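(* Let $M\subset\mathbb{R}^N$ be a compact $C^2$ submanifold of dimension $m$ and $\mathcal{P}\subset M$ a finite set meeting every connected component of $M$. Let $\mathcal{A}$ be a simplicial complex (of Euclidean simplices) whose vertex set is identified with $\mathcal{P}$ by a bijection such that the resulting piecewise linear map $\iota\colon|\mathcal{A}|\to\mathbb{R}^N$ restricts to an embedding on $|\mathrm{st}(p)|$ for every vertex $p$. Suppose: (a) for each $p\in\mathcal{P}$, the orthogonal projection $\pi_{T_pM}$ restricted to $\iota(|\mathrm{st}(p)|)$ is an embedding and $p$ lies in the interior of $\pi_{T_pM}(\iota(|\mathrm{st}(p)|))$ (within the $m$-flat $T_pM$); (b) there are constants $0<t_0\le1$, $0<\mu_0\le1$, $\epsilon_0>0$ with $\epsilon_0\le\mu_0^{1/2}t_0^2/18$ such that every simplex $\sigma\in\iota(\mathcal{A})$ of positive dimension and every vertex $p$ of $\sigma$ satisfy $t(\sigma)\ge t_0$ and $\mu_0\epsilon_0\,\mathrm{lfs}(p)\le L(\sigma)\le\epsilon_0\,\mathrm{lfs}(p)$; (c) for any vertices $p,q\in\mathcal{P}$ with $q\in B(p,\mathrm{lfs}(p)/15)\cap M$: $\pi_{T_pM}(q)\in\pi_{T_pM}(\iota(|\mathrm{st}(p)|))$ if and only if $q$ is a vertex of $\mathrm{st}(p)$. Then: (1) $\iota$ is an embedding, so $\mathcal{A}$ may be identified with $\iota(\mathcal{A})$; (2) the closest-point projection $\pi_M|_{|\mathcal{A}|}\colon|\mathcal{A}|\to M$ is a homeomorphism; (3) for every $x\in\sigma\in\mathcal{A}$,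 with $\check x=\pi_M(x)$, $$d_M(x)=\|\check x-x\|\le\tfrac73\epsilon_0^2\,\mathrm{lfs}(\check x),\qquad \sin\angle(\sigma,T_{\check x}M)\le\frac{13\epsilon_0}{4t_0}.$$
   Context: $\mathrm{st}(p)$ is the subcomplex of simplices containing the vertex $p$ together with their faces. The medial axis of $M$ is the set of points of $\mathbb{R}^N$ with more than one closest point on $M$; $U_M$ is the complement of its closure; $\pi_M\colon U_M\to M$ is the closest-point projection; $d_M(x)=\mathrm{dist}(x,M)$. The local feature size $\mathrm{lfs}(y)$ of $y\in M$ is the distance from $y$ to the medial axis. $T_pM$ is viewed as an affine $m$-flat through $p$ in $\mathbb{R}^N$, and $\pi_{T_pM}$ is orthogonal projection onto it. For a $j$-simplex, $L$ is the longest edge length, $a$ the smallest altitude, $t=a/(jL)$. $\angle(\sigma,T)$ is the angle between the linear subspace parallel to the affine hull of $\sigma$ and that parallel to $T$, where for subspaces $\angle(K,L)=\sup_{u\in K\setminus0}\angle(u,\pi_L(u))$. *)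

theory Defs
  imports "HOL-Analysis.Analysis" "HOL-Library.Extended_Real"
begin

definition C2_on :: "'a::euclidean_space set \<Rightarrow> ('a \<Rightarrow> 'b::euclidean_space) \<Rightarrow> bool" where
  "C2_on U f \<longleftrightarrow> open U \<and>
     (\<exists>f' :: 'a \<Rightarrow> ('a \<Rightarrow>\<^sub>L 'b). \<exists>f'' :: 'a \<Rightarrow> ('a \<Rightarrow>\<^sub>L ('a \<Rightarrow>\<^sub>L 'b)).
        (\<forall>x\<in>U. (f has_derivative blinfun_apply (f' x)) (at x)) \<and>
        (\<forall>x\<in>U. (f' has_derivative blinfun_apply (f'' x)) (at x)) \<and>
        continuous_on U f'')"

definition C2_submanifold :: "'a::euclidean_space set \<Rightarrow> nat \<Rightarrow> bool" where
  "C2_submanifold M m \<longleftrightarrow>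
     (\<forall>p\<in>M. \<exists>(E::'a set) U V \<phi> \<psi>. subspace E \<and> dim E = m \<and> open U \<and> open V \<and> p \<in> V \<and>
        C2_on U \<phi> \<and> (\<forall>x\<in>U \<inter> E. inj_on (frechet_derivative \<phi> (at x)) E) \<and>
        homeomorphism (U \<inter> E) (M \<inter> V) \<phi> \<psi>)"

definition tangent_space :: "'a::euclidean_space set \<Rightarrow> 'a \<Rightarrow> 'a set" where
  "tangent_space M p = {v. \<exists>\<gamma> :: real \<Rightarrow> 'a. \<gamma> 0 = p \<and> (\<gamma> has_vector_derivative v) (at 0) \<and>
        (\<exists>e>0. \<forall>t. \<bar>t\<bar> < e \<longrightarrow> \<gamma> t \<in> M)}"

definition tangent_flat :: "'a::euclidean_space set \<Rightarrow> 'a \<Rightarrow> 'a set" where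
  "tangent_flat M p = (\<lambda>v. p + v) ` tangent_space M p"

definition medial_axis :: "'a::euclidean_space set \<Rightarrow> 'a set" where
  "medial_axis M = {x. \<exists>y z. y \<in> M \<and> z \<in> M \<and> y \<noteq> z \<and>
                        dist x y = infdist x M \<and> dist x z = infdist x M}"

definition U_set :: "'a::euclidean_space set \<Rightarrow> 'a set" where
  "U_set M = - closure (medial_axis M)"

definition lfs :: "'a::euclidean_space set \<Rightarrow> 'a \<Rightarrow> ereal" where
  "lfs M y = (if medial_axis M = {} then \<infinity> else ereal (infdist y (medial_axis M)))"

text \<open>Closest-point projection pi_M (also used for orthogonal projection onto flats):
  the library's closest_point.\<close>

definition vec_angle :: "'a::euclidean_space \<Rightarrow> 'a \<Rightarrow> real" where
  "vec_angle u v = (if u = 0 \<or> v = 0 then pi / 2 else arccos ((u \<bullet> v) / (norm u * norm v)))"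

definition subspace_angle :: "'a::euclidean_space set \<Rightarrow> 'a set \<Rightarrow> real" where
  "subspace_angle K L = (if K - {0} = {} then 0
      else Sup ((\<lambda>u. vec_angle u (closest_point L u)) ` (K - {0})))"

definition direction :: "'a::euclidean_space set \<Rightarrow> 'a set" where
  "direction A = {x - y | x y. x \<in> A \<and> y \<in> A}"

text \<open>For a simplex given by its finite vertex set V: longest edge L, smallest altitude a,
  thickness t = a/(j L) where j = card V - 1 is the dimension.\<close>
definition longest_edge :: "'a::euclidean_space set \<Rightarrow> real" where
  "longest_edge V = Max {dist x y | x y. x \<in> V \<and> y \<in> V}"

definition altitude :: "'a::euclidean_space set \<Rightarrow> 'a \<Rightarrow> real" where
  "altitude V x = infdist x (affine hull (V - {x}))"

definition min_altitude :: "'a::euclidean_space set \<Rightarrow> real" where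
  "min_altitude V = Min (altitude V ` V)"

definition thickness :: "'a::euclidean_space set \<Rightarrow> real" where
  "thickness V = min_altitude V / (real (card V - 1) * longest_edge V)"

text \<open>A simplicial complex of Euclidean simplices, given by the vertex sets of its simplices
  (each simplex is the convex hull of its vertex set).\<close>
definition geom_complex :: "'b::euclidean_space set set \<Rightarrow> bool" where
  "geom_complex K \<longleftrightarrow>
     (\<forall>S\<in>K. S \<noteq> {} \<and> finite S \<and> \<not> affine_dependent S) \<and>
     (\<forall>S\<in>K. \<forall>T. T \<noteq> {} \<and> T \<subseteq> S \<longrightarrow> T \<in> K) \<and>
     (\<forall>S\<in>K. \<forall>T\<in>K. convex hull S \<inter> convex hull T = convex hull (S \<inter> T))"

definition polyhedron :: "'b::euclidean_space set set \<Rightarrow> 'b set" where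
  "polyhedron K = (\<Union>S\<in>K. convex hull S)"

text \<open>|st(w)|: union of simplices containing vertex w (faces are contained in them).\<close>
definition star_set :: "'b::euclidean_space set set \<Rightarrow> 'b \<Rightarrow> 'b set" where
  "star_set K w = (\<Union>S\<in>{S\<in>K. w \<in> S}. convex hull S)"

definition star_vertices :: "'b::euclidean_space set set \<Rightarrow> 'b \<Rightarrow> 'b set" where
  "star_vertices K w = (\<Union>{S\<in>K. w \<in> S})"

definition pl_extension :: "'b::euclidean_space set set \<Rightarrow> ('b \<Rightarrow> 'a::euclidean_space) \<Rightarrow> ('b \<Rightarrow> 'a) \<Rightarrow> bool" where
  "pl_extension K v \<iota> \<longleftrightarrow>
     (\<forall>S\<in>K. \<forall>u. (\<forall>s\<in>S. 0 \<le> u s) \<and> sum u S = 1 \<longrightarrow>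
        \<iota> (\<Sum>s\<in>S. u s *\<^sub>R s) = (\<Sum>s\<in>S. u s *\<^sub>R v s))"

definition embedding_on :: "'b::topological_space set \<Rightarrow> ('b \<Rightarrow> 'a::topological_space) \<Rightarrow> bool" where
  "embedding_on S f \<longleftrightarrow> (\<exists>g. homeomorphism S (f ` S) f g)"

end

theory Submission
  imports Defs
begin

text \<open>
  Write \<open>H = \<pi>\<^sub>M \<circ> \<iota>\<close>. A Brouwer fixed-point argument shows that normal rays of \<open>M\<close> can be prolonged until
  they come close to the medial axis, so balls tangent to \<open>M\<close> at \<open>y\<close> of radius \<open>lfs y\<close> contain no point
  of \<open>M\<close>. Applied at the foot \<open>\<pi>\<^sub>M x\<close> of a point \<open>x\<close> of a simplex with vertices on \<open>M\<close>, this
  bounds \<open>d\<^sub>M x\<close> and, with Whitney's angle bound, the angle between the simplex and the tangent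
  space at the foot; no separate estimate for the variation of tangent spaces is needed.

  Over a convex piece of \<open>T\<^sub>pM\<close> covered by the projected star of \<open>p\<close>, the star is the graph of a map with small
  Lipschitz constant. This makes \<open>H\<close> locally injective, hence by invariance of domain a local
  homeomorphism. The number of preimages under a local homeomorphism of a compact space is locally
  constant where it is one, so it suffices that each \<open>p \<in> P\<close> has a single preimage. If \<open>H x = p\<close>, let
  \<open>q\<close> be the vertex with the largest barycentric coordinate at \<open>x\<close>. The vector \<open>x - p\<close> is normal at \<open>p\<close>,
  so its projection to \<open>T\<^sub>qM\<close> has length \<open>O(\<epsilon>\<^sub>0\<^sup>3 lfs q)\<close>, far less than the size of the simplices at
  \<open>q\<close>; thus \<open>p\<close> projects into the open star of \<open>q\<close>, and condition (c) forces \<open>p = q\<close> and \<open>x = p\<close>.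
\<close>

subsection \<open>Orthogonal projection onto subspaces and flats\<close>

text \<open>The projected star of a vertex is only known to be a neighbourhood of one point, of
  unknown size and shape, and slopes are controlled only inside single simplices. So estimates are
  continued along segments. Inside a ball known to be covered this yields the Lipschitz graph; along
  a segment not known to be covered, positivity of the coordinate at the apex keeps the lifted path
  in the open star. Tangent data at a vertex and at a foot meet only through a simplex: a vector
  tangent at the vertex is replaced by a direction of a simplex containing the point, and this
  direction is nearly tangent at the foot. The bound on \<epsilon>0 is used at two strengths. For
  angles and local injectivity \<open>\<epsilon>0 / t0 \<le> 1 / 18\<close> is enough. The full form
  \<open>324 * \<epsilon>0^2 \<le> \<mu>0 * t0^4\<close> enters for vertices, where a displacement
  of order \<open>\<epsilon>0^3 * lfs / t0\<close> is compared with altitudes of order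
  \<open>\<mu>0 * \<epsilon>0 * t0 * lfs\<close>.\<close>

lemma closest_point_subspaceI:
  fixes V :: "'a::euclidean_space set"
  assumes "subspace V" "z \<in> V" "\<And>y. y \<in> V \<Longrightarrow> (x - z) \<bullet> y = 0"
  shows "closest_point V x = z"
proof -
  have "dist x z \<le> dist x y" if "y \<in> V" for y
  proof -
    have "orthogonal (x - z) (z - y)"
      using assms that by (simp add: orthogonal_def subspace_diff)
    then have "(norm (x - z + (z - y)))\<^sup>2 = (norm (x - z))\<^sup>2 + (norm (z - y))\<^sup>2"
      by (rule norm_add_Pythagorean)
    then have "(norm (x - z))\<^sup>2 \<le> (norm (x - y))\<^sup>2" by simp
    then show ?thesis by (simp add: dist_norm)
  qed
  then show ?thesis
    using closest_point_unique[of V z x] assms(1,2) closed_subspace subspace_imp_convex by metis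
qed

lemma closest_point_subspace:
  fixes V :: "'a::euclidean_space set"
  assumes "subspace V"
  shows closest_point_subspace_in: "closest_point V x \<in> V"
    and closest_point_subspace_orth: "y \<in> V \<Longrightarrow> (x - closest_point V x) \<bullet> y = 0"
proof -
  obtain z w where z: "z \<in> span V" and w: "\<And>u. u \<in> span V \<Longrightarrow> orthogonal w u" and x: "x = z + w"
    using orthogonal_subspace_decomp_exists[of V x] by metis
  have V: "span V = V" using assms by (simp add: span_eq_iff)
  have eq: "closest_point V x = z"
    by (rule closest_point_subspaceI[OF assms]) (use z w x V in \<open>auto simp: orthogonal_def\<close>)
  show "closest_point V x \<in> V" using eq z V by simp
  show "y \<in> V \<Longrightarrow> (x - closest_point V x) \<bullet> y = 0"
    unfolding eq using w[of y] x V by (simp add: orthogonal_def)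
qed

lemma linear_closest_point_subspace:
  fixes V :: "'a::euclidean_space set"
  assumes "subspace V"
  shows "linear (closest_point V)"
proof (rule linearI)
  note c = closest_point_subspace[OF assms]
  show "closest_point V (x + y) = closest_point V x + closest_point V y" for x y
  proof (rule closest_point_subspaceI[OF assms])
    show "closest_point V x + closest_point V y \<in> V" using c assms by (simp add: subspace_add)
    fix u assume "u \<in> V"
    then show "(x + y - (closest_point V x + closest_point V y)) \<bullet> u = 0"
      using c(2)[of u x] c(2)[of u y] by (simp add: inner_diff_left inner_add_left)
  qed
  show "closest_point V (r *\<^sub>R x) = r *\<^sub>R closest_point V x" for r x
  proof (rule closest_point_subspaceI[OF assms])
    show "r *\<^sub>R closest_point V x \<in> V" using c assms by (simp add: subspace_scale)
    fix u assume "u \<in> V"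
    then show "(r *\<^sub>R x - r *\<^sub>R closest_point V x) \<bullet> u = 0"
      using c(2)[of u x] by (simp add: inner_diff_left)
  qed
qed

lemma closest_point_flat:
  fixes V :: "'a::euclidean_space set"
  assumes "subspace V"
  shows "closest_point ((\<lambda>v. p + v) ` V) x = p + closest_point V (x - p)"
proof -
  let ?F = "(\<lambda>v. p + v) ` V"
  have "convex ?F" "closed ?F"
    using assms by (auto simp: subspace_imp_convex closed_subspace closed_translation convex_translation)
  moreover have "p + closest_point V (x - p) \<in> ?F"
    using closest_point_subspace_in[OF assms] by blast
  moreover have "\<forall>z\<in>?F. dist x (p + closest_point V (x - p)) \<le> dist x z"
  proof
    fix z assume "z \<in> ?F"
    then obtain y where y: "y \<in> V" "z = p + y" by blast
    have "dist (x - p) (closest_point V (x - p)) \<le> dist (x - p) y"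
      using closest_point_le[OF closed_subspace[OF assms] y(1)] .
    then show "dist x (p + closest_point V (x - p)) \<le> dist x z"
      using y(2) by (simp add: dist_norm algebra_simps)
  qed
  ultimately show ?thesis using closest_point_unique[of ?F _ x] by metis
qed

lemma norm_closest_point_subspace:
  fixes V :: "'a::euclidean_space set"
  assumes "subspace V"
  shows "(norm u)\<^sup>2 = (norm (closest_point V u))\<^sup>2 + (norm (u - closest_point V u))\<^sup>2"
    and "u \<bullet> closest_point V u = (norm (closest_point V u))\<^sup>2"
    and "u \<bullet> (u - closest_point V u) = (norm (u - closest_point V u))\<^sup>2"
    and "norm (closest_point V u) \<le> norm u"
proof -
  let ?c = "closest_point V u"
  have o: "(u - ?c) \<bullet> ?c = 0"
    using closest_point_subspace[OF assms] by blast
  have "orthogonal ?c (u - ?c)" using o by (simp add: orthogonal_def inner_commute)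
  from norm_add_Pythagorean[OF this]
  show eq: "(norm u)\<^sup>2 = (norm ?c)\<^sup>2 + (norm (u - ?c))\<^sup>2" by simp
  show "u \<bullet> ?c = (norm ?c)\<^sup>2"
    using o by (simp add: inner_diff_left power2_norm_eq_inner)
  show "u \<bullet> (u - ?c) = (norm (u - ?c))\<^sup>2"
    using o by (simp add: inner_diff_left inner_diff_right inner_commute power2_norm_eq_inner)
  show "norm ?c \<le> norm u"
    using eq by (smt (verit) norm_ge_zero power2_le_imp_le zero_le_power2)
qed

subsection \<open>Nearest points off the medial axis\<close>

lemma closest_point_infdist:
  fixes M :: "'a::euclidean_space set"
  assumes "closed M" "M \<noteq> {}"
  shows "closest_point M x \<in> M" "dist x (closest_point M x) = infdist x M"
    "z \<in> M \<Longrightarrow> infdist x M \<le> dist x z"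
proof -
  show "closest_point M x \<in> M" using assms by (rule closest_point_in_set)
  then have "infdist x M \<le> dist x (closest_point M x)" by (rule infdist_le)
  moreover have "dist x (closest_point M x) \<le> infdist x M"
    using assms closest_point_le by (metis infdist_notempty cINF_greatest)
  ultimately show "dist x (closest_point M x) = infdist x M" by simp
  show "z \<in> M \<Longrightarrow> infdist x M \<le> dist x z" by (rule infdist_le)
qed

lemma closest_point_unique_off_medial_axis:
  fixes M :: "'a::euclidean_space set"
  assumes "closed M" "x \<notin> medial_axis M" "y \<in> M" "\<And>z. z \<in> M \<Longrightarrow> dist x y \<le> dist x z"
  shows "closest_point M x = y"
proof -
  have ne: "M \<noteq> {}" using assms by auto
  note c = closest_point_infdist[OF assms(1) ne]
  have "dist x y = infdist x M"
    using c assms(3,4) by (metis order_antisym)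
  then show ?thesis
    using assms(2,3) c unfolding medial_axis_def by blast
qed

text \<open>A map into a compact set is continuous once its graph is closed. Uniqueness of the
  nearest point makes the graph the solution set of one closed equation between distances.\<close>

lemma continuous_on_closest_point_off_medial_axis:
  fixes M :: "'a::euclidean_space set"
  assumes "compact M"
  shows "continuous_on (- medial_axis M) (closest_point M)"
proof (cases "M = {}")
  case True
  have "closest_point M = (\<lambda>x. SOME y. False)" by (auto simp: closest_point_def True)
  then show ?thesis by (metis continuous_on_const)
next
  case ne: False
  let ?S = "- medial_axis M"
  have cl: "closed M" using assms compact_imp_closed by blast
  note c = closest_point_infdist[OF cl ne]
  have graph: "(\<lambda>x. (x, closest_point M x)) ` ?S
      = (?S \<times> M) \<inter> {z. dist (fst z) (snd z) = infdist (fst z) M}"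
  proof (intro equalityI subsetI)
    fix z assume z: "z \<in> (?S \<times> M) \<inter> {z. dist (fst z) (snd z) = infdist (fst z) M}"
    then have "closest_point M (fst z) = snd z"
      by (intro closest_point_unique_off_medial_axis) (auto simp: cl c)
    then show "z \<in> (\<lambda>x. (x, closest_point M x)) ` ?S" using z by (cases z) auto
  qed (use c in auto)
  have "closed {z::'a\<times>'a. dist (fst z) (snd z) = infdist (fst z) M}"
    by (intro closed_Collect_eq continuous_intros)
  then have "closedin (top_of_set (?S \<times> M)) ((\<lambda>x. (x, closest_point M x)) ` ?S)"
    unfolding graph by (rule closedin_closed_Int)
  then show ?thesis
    using continuous_closed_graph_eq[of M "closest_point M" ?S] assms c by auto
qed

lemma nearest_on_segment:
  fixes y :: "'a::euclidean_space"
  assumes "\<And>w. w \<in> M \<Longrightarrow> dist z y \<le> dist z w" "x \<in> closed_segment y z" "w \<in> M"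
  shows "dist x y \<le> dist x w"
proof -
  have "dist z y = dist z x + dist x y"
    using assms(2) by (metis between between_mem_segment dist_commute add.commute)
  then show ?thesis using assms(1)[OF assms(3)] dist_triangle[of z w x] by linarith
qed

text \<open>A Brouwer fixed point \<open>z\<close> of the map sending \<open>z\<close> to the point of the sphere around \<open>x\<close>
  opposite to \<open>\<pi>\<^sub>M(z)\<close> has \<open>x\<close> on the segment from \<open>z\<close> to \<open>\<pi>\<^sub>M(z)\<close>, so normal rays can be prolonged.\<close>
lemma closest_point_extend_ray:
  fixes M :: "'a::euclidean_space set"
  assumes "compact M" "M \<noteq> {}" "x \<notin> M" "0 < d" and disj: "cball x d \<inter> medial_axis M = {}"
    and w: "w \<in> M"
  shows "dist (x + (d / norm (x - closest_point M x)) *\<^sub>R (x - closest_point M x)) (closest_point M x)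
       \<le> dist (x + (d / norm (x - closest_point M x)) *\<^sub>R (x - closest_point M x)) w"
proof -
  let ?p = "closest_point M"
  have cl: "closed M" using assms compact_imp_closed by blast
  note c = closest_point_infdist[OF cl assms(2)]
  define f where "f z = x + (d / norm (x - ?p z)) *\<^sub>R (x - ?p z)" for z
  have ne: "x \<noteq> ?p z" for z using c(1)[of z] assms(3) by auto
  have cont: "continuous_on (cball x d) ?p"
    by (rule continuous_on_subset[OF continuous_on_closest_point_off_medial_axis[OF assms(1)]])
      (use disj in auto)
  have "continuous_on (cball x d) f"
    unfolding f_def by (intro continuous_intros cont) (use ne in auto)
  moreover have "f \<in> cball x d \<rightarrow> cball x d"
    using ne \<open>0 < d\<close> by (auto simp: f_def dist_norm)
  ultimately obtain z where z: "z \<in> cball x d" "f z = z"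
    using brouwer[of "cball x d" f] \<open>0 < d\<close> by auto
  have near: "dist z (?p z) \<le> dist z w" if "w \<in> M" for w
    using c(2)[of z] c(3)[OF that, of z] by simp
  have "x \<in> closed_segment (?p z) z"
  proof -
    define s where "s = norm (x - ?p z)"
    have s: "s > 0" using ne by (simp add: s_def)
    have "x + (d / s) *\<^sub>R (x - ?p z) = z" using z(2) unfolding f_def s_def .
    then have "z - ?p z = (x + (d / s) *\<^sub>R (x - ?p z)) - ?p z" by (rule arg_cong[OF sym])
    also have "\<dots> = (1 + d / s) *\<^sub>R (x - ?p z)" by (simp add: algebra_simps)
    finally have "(s / (s + d)) *\<^sub>R (z - ?p z) = ((s / (s + d)) * (1 + d / s)) *\<^sub>R (x - ?p z)"
      by (simp only: scaleR_scaleR)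
    moreover have "(s / (s + d)) * (1 + d / s) = 1"
    proof -
      have "s \<noteq> 0" "s + d \<noteq> 0" using s \<open>0 < d\<close> by auto
      moreover from this have "1 + d / s = (s + d) / s" by (simp add: add_divide_distrib)
      ultimately show ?thesis by simp
    qed
    ultimately have "(s / (s + d)) *\<^sub>R (z - ?p z) = x - ?p z" by (simp only: scaleR_one)
    then have "x = ?p z + (s / (s + d)) *\<^sub>R (z - ?p z)" by simp
    also have "\<dots> = (1 - s / (s + d)) *\<^sub>R ?p z + (s / (s + d)) *\<^sub>R z"
      by (simp add: algebra_simps)
    finally have "x = (1 - s / (s + d)) *\<^sub>R ?p z + (s / (s + d)) *\<^sub>R z" .
    moreover have "0 \<le> s / (s + d)" "s / (s + d) \<le> 1" using s \<open>0 < d\<close> by auto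
    ultimately show ?thesis unfolding in_segment by (intro exI[of _ "s / (s + d)"] conjI)
  qed
  then have nx: "dist x (?p z) \<le> dist x w" if "w \<in> M" for w
    using nearest_on_segment[of M z "?p z" x w] near that by simp
  have "x \<notin> medial_axis M"
  proof
    assume "x \<in> medial_axis M"
    moreover have "x \<in> cball x d" using \<open>0 < d\<close> by simp
    ultimately have "x \<in> cball x d \<inter> medial_axis M" by (rule IntI[rotated])
    then show False using disj by simp
  qed
  then have eq: "?p x = ?p z"
    by (rule closest_point_unique_off_medial_axis[OF cl _ c(1) nx])
  have "x + (d / norm (x - ?p x)) *\<^sub>R (x - ?p x) = z" using z(2) unfolding f_def eq .
  then show ?thesis using near[OF w] by (simp only: eq)
qed

subsection \<open>Tangent spaces\<close>

text \<open>Differentiability of the derivative at \<open>x0\<close> makes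
  \<open>f' y - f' x0\<close> at most a multiple of \<open>norm (y - x0)\<close>; the mean value
  inequality for \<phi> minus its linear part then gives a quadratic remainder.\<close>

lemma C2_on_Taylor:
  assumes "C2_on U \<phi>" "x0 \<in> U"
  obtains B r where "0 < r" "0 \<le> B" "ball x0 r \<subseteq> U" "bounded_linear (frechet_derivative \<phi> (at x0))"
    "\<And>x. norm (x - x0) < r \<Longrightarrow> norm (\<phi> x - \<phi> x0 - frechet_derivative \<phi> (at x0) (x - x0)) \<le> B * (norm (x - x0))\<^sup>2"
proof -
  obtain f' f'' where oU: "open U"
    and f': "\<And>x. x \<in> U \<Longrightarrow> (\<phi> has_derivative blinfun_apply (f' x)) (at x)"
    and f'': "\<And>x. x \<in> U \<Longrightarrow> (f' has_derivative blinfun_apply (f'' x)) (at x)"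
    using assms(1) unfolding C2_on_def by blast
  have D: "frechet_derivative \<phi> (at x0) = blinfun_apply (f' x0)"
    using frechet_derivative_at[OF f'[OF assms(2)]] by simp
  obtain r1 where r1: "r1 > 0" "ball x0 r1 \<subseteq> U"
    using oU assms(2) open_contains_ball by blast
  obtain r2 where r2: "r2 > 0"
    "\<And>y. norm (y - x0) < r2 \<Longrightarrow> norm (f' y - f' x0 - f'' x0 (y - x0)) \<le> 1 * norm (y - x0)"
    using f''[OF assms(2)] unfolding has_derivative_at_alt by (metis zero_less_one)
  define B where "B = norm (f'' x0) + 1"
  have lip: "norm (f' y - f' x0) \<le> B * norm (y - x0)" if "norm (y - x0) < r2" for y
  proof -
    have "norm (f'' x0 (y - x0)) \<le> norm (f'' x0) * norm (y - x0)" by (rule norm_blinfun)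
    then have "norm (f' y - f' x0) \<le> norm (f'' x0) * norm (y - x0) + 1 * norm (y - x0)"
      using r2(2)[OF that] norm_triangle_sub[of "f' y - f' x0" "f'' x0 (y - x0)"] by linarith
    then show ?thesis by (simp add: B_def algebra_simps)
  qed
  show ?thesis
  proof
    show "0 < min r1 r2" using r1 r2 by simp
    show "0 \<le> B" by (simp add: B_def)
    show "ball x0 (min r1 r2) \<subseteq> U" using r1 by auto
    show "bounded_linear (frechet_derivative \<phi> (at x0))"
      unfolding D by (rule blinfun.bounded_linear_right)
    fix x assume x: "norm (x - x0) < min r1 r2"
    let ?S = "cball x0 (norm (x - x0))"
    let ?g = "\<lambda>x. \<phi> x - f' x0 x"
    have "norm (?g x - ?g x0) \<le> (B * norm (x - x0)) * norm (x - x0)"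
    proof (rule differentiable_bound[where S = ?S])
      fix y assume y: "y \<in> ?S"
      then have ny: "norm (y - x0) \<le> norm (x - x0)" by (simp add: dist_norm norm_minus_commute)
      then have "y \<in> U" using x r1(2) by (auto simp: dist_norm norm_minus_commute)
      then show "(?g has_derivative blinfun_apply (f' y - f' x0)) (at y within ?S)"
        using has_derivative_diff[OF has_derivative_at_withinI[OF f']
            bounded_linear_imp_has_derivative[OF blinfun.bounded_linear_right]]
        by (simp add: blinfun.diff_left[abs_def])
      have "norm (f' y - f' x0) \<le> B * norm (y - x0)" using lip ny x by auto
      also have "\<dots> \<le> B * norm (x - x0)" using ny by (simp add: B_def mult_left_mono)
      finally show "onorm (blinfun_apply (f' y - f' x0)) \<le> B * norm (x - x0)"
        by (simp add: norm_blinfun.rep_eq)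
    qed (auto simp: dist_norm norm_minus_commute)
    then show "norm (\<phi> x - \<phi> x0 - frechet_derivative \<phi> (at x0) (x - x0)) \<le> B * (norm (x - x0))\<^sup>2"
      unfolding D by (simp add: blinfun.diff_right power2_eq_square algebra_simps)
  qed
qed

text \<open>Condenses a chart into what tangent spaces and small tangent balls require: a linear
  model with quadratic error in both directions. The return direction rests on the lower bound
  \<open>c * norm e\<close> for the injective derivative.\<close>

lemma C2_submanifold_linearize:
  fixes M :: "'a::euclidean_space set"
  assumes "C2_submanifold M m" "p \<in> M"
  obtains E :: "'a set" and D B r where "subspace E" "dim E = m" "linear D" "inj_on D E" "0 < r" "0 \<le> (B::real)"
    "\<And>e. e \<in> E \<Longrightarrow> norm e < r \<Longrightarrow> \<exists>z\<in>M. norm (z - p - D e) \<le> B * (norm e)\<^sup>2"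
    "\<And>z. z \<in> M \<Longrightarrow> norm (z - p) < r \<Longrightarrow>
        \<exists>e\<in>E. norm e \<le> B * norm (z - p) \<and> norm (z - p - D e) \<le> B * (norm e)\<^sup>2"
proof -
  obtain E :: "'a set" and U V \<phi> \<psi> where E: "subspace E" "dim E = m" and UV: "open U" "open V" "p \<in> V"
    and C2: "C2_on U \<phi>" and inj: "\<forall>x\<in>U \<inter> E. inj_on (frechet_derivative \<phi> (at x)) E"
    and hom: "homeomorphism (U \<inter> E) (M \<inter> V) \<phi> \<psi>"
    using assms(1)[unfolded C2_submanifold_def, rule_format, OF assms(2)] by blast
  define x0 where "x0 = \<psi> p"
  have x0: "x0 \<in> U" "x0 \<in> E" "\<phi> x0 = p"
    using hom assms(2) UV(3) unfolding x0_def homeomorphism_def by auto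
  obtain B0 r0 where r0: "0 < r0" "0 \<le> B0" "ball x0 r0 \<subseteq> U"
    and bl: "bounded_linear (frechet_derivative \<phi> (at x0))"
    and T: "\<And>x. norm (x - x0) < r0 \<Longrightarrow>
       norm (\<phi> x - \<phi> x0 - frechet_derivative \<phi> (at x0) (x - x0)) \<le> B0 * (norm (x - x0))\<^sup>2"
    using C2_on_Taylor[OF C2 x0(1)] by metis
  let ?D = "frechet_derivative \<phi> (at x0)"
  have injD: "inj_on ?D E" using inj x0 by blast
  have lin: "linear ?D" using bl by (simp add: bounded_linear.linear)
  have "\<forall>x\<in>E. ?D x = 0 \<longrightarrow> x = 0"
    using injD linear_0[OF lin] subspace_0[OF E(1)] by (metis inj_onD)
  then obtain c where c: "c > 0" "\<And>x. x \<in> E \<Longrightarrow> norm (?D x) \<ge> c * norm x"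
    using injective_imp_isometric[OF closed_subspace[OF E(1)] E(1) bl] by metis
  \<comment> \<open>Within \<rho> the quadratic error is at most half of \<open>c * norm e\<close>,
    so it can be absorbed and \<open>norm e\<close> is bounded by \<open>2 / c\<close> times
    \<open>norm (z - p)\<close>.\<close>
  define \<rho> where "\<rho> = min r0 (c / (2 * (B0 + 1)))"
  have \<rho>: "\<rho> > 0" using r0 c by (simp add: \<rho>_def)
  have "continuous_on (M \<inter> V) \<psi>" using hom by (simp add: homeomorphism_def)
  from this[unfolded continuous_on_iff, rule_format, of p \<rho>]
  obtain r1 where r1: "r1 > 0" "\<And>z. z \<in> M \<inter> V \<Longrightarrow> dist z p < r1 \<Longrightarrow> dist (\<psi> z) x0 < \<rho>"
    using \<rho> assms(2) UV(3) unfolding x0_def by blast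
  obtain r2 where r2: "r2 > 0" "ball p r2 \<subseteq> V" using UV open_contains_ball by blast
  define r where "r = min r0 (min r1 r2)"
  define B where "B = max B0 (2 / c)"
  have BB: "B0 \<le> B" "2 / c \<le> B" by (auto simp: B_def)
  show ?thesis
  proof
    show "subspace E" "dim E = m" "linear ?D" "inj_on ?D E" using E lin injD by auto
    show "0 < r" using r0 r1 r2 by (simp add: r_def)
    show "0 \<le> B" using r0(2) BB(1) by linarith
    show "\<exists>z\<in>M. norm (z - p - ?D e) \<le> B * (norm e)\<^sup>2" if e: "e \<in> E" "norm e < r" for e
    proof
      have "x0 + e \<in> U \<inter> E"
        using e x0 E r0(3) subspace_add by (auto simp: r_def dist_norm subset_iff)
      then show "\<phi> (x0 + e) \<in> M" using hom by (auto simp: homeomorphism_def)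
      have "norm (\<phi> (x0 + e) - p - ?D e) \<le> B0 * (norm e)\<^sup>2"
        using T[of "x0 + e"] e x0(3) by (simp add: r_def)
      also have "\<dots> \<le> B * (norm e)\<^sup>2" using BB(1) by (simp add: mult_right_mono)
      finally show "norm (\<phi> (x0 + e) - p - ?D e) \<le> B * (norm e)\<^sup>2" .
    qed
    show "\<exists>e\<in>E. norm e \<le> B * norm (z - p) \<and> norm (z - p - ?D e) \<le> B * (norm e)\<^sup>2"
      if z: "z \<in> M" "norm (z - p) < r" for z
    proof
      let ?e = "\<psi> z - x0"
      have zV: "z \<in> M \<inter> V"
        using z r2(2) by (auto simp: r_def dist_norm norm_minus_commute subset_iff)
      then have pz: "\<psi> z \<in> U \<inter> E" "\<phi> (\<psi> z) = z" using hom by (auto simp: homeomorphism_def)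
      then show eE: "?e \<in> E" using x0 E subspace_diff by blast
      have small: "norm ?e < \<rho>" using r1(2)[OF zV] z(2) by (simp add: r_def dist_norm)
      have t: "norm (z - p - ?D ?e) \<le> B0 * (norm ?e)\<^sup>2"
        using T[of "\<psi> z"] small pz(2) x0(3) by (simp add: \<rho>_def)
      have "B0 * norm ?e \<le> B0 * (c / (2 * (B0 + 1)))"
        using small r0(2) by (intro mult_left_mono) (auto simp: \<rho>_def)
      also have "\<dots> \<le> c / 2" using r0(2) c(1) by (simp add: field_simps)
      finally have "B0 * norm ?e * norm ?e \<le> c / 2 * norm ?e" by (rule mult_right_mono) simp
      then have "norm (z - p - ?D ?e) \<le> c / 2 * norm ?e"
        using t by (simp add: power2_eq_square mult.assoc)
      moreover have "norm (?D ?e) \<le> norm (z - p) + norm (z - p - ?D ?e)"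
        by (metis norm_triangle_sub norm_minus_commute)
      ultimately have "c / 2 * norm ?e \<le> norm (z - p)" using c(2)[OF eE] by linarith
      then have "norm ?e \<le> 2 / c * norm (z - p)" using c(1) by (simp add: field_simps)
      also have "\<dots> \<le> B * norm (z - p)" using BB(2) by (rule mult_right_mono) simp
      finally have "norm ?e \<le> B * norm (z - p)" .
      moreover have "norm (z - p - ?D ?e) \<le> B * (norm ?e)\<^sup>2"
        using t mult_right_mono[OF BB(1), of "(norm ?e)\<^sup>2"] by simp
      ultimately show "norm ?e \<le> B * norm (z - p) \<and> norm (z - p - ?D ?e) \<le> B * (norm ?e)\<^sup>2" by simp
    qed
  qed
qed

text \<open>For one inclusion a curve is chosen pointwise on \<open>M\<close>, with quadratic error
  and hence the right derivative at 0. For the other, difference quotients of a curve are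
  approximated from the image of \<open>E\<close>, which is closed as a subspace of finite
  dimension.\<close>

lemma tangent_space_eq_image:
  fixes M :: "'a::euclidean_space set"
  assumes pM: "p \<in> M" and E: "subspace E" and D: "linear D" and r: "0 < r" and B: "0 \<le> (B::real)"
    and to: "\<And>e. e \<in> E \<Longrightarrow> norm e < r \<Longrightarrow> \<exists>z\<in>M. norm (z - p - D e) \<le> B * (norm e)\<^sup>2"
    and param: "\<And>z. z \<in> M \<Longrightarrow> norm (z - p) < r \<Longrightarrow>
        \<exists>e\<in>E. norm e \<le> B * norm (z - p) \<and> norm (z - p - D e) \<le> B * (norm e)\<^sup>2"
  shows "tangent_space M p = D ` E"
proof (intro equalityI subsetI)
  fix v assume "v \<in> D ` E"
  then obtain e where e: "e \<in> E" "v = D e" by blast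
  have ex: "\<exists>z. (norm (t *\<^sub>R e) < r \<longrightarrow> z \<in> M) \<and>
      (norm (t *\<^sub>R e) < r \<longrightarrow> norm (z - p - D (t *\<^sub>R e)) \<le> B * (norm (t *\<^sub>R e))\<^sup>2)" for t
    using to[of "t *\<^sub>R e"] e E subspace_scale by blast
  obtain \<gamma> where \<gamma>: "\<And>t. norm (t *\<^sub>R e) < r \<Longrightarrow> \<gamma> t \<in> M"
     "\<And>t. norm (t *\<^sub>R e) < r \<Longrightarrow> norm (\<gamma> t - p - D (t *\<^sub>R e)) \<le> B * (norm (t *\<^sub>R e))\<^sup>2"
    using choice[of "\<lambda>t z. (norm (t *\<^sub>R e) < r \<longrightarrow> z \<in> M) \<and>
      (norm (t *\<^sub>R e) < r \<longrightarrow> norm (z - p - D (t *\<^sub>R e)) \<le> B * (norm (t *\<^sub>R e))\<^sup>2)"] ex by blast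
  have \<gamma>0: "\<gamma> 0 = p" using \<gamma>(2)[of 0] r D by (simp add: linear_0)
  define d where "d = r / (norm e + 1)"
  have d: "d > 0" using r by (simp add: d_def add_nonneg_pos)
  have small: "norm (t *\<^sub>R e) < r" if "\<bar>t\<bar> < d" for t
  proof -
    have "\<bar>t\<bar> * norm e \<le> \<bar>t\<bar> * (norm e + 1)" by (simp add: mult_left_mono)
    also have "\<dots> < r" using that pos_less_divide_eq[of "norm e + 1" "\<bar>t\<bar>" r]
      by (simp add: d_def add_nonneg_pos)
    finally show ?thesis by simp
  qed
  have "(\<gamma> has_vector_derivative v) (at 0)"
    unfolding has_vector_derivative_def has_derivative_at_alt
  proof (intro conjI allI impI)
    show "bounded_linear (\<lambda>x. x *\<^sub>R v)" by (rule bounded_linear_scaleR_left)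
    fix \<epsilon> :: real assume \<epsilon>: "0 < \<epsilon>"
    define q where "q = min d (\<epsilon> / (B * (norm e)\<^sup>2 + 1))"
    have pos: "B * (norm e)\<^sup>2 + 1 > 0" using B by (simp add: add_nonneg_pos)
    show "\<exists>d>0. \<forall>y. norm (y - 0) < d \<longrightarrow> norm (\<gamma> y - \<gamma> 0 - (y - 0) *\<^sub>R v) \<le> \<epsilon> * norm (y - 0)"
    proof (intro exI conjI allI impI)
      show "q > 0" using d \<epsilon> pos by (simp add: q_def)
      fix y :: real assume y: "norm (y - 0) < q"
      have "norm (\<gamma> y - p - D (y *\<^sub>R e)) \<le> B * (norm (y *\<^sub>R e))\<^sup>2"
        using \<gamma>(2) small y by (simp add: q_def)
      also have "\<dots> = \<bar>y\<bar> * (B * (norm e)\<^sup>2) * \<bar>y\<bar>" by (simp add: power2_eq_square)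
      also have "\<dots> \<le> \<epsilon> * \<bar>y\<bar>"
      proof (rule mult_right_mono)
        have "\<bar>y\<bar> * (B * (norm e)\<^sup>2) \<le> \<bar>y\<bar> * (B * (norm e)\<^sup>2 + 1)" by (simp add: mult_left_mono)
        also have "\<dots> \<le> \<epsilon>" using y pos by (simp add: q_def pos_less_divide_eq less_imp_le)
        finally show "\<bar>y\<bar> * (B * (norm e)\<^sup>2) \<le> \<epsilon>" .
      qed simp
      finally show "norm (\<gamma> y - \<gamma> 0 - (y - 0) *\<^sub>R v) \<le> \<epsilon> * norm (y - 0)"
        using e(2) D by (simp add: \<gamma>0 linear_scale)
    qed
  qed
  then show "v \<in> tangent_space M p"
    unfolding tangent_space_def using \<gamma>0 d \<gamma>(1) small by blast
next
  fix v assume "v \<in> tangent_space M p"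
  then obtain \<gamma> d where \<gamma>: "\<gamma> 0 = p" "(\<gamma> has_vector_derivative v) (at 0)" "d > 0"
    "\<And>t. \<bar>t\<bar> < d \<Longrightarrow> \<gamma> t \<in> M"
    unfolding tangent_space_def by blast
  have sub: "subspace (D ` E)" using D E by (rule linear_subspace_image)
  have "v \<in> closure (D ` E)"
    unfolding closure_approachable
  proof (intro allI impI)
    fix \<epsilon> :: real assume \<epsilon>: "0 < \<epsilon>"
    \<comment> \<open>\<open>N\<close> bounds the speed near 0, so the parameter satisfies
      \<open>norm e \<le> B * (t * N)\<close> and the quadratic error is at most
      \<open>t^2 * K\<close>. After division by \<open>t\<close> it vanishes with
      \<open>t\<close>.\<close>
    define N where "N = norm v + 1"
    define K where "K = B * (B * N)\<^sup>2"
    have N: "N > 0" by (simp add: N_def add_nonneg_pos)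
    have K: "K \<ge> 0" using B by (simp add: K_def)
    define \<eta> where "\<eta> = min 1 (\<epsilon> / 3)"
    have \<eta>: "\<eta> > 0" using \<epsilon> by (simp add: \<eta>_def)
    obtain q where q: "q > 0"
      "\<And>y. norm (y - 0) < q \<Longrightarrow> norm (\<gamma> y - \<gamma> 0 - (y - 0) *\<^sub>R v) \<le> \<eta> * norm (y - 0)"
      using \<gamma>(2) \<eta> unfolding has_vector_derivative_def has_derivative_at_alt by blast
    define t where "t = min (q / 2) (min (d / 2) (min (r / (2 * N)) (\<epsilon> / (3 * (K + 1)))))"
    have t0: "t > 0" using q \<gamma>(3) r N \<epsilon> K by (simp add: t_def)
    have tq: "t < q" "t < d" using q(1) \<gamma>(3) by (auto simp: t_def min_less_iff_disj)
    have "t \<le> r / (2 * N)" by (simp add: t_def)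
    then have tr: "t * N \<le> r / 2" using N by (simp add: field_simps)
    have "t \<le> \<epsilon> / (3 * (K + 1))" by (simp add: t_def)
    then have "t * (K + 1) \<le> \<epsilon> / 3" using K by (simp add: field_simps)
    then have tK: "t * K \<le> \<epsilon> / 3" using t0 by (simp add: algebra_simps)
    have a: "norm (\<gamma> t - p - t *\<^sub>R v) \<le> \<eta> * t" using q(2)[of t] tq t0 \<gamma>(1) by simp
    have "\<eta> * t \<le> t" using t0 by (simp add: \<eta>_def)
    moreover have "norm (\<gamma> t - p) \<le> norm (t *\<^sub>R v) + norm (\<gamma> t - p - t *\<^sub>R v)"
      by (metis norm_triangle_sub)
    moreover have "norm (t *\<^sub>R v) = t * N - t" using t0 by (simp add: N_def algebra_simps)
    ultimately have b: "norm (\<gamma> t - p) \<le> t * N" using a by linarith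
    then have "norm (\<gamma> t - p) < r" using tr r by linarith
    then obtain e where e: "e \<in> E" "norm e \<le> B * norm (\<gamma> t - p)"
        "norm (\<gamma> t - p - D e) \<le> B * (norm e)\<^sup>2"
      using param \<gamma>(4)[of t] t0 tq(2) by (metis abs_of_pos)
    have "norm e \<le> B * (t * N)" using e(2) mult_left_mono[OF b B] by linarith
    then have "(norm e)\<^sup>2 \<le> (B * (t * N))\<^sup>2" by (rule power_mono) simp
    then have "B * (norm e)\<^sup>2 \<le> t\<^sup>2 * K"
      using mult_left_mono[OF _ B] by (fastforce simp: K_def power_mult_distrib algebra_simps)
    then have "norm (\<gamma> t - p - D e) \<le> t\<^sup>2 * K" using e(3) by linarith
    then have "norm (t *\<^sub>R v - D e) \<le> \<eta> * t + t\<^sup>2 * K"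
      using a norm_triangle_ineq4[of "\<gamma> t - p - D e" "\<gamma> t - p - t *\<^sub>R v"] by simp
    also have "\<dots> = t * (\<eta> + t * K)" by (simp add: power2_eq_square algebra_simps)
    also have "\<dots> < t * \<epsilon>"
      using t0 tK \<epsilon> by (intro mult_strict_left_mono) (auto simp: \<eta>_def)
    finally have n: "norm (t *\<^sub>R v - D e) < t * \<epsilon>" .
    have "t *\<^sub>R v - D e = t *\<^sub>R (v - (1 / t) *\<^sub>R D e)" using t0 by (simp add: algebra_simps)
    then have "t * norm (v - (1 / t) *\<^sub>R D e) < t * \<epsilon>" using n t0 by simp
    then have "dist ((1 / t) *\<^sub>R D e) v < \<epsilon>" using t0 by (simp add: dist_norm norm_minus_commute)
    moreover have "(1 / t) *\<^sub>R D e \<in> D ` E" using sub e(1) subspace_scale by blast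
    ultimately show "\<exists>y\<in>D ` E. dist y v < \<epsilon>" by blast
  qed
  then show "v \<in> D ` E" using closed_subspace[OF sub] by simp
qed

lemma tangent_space_subspace:
  fixes M :: "'a::euclidean_space set"
  assumes "C2_submanifold M m" "p \<in> M"
  shows "subspace (tangent_space M p)" "dim (tangent_space M p) = m"
proof -
  obtain E :: "'a set" and D B r where *: "subspace E" "dim E = m" "linear D" "inj_on D E" "0 < r" "0 \<le> (B::real)"
    "\<And>e. e \<in> E \<Longrightarrow> norm e < r \<Longrightarrow> \<exists>z\<in>M. norm (z - p - D e) \<le> B * (norm e)\<^sup>2"
    "\<And>z. z \<in> M \<Longrightarrow> norm (z - p) < r \<Longrightarrow>
        \<exists>e\<in>E. norm e \<le> B * norm (z - p) \<and> norm (z - p - D e) \<le> B * (norm e)\<^sup>2"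
    by (rule C2_submanifold_linearize[OF assms], rule that)
  have eq: "tangent_space M p = D ` E"
    by (rule tangent_space_eq_image[OF assms(2) *(1,3,5,6)]) (use *(7,8) in auto)
  show "subspace (tangent_space M p)" unfolding eq using *(3,1) by (rule linear_subspace_image)
  have "span E = E" using *(1) by (simp add: span_eq_iff)
  then have "inj_on D (span E)" using *(4) by (simp only:)
  then show "dim (tangent_space M p) = m"
    unfolding eq using dim_image_eq[OF *(3)] *(2) by blast
qed

text \<open>Along a curve in \<open>M\<close> through \<open>y\<close> the squared distance to
  \<open>x\<close> has a local minimum at 0, and its derivative there is
  \<open>- 2 * ((x - y) \<bullet> v)\<close>.\<close>

lemma closest_point_normal:
  fixes M :: "'a::euclidean_space set"
  assumes "y \<in> M" "\<And>z. z \<in> M \<Longrightarrow> dist x y \<le> dist x z" "v \<in> tangent_space M y"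
  shows "(x - y) \<bullet> v = 0"
proof -
  obtain \<gamma> d where \<gamma>: "\<gamma> 0 = y" "(\<gamma> has_vector_derivative v) (at 0)" "d > 0"
    "\<And>t. \<bar>t\<bar> < d \<Longrightarrow> \<gamma> t \<in> M"
    using assms(3) unfolding tangent_space_def by blast
  let ?f = "\<lambda>t. (x - \<gamma> t) \<bullet> (x - \<gamma> t)"
  have g: "(\<gamma> has_derivative (\<lambda>t. t *\<^sub>R v)) (at 0)"
    using \<gamma>(2) by (simp add: has_vector_derivative_def)
  have "(?f has_derivative (\<lambda>t. (x - \<gamma> 0) \<bullet> (0 - t *\<^sub>R v) + (0 - t *\<^sub>R v) \<bullet> (x - \<gamma> 0))) (at 0)"
    by (rule has_derivative_inner) (rule has_derivative_diff[OF has_derivative_const g])+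
  then have "(?f has_derivative (\<lambda>t. t * (- 2 * ((x - y) \<bullet> v)))) (at 0)"
    by (simp add: \<gamma>(1) inner_commute algebra_simps)
  then have "DERIV ?f 0 :> - 2 * ((x - y) \<bullet> v)"
    unfolding has_field_derivative_def by (rule has_derivative_eq_rhs) (auto simp: fun_eq_iff)
  moreover have "\<forall>t. \<bar>0 - t\<bar> < d \<longrightarrow> ?f 0 \<le> ?f t"
    using \<gamma>(4) assms(2) by (auto simp: \<gamma>(1) dist_norm norm_le)
  ultimately have "- 2 * ((x - y) \<bullet> v) = 0"
    using DERIV_local_min[of ?f _ 0 d] \<gamma>(3) by blast
  then show ?thesis by simp
qed

subsection \<open>Empty tangent balls\<close>

text \<open>Points near \<open>y\<close> rise above the tangent space by at most
  \<open>B^3 * (norm (z - y))^2\<close>, which a sphere of radius \<open>s\<close> with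
  \<open>2 * s * B^3 \<le> 1\<close> clears. Points at distance at least
  \<open>r \<ge> 2 * s\<close> are outside by the triangle inequality.\<close>

lemma C2_submanifold_small_tangent_ball:
  fixes M :: "'a::euclidean_space set"
  assumes "C2_submanifold M m" "y \<in> M" "norm n = 1" "\<And>v. v \<in> tangent_space M y \<Longrightarrow> n \<bullet> v = 0"
  obtains s where "0 < s" "\<And>z. z \<in> M \<Longrightarrow> s \<le> dist (y + s *\<^sub>R n) z"
proof -
  obtain E :: "'a set" and D B r where *: "subspace E" "dim E = m" "linear D" "inj_on D E" "0 < r" "0 \<le> (B::real)"
    "\<And>e. e \<in> E \<Longrightarrow> norm e < r \<Longrightarrow> \<exists>z\<in>M. norm (z - y - D e) \<le> B * (norm e)\<^sup>2"
    "\<And>z. z \<in> M \<Longrightarrow> norm (z - y) < r \<Longrightarrow>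
        \<exists>e\<in>E. norm e \<le> B * norm (z - y) \<and> norm (z - y - D e) \<le> B * (norm e)\<^sup>2"
    by (rule C2_submanifold_linearize[OF assms(1,2)], rule that)
  have eq: "tangent_space M y = D ` E"
    by (rule tangent_space_eq_image[OF assms(2) *(1,3,5,6)]) (use *(7,8) in auto)
  define s where "s = min (r / 2) (1 / (2 * (B ^ 3 + 1)))"
  have s: "s > 0" using *(5,6) by (simp add: s_def add_nonneg_pos)
  have B3: "2 * s * B ^ 3 \<le> 1"
  proof -
    have "B ^ 3 \<ge> 0" using *(6) by simp
    moreover have "s \<le> 1 / (2 * (B ^ 3 + 1))" by (simp add: s_def)
    moreover from \<open>B ^ 3 \<ge> 0\<close> have "0 < 2 * (B ^ 3 + 1)" by (intro mult_pos_pos add_nonneg_pos) auto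
    ultimately have "s * (2 * (B ^ 3 + 1)) \<le> 1"
      using pos_le_divide_eq[of "2 * (B ^ 3 + 1)" s 1] by blast
    then show ?thesis using s by (simp add: algebra_simps)
  qed
  have "s \<le> dist (y + s *\<^sub>R n) z" if z: "z \<in> M" for z
  proof (cases "norm (z - y) < r")
    case True
    obtain e where e: "e \<in> E" "norm e \<le> B * norm (z - y)" "norm (z - y - D e) \<le> B * (norm e)\<^sup>2"
      using *(8)[OF z True] by blast
    have "n \<bullet> D e = 0" using assms(4) e(1) eq by blast
    then have "n \<bullet> (z - y) = n \<bullet> (z - y - D e)" by (simp add: inner_diff_right)
    also have "\<dots> \<le> norm (z - y - D e)"
      using norm_cauchy_schwarz[of n "z - y - D e"] assms(3) by simp
    also have "\<dots> \<le> B * (B * norm (z - y))\<^sup>2"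
      using e(3) mult_left_mono[OF power_mono[OF e(2), of 2] *(6)] by simp
    also have "\<dots> = B ^ 3 * (norm (z - y))\<^sup>2" by (simp add: power3_eq_cube power2_eq_square)
    finally have "n \<bullet> (z - y) \<le> B ^ 3 * (norm (z - y))\<^sup>2" .
    then have "2 * s * (n \<bullet> (z - y)) \<le> 2 * s * (B ^ 3 * (norm (z - y))\<^sup>2)"
      using s by (intro mult_left_mono) auto
    also have "\<dots> = (2 * s * B ^ 3) * (norm (z - y))\<^sup>2" by simp
    also have "\<dots> \<le> 1 * (norm (z - y))\<^sup>2" using B3 by (rule mult_right_mono) simp
    finally have "s\<^sup>2 \<le> s\<^sup>2 - 2 * s * (n \<bullet> (z - y)) + (norm (z - y))\<^sup>2" by simp
    also have "\<dots> = (norm (s *\<^sub>R n - (z - y)))\<^sup>2"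
    proof -
      have "n \<bullet> n = 1" using assms(3) by (simp add: norm_eq_1)
      then show ?thesis
        by (simp add: power2_norm_eq_inner inner_diff_left inner_diff_right inner_commute)
           (simp add: power2_eq_square algebra_simps)
    qed
    finally have "s \<le> norm (s *\<^sub>R n - (z - y))" by (rule power2_le_imp_le) simp
    then show ?thesis by (simp add: dist_norm algebra_simps)
  next
    case False
    have "dist y z \<le> dist y (y + s *\<^sub>R n) + dist (y + s *\<^sub>R n) z" by (rule dist_triangle)
    then show ?thesis
      using False s assms(3) by (simp add: dist_norm norm_minus_commute s_def)
  qed
  then show ?thesis using that s by blast
qed

text \<open>Take the largest \<open>t \<le> R\<close> whose ball is empty. If \<open>t < R\<close>,
  its centre is at distance at least \<open>R - t\<close> from the medial axis, so
  \<open>closest_point_extend_ray\<close> lengthens the normal segment by half of that, a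
  contradiction.\<close>

lemma C2_submanifold_tangent_ball:
  fixes M :: "'a::euclidean_space set"
  assumes "compact M" "C2_submanifold M m" "y \<in> M" "norm n = 1"
    and nT: "\<And>v. v \<in> tangent_space M y \<Longrightarrow> n \<bullet> v = 0"
    and R: "0 < R" "\<And>a. a \<in> medial_axis M \<Longrightarrow> R \<le> dist y a" and w: "w \<in> M"
  shows "R \<le> dist (y + R *\<^sub>R n) w"
proof -
  have cl: "closed M" and ne: "M \<noteq> {}" using assms(1,3) compact_imp_closed by auto
  define S where "S = {0..R} \<inter> (\<Inter>z\<in>M. {t. t \<le> dist (y + t *\<^sub>R n) z})"
  have S: "t \<in> S \<longleftrightarrow> 0 \<le> t \<and> t \<le> R \<and> (\<forall>z\<in>M. t \<le> dist (y + t *\<^sub>R n) z)" for t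
    by (auto simp: S_def)
  have "closed (\<Inter>z\<in>M. {t. t \<le> dist (y + t *\<^sub>R n) z})"
    by (intro closed_INT ballI closed_Collect_le continuous_intros)
  then have "compact S" unfolding S_def by (intro compact_Int_closed compact_Icc)
  moreover have "S \<noteq> {}" using S[of 0] R by force
  ultimately obtain t where t: "t \<in> S" and max: "\<And>t'. t' \<in> S \<Longrightarrow> t' \<le> t"
    using compact_attains_sup[of S] by blast
  have t': "t \<le> R" "\<And>z. z \<in> M \<Longrightarrow> t \<le> dist (y + t *\<^sub>R n) z" using t S by auto
  obtain s where s: "0 < s" "\<And>z. z \<in> M \<Longrightarrow> s \<le> dist (y + s *\<^sub>R n) z"
    using C2_submanifold_small_tangent_ball[OF assms(2,3,4) nT] by blast
  have down: "t2 \<le> dist (y + t2 *\<^sub>R n) z"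
    if "0 \<le> t2" "t2 \<le> t1" "0 < t1" "\<And>z. z \<in> M \<Longrightarrow> t1 \<le> dist (y + t1 *\<^sub>R n) z" "z \<in> M" for t1 t2 z
  proof -
    have "y + t2 *\<^sub>R n = (1 - t2 / t1) *\<^sub>R y + (t2 / t1) *\<^sub>R (y + t1 *\<^sub>R n)"
      using that by (simp add: algebra_simps)
    then have "y + t2 *\<^sub>R n \<in> closed_segment y (y + t1 *\<^sub>R n)"
      unfolding closed_segment_def using that by (intro CollectI exI[of _ "t2 / t1"]) auto
    then have "dist (y + t2 *\<^sub>R n) y \<le> dist (y + t2 *\<^sub>R n) z"
      by (rule nearest_on_segment[where M = M and z = "y + t1 *\<^sub>R n", rotated])
        (use that assms(4) in \<open>simp_all add: dist_norm\<close>)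
    then show ?thesis using that assms(4) by (simp add: dist_norm)
  qed
  \<comment> \<open>The maximum must be positive: at \<open>t = 0\<close> the centre lies on
    \<open>M\<close> and there is no ray to prolong. The small ball from the chart provides this
    start.\<close>
  have "min s R \<in> S" using down[of "min s R" s] s R(1) by (auto simp: S)
  then have tpos: "t > 0" using max s(1) R(1) by (metis less_le_trans min_less_iff_conj)
  have "t = R"
  proof (rule ccontr)
    assume "t \<noteq> R"
    define d where "d = (R - t) / 2"
    have d: "d > 0" "t + d \<le> R" using t'(1) \<open>t \<noteq> R\<close> by (auto simp: d_def field_simps)
    let ?x = "y + t *\<^sub>R n"
    have dxy: "dist ?x y = t" using tpos assms(4) by (simp add: dist_norm)
    have xM: "?x \<notin> M" using t'(2)[of ?x] tpos by auto
    have far: "d < dist ?x a" if "a \<in> medial_axis M" for a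
      using R(2)[OF that] dist_triangle[of y a ?x] dxy d by (simp add: dist_commute d_def field_simps)
    have "?x \<notin> medial_axis M" using far[of ?x] d by auto
    then have px: "closest_point M ?x = y"
      by (rule closest_point_unique_off_medial_axis[OF cl _ assms(3)]) (use dxy t'(2) in simp)
    have disj: "cball ?x d \<inter> medial_axis M = {}" using far by fastforce
    have ext: "?x + (d / norm (?x - closest_point M ?x)) *\<^sub>R (?x - closest_point M ?x) = y + (t + d) *\<^sub>R n"
      unfolding px using tpos assms(4) by (simp add: algebra_simps)
    have "t + d \<le> dist (y + (t + d) *\<^sub>R n) z" if "z \<in> M" for z
    proof -
      have "dist (y + (t + d) *\<^sub>R n) y = t + d" using tpos d assms(4) by (simp add: dist_norm)
      then show ?thesis
        using closest_point_extend_ray[OF assms(1) ne xM d(1) disj that] unfolding ext unfolding px by simp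
    qed
    then have "t + d \<in> S" using tpos d by (auto simp: S)
    then show False using max d(1) by fastforce
  qed
  then show ?thesis using t'(2)[OF w] by simp
qed

text \<open>Squaring the statement that \<open>z\<close> is outside the tangent ball bounds its
  normal component quadratically, as in Federer's inequality for sets of positive reach, but with a
  radius belonging to \<open>y\<close>.\<close>

lemma tangent_ball_inner_le:
  fixes M :: "'a::euclidean_space set"
  assumes "compact M" "C2_submanifold M m" "y \<in> M"
    and nT: "\<And>v. v \<in> tangent_space M y \<Longrightarrow> n \<bullet> v = 0"
    and R: "0 < R" "\<And>a. a \<in> medial_axis M \<Longrightarrow> R \<le> dist y a" and z: "z \<in> M"
  shows "(z - y) \<bullet> n \<le> norm n * ((norm (z - y))\<^sup>2 / (2 * R))"
proof (cases "n = 0")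
  case False
  define k where "k = n /\<^sub>R norm n"
  have k: "norm k = 1" "n = norm n *\<^sub>R k" using False by (auto simp: k_def)
  have kT: "k \<bullet> v = 0" if "v \<in> tangent_space M y" for v using nT[OF that] by (simp add: k_def)
  have "R \<le> norm (R *\<^sub>R k - (z - y))"
    using C2_submanifold_tangent_ball[OF assms(1-3) k(1) kT R z] by (simp add: dist_norm algebra_simps)
  then have "R\<^sup>2 \<le> (norm (R *\<^sub>R k - (z - y)))\<^sup>2" using R(1) by (intro power_mono) auto
  also have "\<dots> = R\<^sup>2 - 2 * R * ((z - y) \<bullet> k) + (norm (z - y))\<^sup>2"
  proof -
    have "k \<bullet> k = 1" using k(1) by (simp add: norm_eq_1)
    then show ?thesis
      by (simp add: power2_norm_eq_inner inner_diff_left inner_diff_right inner_commute)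
         (simp add: power2_eq_square algebra_simps)
  qed
  finally have "(z - y) \<bullet> k \<le> (norm (z - y))\<^sup>2 / (2 * R)" using R(1) by (simp add: field_simps)
  then have "norm n * ((z - y) \<bullet> k) \<le> norm n * ((norm (z - y))\<^sup>2 / (2 * R))"
    by (rule mult_left_mono) simp
  then show ?thesis by (subst (1) k(2)) simp
qed simp

subsection \<open>Altitudes, thickness and angles of simplices\<close>

lemma longest_edge_ge:
  fixes A :: "'a::euclidean_space set"
  assumes "finite A" "x \<in> A" "y \<in> A"
  shows "dist x y \<le> longest_edge A"
proof -
  have eq: "{dist x y | x y. x \<in> A \<and> y \<in> A} = (\<lambda>(x, y). dist x y) ` (A \<times> A)" by auto
  have "finite {dist x y | x y. x \<in> A \<and> y \<in> A}"
    unfolding eq by (intro finite_imageI finite_cartesian_product assms(1))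
  then show ?thesis unfolding longest_edge_def by (rule Max_ge) (use assms in auto)
qed

lemma dist_convex_hull_le:
  fixes A :: "'a::real_normed_vector set"
  assumes "x \<in> convex hull A" "\<And>a. a \<in> A \<Longrightarrow> dist y a \<le> r"
  shows "dist y x \<le> r"
proof -
  have "convex hull A \<subseteq> cball y r" by (rule hull_minimal) (use assms(2) in \<open>auto intro: convex_cball\<close>)
  then show ?thesis using assms(1) by auto
qed

lemma dist_convex_hull_le_longest_edge:
  fixes A :: "'a::euclidean_space set"
  assumes "finite A" "x \<in> convex hull A" "y \<in> A"
  shows "dist x y \<le> longest_edge A"
  using dist_convex_hull_le[OF assms(2), of y "longest_edge A"] longest_edge_ge[OF assms(1,3)]
  by (simp add: dist_commute)

text \<open>If \<open>c a\<close> is nonzero, the zero-sum combination equals \<open>c a\<close>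
  times the difference of \<open>a\<close> and an affine combination of the other vertices, whose
  distance from \<open>a\<close> is at least the altitude.\<close>

lemma altitude_coeff_le:
  fixes A :: "'a::euclidean_space set"
  assumes "finite A" "a \<in> A" "sum c A = 0"
  shows "\<bar>c a\<bar> * altitude A a \<le> norm (\<Sum>x\<in>A. c x *\<^sub>R x)"
proof (cases "c a = 0")
  case False
  let ?B = "A - {a}"
  have sB: "sum c ?B = - c a" using assms by (simp add: sum_diff1)
  define y where "y = (\<Sum>x\<in>?B. (- c x / c a) *\<^sub>R x)"
  have "sum (\<lambda>x. - c x / c a) ?B = - sum c ?B / c a"
    by (simp add: sum_divide_distrib sum_negf)
  then have "sum (\<lambda>x. - c x / c a) ?B = 1" using sB False by simp
  then have "y \<in> affine hull ?B"
    unfolding y_def using assms(1) by (subst affine_hull_finite) auto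
  then have "altitude A a \<le> dist a y" unfolding altitude_def by (rule infdist_le)
  then have "\<bar>c a\<bar> * altitude A a \<le> \<bar>c a\<bar> * dist a y" by (rule mult_left_mono) simp
  also have "\<dots> = norm (c a *\<^sub>R (a - y))" by (simp add: dist_norm)
  also have "c a *\<^sub>R (a - y) = (\<Sum>x\<in>A. c x *\<^sub>R x)"
  proof -
    have "c a *\<^sub>R y = (\<Sum>x\<in>?B. - c x *\<^sub>R x)"
      unfolding y_def scaleR_sum_right using False by (intro sum.cong) auto
    then have "c a *\<^sub>R (a - y) = c a *\<^sub>R a + (\<Sum>x\<in>?B. c x *\<^sub>R x)"
      by (simp add: scaleR_diff_right sum_negf)
    then show ?thesis using assms(1,2) by (simp add: sum.remove)
  qed
  finally show ?thesis .
qed simp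

lemma altitude_pos:
  fixes A :: "'a::euclidean_space set"
  assumes "\<not> affine_dependent A" "a \<in> A" "A \<noteq> {a}"
  shows "0 < altitude A a"
proof -
  have "A - {a} \<noteq> {}" using assms(2,3) by auto
  then have "affine hull (A - {a}) \<noteq> {}" by simp
  moreover have "a \<notin> affine hull (A - {a})" using assms(1,2) unfolding affine_dependent_def by auto
  ultimately have "infdist a (affine hull (A - {a})) \<noteq> 0"
    using in_closed_iff_infdist_zero[of "affine hull (A - {a})" a] closed_affine_hull by blast
  then show ?thesis unfolding altitude_def using infdist_nonneg[of a] by (metis less_eq_real_def)
qed

lemma thickness_altitude:
  fixes A :: "'a::euclidean_space set"
  assumes "finite A" "2 \<le> card A" "0 < t" "t \<le> thickness A"
  shows longest_edge_pos_of_thickness: "0 < longest_edge A"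
    and altitude_ge_of_thickness: "a \<in> A \<Longrightarrow> t * (real (card A - 1) * longest_edge A) \<le> altitude A a"
proof -
  obtain b where b: "b \<in> A" using assms(2) by force
  have "longest_edge A \<ge> 0" using longest_edge_ge[OF assms(1) b b] by simp
  moreover have "longest_edge A \<noteq> 0" using assms(3,4) by (auto simp: thickness_def)
  ultimately show L: "0 < longest_edge A" by simp
  assume a: "a \<in> A"
  have pos: "0 < real (card A - 1) * longest_edge A" using assms(2) L by simp
  have "t * (real (card A - 1) * longest_edge A) \<le> min_altitude A"
    using assms(4) pos_le_divide_eq[OF pos] unfolding thickness_def by blast
  also have "\<dots> \<le> altitude A a" unfolding min_altitude_def using assms(1) a by simp
  finally show "t * (real (card A - 1) * longest_edge A) \<le> altitude A a" .
qed

lemma direction_affine_hull_finite: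
  assumes "finite A" "u \<in> direction (affine hull A)"
  obtains c where "sum c A = 0" "u = (\<Sum>a\<in>A. c a *\<^sub>R a)"
proof -
  obtain x y where "x \<in> affine hull A" "y \<in> affine hull A" "u = x - y"
    using assms(2) unfolding direction_def by blast
  then obtain f g where "sum f A = 1" "x = (\<Sum>a\<in>A. f a *\<^sub>R a)" "sum g A = 1" "y = (\<Sum>a\<in>A. g a *\<^sub>R a)"
    unfolding affine_hull_finite[OF assms(1)] by auto
  then have "sum (\<lambda>a. f a - g a) A = 0" "u = (\<Sum>a\<in>A. (f a - g a) *\<^sub>R a)"
    using \<open>u = x - y\<close> by (auto simp: sum_subtractf scaleR_left_diff_distrib)
  then show ?thesis by (rule that)
qed

text \<open>Whitney's angle bound: the altitudes control the coefficients of \<open>u\<close> with respect to the vertices.\<close>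
lemma thick_simplex_direction_bound:
  fixes A :: "'a::euclidean_space set"
  assumes A: "finite A" "2 \<le> card A" "0 < t" "t \<le> thickness A"
    and V: "subspace V" and h: "0 \<le> h"
    and near: "\<And>a n. a \<in> A \<Longrightarrow> (\<And>v. v \<in> V \<Longrightarrow> n \<bullet> v = 0) \<Longrightarrow> \<bar>(a - z) \<bullet> n\<bar> \<le> norm n * h"
    and c: "sum c A = 0" and u: "u = (\<Sum>a\<in>A. c a *\<^sub>R a)"
  shows "norm (u - closest_point V u) \<le> 2 * h / (t * longest_edge A) * norm u"
proof (cases "u = closest_point V u")
  case True
  then show ?thesis using h A(3) longest_edge_pos_of_thickness[OF A] by simp
next
  case False
  define w where "w = u - closest_point V u"
  define j where "j = real (card A - 1)"
  let ?L = "longest_edge A"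
  have wpos: "norm w > 0" using False by (simp add: w_def)
  have L: "?L > 0" using longest_edge_pos_of_thickness[OF A] .
  \<comment> \<open>The number of vertices is \<open>j + 1 \<le> 2 * j\<close>; this costs the
    factor 2 of the bound and cancels the \<open>j\<close> in the thickness.\<close>
  have j: "j \<ge> 1" "real (card A) \<le> 2 * j" using A(2) by (auto simp: j_def)
  have wV: "w \<bullet> v = 0" if "v \<in> V" for v
    unfolding w_def using closest_point_subspace_orth[OF V that] .
  have ca: "\<bar>c a\<bar> \<le> norm u / (t * (j * ?L))" if "a \<in> A" for a
  proof -
    have "\<bar>c a\<bar> * (t * (j * ?L)) \<le> \<bar>c a\<bar> * altitude A a"
      using altitude_ge_of_thickness[OF A that] by (intro mult_left_mono) (auto simp: j_def)
    also have "\<dots> \<le> norm u" unfolding u by (rule altitude_coeff_le[OF A(1) that c])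
    finally show ?thesis using A(3) j(1) L by (simp add: pos_le_divide_eq)
  qed
  have "(norm w)\<^sup>2 = u \<bullet> w" using norm_closest_point_subspace(3)[OF V, of u] by (simp add: w_def)
  \<comment> \<open>Because the coefficients sum to 0, the base point \<open>z\<close> can be
    subtracted from every vertex.\<close>
  also have "\<dots> = (\<Sum>a\<in>A. c a * ((a - z) \<bullet> w))"
    using c by (simp add: u inner_sum_left inner_diff_left right_diff_distrib sum_subtractf
        flip: sum_distrib_right)
  also have "\<dots> \<le> (\<Sum>a\<in>A. norm u / (t * (j * ?L)) * (norm w * h))"
  proof (rule sum_mono)
    fix a assume a: "a \<in> A"
    have "c a * ((a - z) \<bullet> w) \<le> \<bar>c a\<bar> * \<bar>(a - z) \<bullet> w\<bar>" by (metis abs_ge_self abs_mult)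
    also have "\<dots> \<le> norm u / (t * (j * ?L)) * (norm w * h)"
      using ca[OF a] near[OF a wV] A(3) j(1) L by (intro mult_mono) auto
    finally show "c a * ((a - z) \<bullet> w) \<le> norm u / (t * (j * ?L)) * (norm w * h)" .
  qed
  also have "\<dots> = real (card A) * (norm u / (t * (j * ?L)) * (norm w * h))" by simp
  also have "\<dots> \<le> 2 * j * (norm u / (t * (j * ?L)) * (norm w * h))"
    using A(3) j L h by (intro mult_right_mono) auto
  also have "\<dots> = (2 * h / (t * ?L) * norm u) * norm w" using j(1) by simp
  finally have "norm w * norm w \<le> (2 * h / (t * ?L) * norm u) * norm w"
    by (simp add: power2_eq_square)
  then show ?thesis unfolding w_def[symmetric] using wpos by (rule mult_right_le_imp_le)
qed

text \<open>The cosine of each angle is the ratio of projected to original length, at least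
  \<open>sqrt (1 - k^2)\<close>, so each angle is at most \<open>arcsin k\<close>. The supremum
  stays in the range where sine is monotone.\<close>

lemma sin_subspace_angle_le:
  fixes W T :: "'a::euclidean_space set"
  assumes T: "subspace T" and k: "0 \<le> k" "k < 1"
    and W: "\<And>u. u \<in> W \<Longrightarrow> norm (u - closest_point T u) \<le> k * norm u"
  shows "sin (subspace_angle W T) \<le> k"
proof (cases "W - {0} = {}")
  case True
  then show ?thesis using k by (simp add: subspace_angle_def)
next
  case False
  have bound: "0 \<le> vec_angle u (closest_point T u)" "vec_angle u (closest_point T u) \<le> arcsin k"
    if u: "u \<in> W - {0}" for u
  proof -
    let ?p = "closest_point T u"
    have nu: "norm u > 0" using u by simp
    have "(norm (u - ?p))\<^sup>2 \<le> (k * norm u)\<^sup>2" using W u by (intro power_mono) auto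
    then have p2: "(1 - k\<^sup>2) * (norm u)\<^sup>2 \<le> (norm ?p)\<^sup>2"
      using norm_closest_point_subspace(1)[OF T, of u] by (simp add: power_mult_distrib algebra_simps)
    have k2: "k\<^sup>2 < 1" using k by (simp add: power_less_one_iff abs_square_less_1)
    have "0 < (1 - k\<^sup>2) * (norm u)\<^sup>2" using k2 nu by simp
    \<comment> \<open>Since \<open>k < 1\<close> the projection is nonzero, so the default value
      \<open>pi / 2\<close> of \<open>vec_angle\<close> does not occur.\<close>
    then have p0: "norm ?p > 0" using p2 by (metis less_le_trans zero_less_norm_iff norm_zero power_zero_numeral less_irrefl)
    have va: "vec_angle u ?p = arccos (norm ?p / norm u)"
      using nu p0 norm_closest_point_subspace(2)[OF T, of u]
      by (simp add: vec_angle_def power2_eq_square)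
    have le1: "norm ?p / norm u \<le> 1" using norm_closest_point_subspace(4)[OF T, of u] nu by simp
    have "1 - k\<^sup>2 \<le> (norm ?p / norm u)\<^sup>2"
      using p2 nu by (simp add: power_divide pos_le_divide_eq)
    then have "sqrt (1 - k\<^sup>2) \<le> norm ?p / norm u" by (intro real_le_lsqrt) auto
    then have "arccos (norm ?p / norm u) \<le> arccos (sqrt (1 - k\<^sup>2))"
      using le1 k2 by (intro arccos_le_mono[THEN iffD2]) (auto simp: abs_le_iff)
    also have "arccos (sqrt (1 - k\<^sup>2)) = arcsin k"
    proof -
      have "0 \<le> arcsin k" using k arcsin_le_mono[of 0 k] by simp
      moreover have "arcsin k \<le> pi" using k arcsin_ubound[of k] pi_gt_zero by linarith
      ultimately show ?thesis using cos_arcsin[of k] arccos_cos[of "arcsin k"] k by simp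
    qed
    finally show "vec_angle u ?p \<le> arcsin k" unfolding va .
    show "0 \<le> vec_angle u ?p" unfolding va using le1 nu by (intro arccos_lbound) (auto intro: order_trans[of _ 0])
  qed
  let ?I = "(\<lambda>u. vec_angle u (closest_point T u)) ` (W - {0})"
  obtain u0 where u0: "u0 \<in> W - {0}" using False by blast
  have le: "Sup ?I \<le> arcsin k" by (rule cSup_least) (use False bound in auto)
  have "0 \<le> vec_angle u0 (closest_point T u0)" using bound(1)[OF u0] .
  also have "\<dots> \<le> Sup ?I"
    by (rule cSup_upper) (use u0 bound(2) in \<open>auto intro!: bdd_aboveI[of _ "arcsin k"]\<close>)
  finally have "0 \<le> Sup ?I" .
  then have "sin (Sup ?I) \<le> sin (arcsin k)"
    using le arcsin_ubound[of k] k pi_gt_zero by (intro sin_monotone_2pi_le) auto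
  moreover have "subspace_angle W T = Sup ?I" using False by (simp only: subspace_angle_def if_False)
  ultimately show ?thesis using k by simp
qed

subsection \<open>Simplices with vertices on the submanifold\<close>

text \<open>Both \<open>n\<close> and \<open>- n\<close> are normal, which gives the absolute value.
  Positivity of \<open>infdist\<close> also excludes an empty medial axis, for which
  \<open>infdist\<close> is 0 by convention.\<close>

lemma tangent_ball_infdist:
  fixes M :: "'a::euclidean_space set"
  assumes "compact M" "C2_submanifold M m" "y \<in> M" "z \<in> M"
    and nT: "\<And>v. v \<in> tangent_space M y \<Longrightarrow> n \<bullet> v = 0"
    and R: "0 < infdist y (medial_axis M)"
  shows "\<bar>(z - y) \<bullet> n\<bar> \<le> norm n * ((norm (z - y))\<^sup>2 / (2 * infdist y (medial_axis M)))"
proof -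
  have a: "infdist y (medial_axis M) \<le> dist y a" if "a \<in> medial_axis M" for a
    using that by (rule infdist_le)
  have "(z - y) \<bullet> n \<le> norm n * ((norm (z - y))\<^sup>2 / (2 * infdist y (medial_axis M)))"
    by (rule tangent_ball_inner_le[OF assms(1-3) nT R a assms(4)])
  moreover have "(z - y) \<bullet> (- n) \<le> norm (- n) * ((norm (z - y))\<^sup>2 / (2 * infdist y (medial_axis M)))"
    by (rule tangent_ball_inner_le[OF assms(1-3) _ R a assms(4)]) (use nT in simp)
  ultimately show ?thesis by simp
qed

text \<open>The vector \<open>x - y\<close> is normal at \<open>y\<close>, so the tangent ball bound
  puts all vertices, and hence their hull, in one half-space orthogonal to it. Evaluated at
  \<open>x\<close> this bounds \<open>norm (x - y)\<close>.\<close>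

lemma dist_closest_point_simplex_le:
  fixes M :: "'a::euclidean_space set"
  assumes M: "compact M" "C2_submanifold M m" and V: "V \<subseteq> M" "x \<in> convex hull V"
    and y: "y \<in> M" "\<And>w. w \<in> M \<Longrightarrow> dist x y \<le> dist x w"
    and R: "0 < infdist y (medial_axis M)"
    and r: "\<And>q. q \<in> V \<Longrightarrow> dist q y \<le> r"
  shows "dist x y \<le> r\<^sup>2 / (2 * infdist y (medial_axis M))"
proof (cases "x = y")
  case False
  let ?R = "infdist y (medial_axis M)" and ?n = "x - y"
  let ?h = "r\<^sup>2 / (2 * ?R)"
  have nT: "?n \<bullet> v = 0" if "v \<in> tangent_space M y" for v
    by (rule closest_point_normal[OF y that])
  have "V \<subseteq> {q. ?n \<bullet> q \<le> ?n \<bullet> y + norm ?n * ?h}"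
  proof
    fix q assume q: "q \<in> V"
    then have "\<bar>(q - y) \<bullet> ?n\<bar> \<le> norm ?n * ((norm (q - y))\<^sup>2 / (2 * ?R))"
      using V(1) by (intro tangent_ball_infdist[OF M y(1) _ nT R]) auto
    also have "\<dots> \<le> norm ?n * ?h"
      using r[OF q] R by (intro mult_left_mono divide_right_mono power_mono) (auto simp: dist_norm)
    finally show "q \<in> {q. ?n \<bullet> q \<le> ?n \<bullet> y + norm ?n * ?h}"
      by (simp add: inner_commute[of ?n] inner_diff_left[of q])
  qed
  then have "convex hull V \<subseteq> {q. ?n \<bullet> q \<le> ?n \<bullet> y + norm ?n * ?h}"
    by (rule hull_minimal) (rule convex_halfspace_le)
  then have "?n \<bullet> x \<le> ?n \<bullet> y + norm ?n * ?h" using V(2) by blast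
  then have "?n \<bullet> x - ?n \<bullet> y \<le> norm ?n * ?h" by (simp only: diff_le_eq add.commute)
  moreover have "?n \<bullet> x - ?n \<bullet> y = norm ?n * norm ?n"
    by (simp only: inner_diff_right[symmetric] dot_square_norm power2_eq_square)
  ultimately have "norm ?n * norm ?n \<le> norm ?n * ?h" by (simp only:)
  moreover have "0 < norm ?n" using False by simp
  ultimately have "norm ?n \<le> ?h" by (rule mult_left_le_imp_le)
  then show ?thesis by (simp only: dist_norm)
qed (use R in simp)

text \<open>A bootstrap. With \<open>L\<close> the longest edge, vertices are crudely within
  \<open>2 * L\<close> of the foot, whose \<open>infdist\<close> is therefore at least
  \<open>16 * L\<close>; this already bounds the height by \<open>L / 8\<close>. The vertices are
  then within \<open>9/8 * L\<close>, and a second round gives \<open>(9/8)^2 / 2 = 81/128\<close>.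
  The factor \<open>15/16\<close> is \<open>1 - (9/8) / 18\<close>.\<close>

lemma simplex_near_submanifold:
  fixes M :: "'a::euclidean_space set"
  assumes M: "compact M" "C2_submanifold M m" and V: "finite V" "V \<subseteq> M" "x \<in> convex hull V" "p \<in> V"
    and R: "0 < infdist p (medial_axis M)"
    and L: "longest_edge V \<le> infdist p (medial_axis M) / 18"
  shows "0 < infdist x (medial_axis M)"
    and "q \<in> V \<Longrightarrow> dist q (closest_point M x) \<le> 9/8 * longest_edge V"
    and "15/16 * infdist p (medial_axis M) \<le> infdist (closest_point M x) (medial_axis M)"
    and "dist x (closest_point M x)
      \<le> 81/128 * (longest_edge V)\<^sup>2 / infdist (closest_point M x) (medial_axis M)"
proof -
  let ?A = "medial_axis M" and ?L = "longest_edge V" and ?y = "closest_point M x"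
  have cl: "closed M" and ne: "M \<noteq> {}" using M V compact_imp_closed by auto
  note c = closest_point_infdist[OF cl ne]
  have near: "dist x ?y \<le> dist x w" if "w \<in> M" for w using c(2,3) that by metis
  have xq: "dist x q \<le> ?L" if "q \<in> V" for q
    using dist_convex_hull_le_longest_edge[OF V(1,3) that] .
  have L0: "0 \<le> ?L" using xq[OF V(4)] zero_le_dist[of x p] by linarith
  have "infdist p ?A \<le> infdist x ?A + dist p x" by (rule infdist_triangle)
  then show x: "0 < infdist x ?A" using xq[OF V(4)] L R by (simp add: dist_commute)
  have xy: "dist x ?y \<le> ?L" using near[of p] xq[OF V(4)] V(2,4) by (meson order_trans subsetD)
  have tri: "dist q ?y \<le> ?L + dist x ?y" if "q \<in> V" for q
    using xq[OF that] dist_triangle[of q ?y x] by (simp add: dist_commute)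
  have Ry: "infdist p ?A \<le> infdist ?y ?A + dist p ?y" by (rule infdist_triangle)
  have "dist p ?y \<le> 2 * ?L" using tri[OF V(4)] xy by linarith
  then have R1: "16 * ?L \<le> infdist ?y ?A" "0 < infdist ?y ?A" using Ry L R by auto
  have tri2: "dist q ?y \<le> 2 * ?L" if "q \<in> V" for q using tri[OF that] xy by linarith
  have "dist x ?y \<le> (2 * ?L)\<^sup>2 / (2 * infdist ?y ?A)"
    by (rule dist_closest_point_simplex_le[OF M V(2,3) c(1) near R1(2) tri2])
  also have "\<dots> \<le> ?L / 8"
  proof -
    have "16 * ?L * ?L \<le> infdist ?y ?A * ?L" using R1(1) L0 by (rule mult_right_mono)
    then have "2 * ?L * ?L \<le> ?L / 8 * infdist ?y ?A" by (simp add: mult.commute)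
    moreover have "(2 * ?L)\<^sup>2 / (2 * infdist ?y ?A) = 2 * ?L * ?L / infdist ?y ?A"
      by (simp add: power2_eq_square)
    ultimately show ?thesis using pos_divide_le_eq[OF R1(2)] by metis
  qed
  finally have xy2: "dist x ?y \<le> ?L / 8" .
  show q: "dist q ?y \<le> 9/8 * ?L" if "q \<in> V" for q using tri[OF that] xy2 by linarith
  show "15/16 * infdist p ?A \<le> infdist ?y ?A" using q[OF V(4)] Ry L by linarith
  have "dist x ?y \<le> (9/8 * ?L)\<^sup>2 / (2 * infdist ?y ?A)"
    by (rule dist_closest_point_simplex_le[OF M V(2,3) c(1) near R1(2) q])
  then show "dist x ?y \<le> 81/128 * ?L\<^sup>2 / infdist ?y ?A"
    by (simp add: power2_eq_square)
qed

text \<open>The base point \<open>z\<close> is left free, since two are used: a vertex, with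
  \<open>r\<close> the longest edge, and the foot of a point of the simplex, with \<open>r\<close>
  equal to \<open>9/8\<close> of it. The tangent balls at \<open>z\<close> supply the height
  \<open>r^2 / (2 * infdist)\<close> for Whitney's bound.\<close>

lemma simplex_tangent_space_angle:
  fixes M :: "'a::euclidean_space set"
  assumes M: "compact M" "C2_submanifold M m" and V: "finite V" "V \<subseteq> M" "2 \<le> card V"
    and t: "0 < t" "t \<le> thickness V"
    and z: "z \<in> M" "0 < infdist z (medial_axis M)" "\<And>q. q \<in> V \<Longrightarrow> dist q z \<le> r"
    and c: "sum c V = 0" and u: "u = (\<Sum>a\<in>V. c a *\<^sub>R a)"
  shows "norm (u - closest_point (tangent_space M z) u)
     \<le> r\<^sup>2 / (t * longest_edge V * infdist z (medial_axis M)) * norm u"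
proof -
  let ?R = "infdist z (medial_axis M)"
  have "\<bar>(a - z) \<bullet> n\<bar> \<le> norm n * (r\<^sup>2 / (2 * ?R))"
    if a: "a \<in> V" and n: "\<And>v. v \<in> tangent_space M z \<Longrightarrow> n \<bullet> v = 0" for a n
  proof -
    have "\<bar>(a - z) \<bullet> n\<bar> \<le> norm n * ((norm (a - z))\<^sup>2 / (2 * ?R))"
      using a V(2) by (intro tangent_ball_infdist[OF M z(1) _ n z(2)]) auto
    also have "\<dots> \<le> norm n * (r\<^sup>2 / (2 * ?R))"
      using z(3)[OF a] z(2) by (intro mult_left_mono divide_right_mono power_mono) (auto simp: dist_norm)
    finally show ?thesis .
  qed
  from thick_simplex_direction_bound[OF V(1,3) t tangent_space_subspace(1)[OF M(2) z(1)] _ this c u]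
  have "norm (u - closest_point (tangent_space M z) u)
      \<le> 2 * (r\<^sup>2 / (2 * ?R)) / (t * longest_edge V) * norm u" using z(2) by simp
  also have "2 * (r\<^sup>2 / (2 * ?R)) / (t * longest_edge V) = r\<^sup>2 / (t * longest_edge V * ?R)"
    by (simp add: divide_simps)
  finally show ?thesis .
qed

subsection \<open>Barycentric coordinates on a simplicial complex\<close>

text \<open>Coordinates are total functions that vanish off \<open>S\<close>, so that those of one
  point with respect to different simplices can be compared as functions.\<close>

definition is_bary :: "'b::euclidean_space set \<Rightarrow> 'b \<Rightarrow> ('b \<Rightarrow> real) \<Rightarrow> bool" where
  "is_bary S x \<beta> \<longleftrightarrow>
     (\<forall>s. s \<notin> S \<longrightarrow> \<beta> s = 0) \<and> (\<forall>s\<in>S. 0 \<le> \<beta> s) \<and> sum \<beta> S = 1 \<and> (\<Sum>s\<in>S. \<beta> s *\<^sub>R s) = x"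

definition bary :: "'b::euclidean_space set set \<Rightarrow> 'b \<Rightarrow> 'b \<Rightarrow> real" where
  "bary K x = (SOME \<beta>. \<exists>S\<in>K. is_bary S x \<beta>)"

lemma is_bary_exists:
  assumes "finite S" "x \<in> convex hull S"
  obtains \<beta> where "is_bary S x \<beta>"
proof -
  obtain u where u: "\<forall>s\<in>S. 0 \<le> u s" "sum u S = 1" "(\<Sum>s\<in>S. u s *\<^sub>R s) = x"
    using assms(2) unfolding convex_hull_finite[OF assms(1)] by blast
  have "is_bary S x (\<lambda>s. if s \<in> S then u s else 0)"
    using u by (simp add: is_bary_def if_distrib[of "\<lambda>c. c *\<^sub>R _"] cong: sum.cong if_cong)
  then show ?thesis by (rule that)
qed

lemma is_bary_in_hull: "finite S \<Longrightarrow> is_bary S x \<beta> \<Longrightarrow> x \<in> convex hull S"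
  unfolding is_bary_def convex_hull_finite by blast

lemma is_bary_mono:
  assumes "is_bary S x \<beta>" "S \<subseteq> T" "finite T"
  shows "is_bary T x \<beta>"
proof -
  have "sum \<beta> T = sum \<beta> S" "(\<Sum>s\<in>T. \<beta> s *\<^sub>R s) = (\<Sum>s\<in>S. \<beta> s *\<^sub>R s)"
    by (intro sum.mono_neutral_right assms; use assms(1) in \<open>auto simp: is_bary_def\<close>)+
  moreover have "0 \<le> \<beta> s" for s using assms(1) unfolding is_bary_def by (cases "s \<in> S") auto
  ultimately show ?thesis using assms unfolding is_bary_def by auto
qed

lemma affine_independent_coeff_unique:
  fixes S :: "'b::euclidean_space set"
  assumes "finite S" "\<not> affine_dependent S" "sum f S = sum g S"
    "(\<Sum>s\<in>S. f s *\<^sub>R s) = (\<Sum>s\<in>S. g s *\<^sub>R s)" "s \<in> S"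
  shows "f s = g s"
proof (rule ccontr)
  assume "f s \<noteq> g s"
  moreover have "sum (\<lambda>s. f s - g s) S = 0" using assms(3) by (simp add: sum_subtractf)
  moreover have "(\<Sum>s\<in>S. (f s - g s) *\<^sub>R s) = 0"
    using assms(4) by (simp add: scaleR_left_diff_distrib sum_subtractf)
  ultimately have "affine_dependent S"
    unfolding affine_dependent_explicit_finite[OF assms(1)] using assms(5)
    by (intro exI[of _ "\<lambda>s. f s - g s"]) auto
  then show False using assms(2) by simp
qed

locale complex_map =
  fixes K :: "'b::euclidean_space set set" and v :: "'b \<Rightarrow> 'a::euclidean_space" and \<iota> :: "'b \<Rightarrow> 'a"
  assumes geom: "geom_complex K" and fin_vertices: "finite (\<Union>K)" and pl: "pl_extension K v \<iota>"
begin

lemma simplex: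
  assumes "S \<in> K"
  shows "S \<noteq> {}" "finite S" "\<not> affine_dependent S" "S \<subseteq> \<Union>K"
  using assms geom unfolding geom_complex_def by auto

lemma face: "S \<in> K \<Longrightarrow> T \<noteq> {} \<Longrightarrow> T \<subseteq> S \<Longrightarrow> T \<in> K"
  using geom unfolding geom_complex_def by blast

lemma finite_complex: "finite K"
  using fin_vertices by (rule finite_UnionD)

text \<open>The point lies in the hull of \<open>S \<inter> T\<close>. Its coordinates there,
  extended by 0, agree with both functions by affine independence.\<close>

lemma is_bary_unique:
  assumes "S \<in> K" "T \<in> K" "is_bary S x \<beta>" "is_bary T x \<gamma>"
  shows "\<beta> = \<gamma>"
proof -
  note fS = simplex(2)[OF assms(1)] and fT = simplex(2)[OF assms(2)]
  have "x \<in> convex hull S \<inter> convex hull T"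
    using is_bary_in_hull fS fT assms(3,4) by blast
  also have "\<dots> = convex hull (S \<inter> T)" using geom assms(1,2) unfolding geom_complex_def by blast
  finally obtain \<delta> where \<delta>: "is_bary (S \<inter> T) x \<delta>" using is_bary_exists[of "S \<inter> T"] fS by blast
  have *: "\<beta>' = \<delta>" if "U \<in> K" "is_bary U x \<beta>'" "is_bary U x \<delta>" for U \<beta>'
  proof
    fix s
    show "\<beta>' s = \<delta> s"
      using that affine_independent_coeff_unique[OF simplex(2,3)[OF that(1)], of \<beta>' \<delta> s]
      unfolding is_bary_def by (cases "s \<in> U") auto
  qed
  have "is_bary S x \<delta>" using \<delta> by (rule is_bary_mono) (use fS in auto)
  moreover have "is_bary T x \<delta>" using \<delta> by (rule is_bary_mono) (use fT in auto)
  ultimately show ?thesis using * assms by metis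
qed

lemma bary_eqI:
  assumes "S \<in> K" "is_bary S x \<beta>"
  shows "bary K x = \<beta>"
proof -
  have "\<exists>T\<in>K. is_bary T x (bary K x)"
    unfolding bary_def by (rule someI2[of _ \<beta>]) (use assms in auto)
  then show ?thesis using is_bary_unique assms by blast
qed

lemma bary:
  assumes "S \<in> K" "x \<in> convex hull S"
  shows is_bary_bary: "is_bary S x (bary K x)"
    and bary_outside: "s \<notin> S \<Longrightarrow> bary K x s = 0"
    and bary_nonneg: "0 \<le> bary K x s"
    and sum_bary: "sum (bary K x) S = 1"
    and bary_repr: "(\<Sum>s\<in>S. bary K x s *\<^sub>R s) = x"
    and \<iota>_bary: "\<iota> x = (\<Sum>s\<in>S. bary K x s *\<^sub>R v s)"
proof -
  obtain \<beta> where "is_bary S x \<beta>" using is_bary_exists simplex(2) assms by blast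
  then show i: "is_bary S x (bary K x)" using bary_eqI assms(1) by metis
  show "s \<notin> S \<Longrightarrow> bary K x s = 0" using i by (auto simp: is_bary_def)
  show "0 \<le> bary K x s" using i by (cases "s \<in> S") (auto simp: is_bary_def)
  show "sum (bary K x) S = 1" "(\<Sum>s\<in>S. bary K x s *\<^sub>R s) = x" using i by (auto simp: is_bary_def)
  have "\<iota> (\<Sum>s\<in>S. bary K x s *\<^sub>R s) = (\<Sum>s\<in>S. bary K x s *\<^sub>R v s)"
    using pl assms(1) i unfolding pl_extension_def is_bary_def by blast
  then show "\<iota> x = (\<Sum>s\<in>S. bary K x s *\<^sub>R v s)" using i by (simp add: is_bary_def)
qed

lemma polyhedronE:
  assumes "x \<in> polyhedron K"
  obtains S where "S \<in> K" "x \<in> convex hull S"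
  using assms unfolding polyhedron_def by blast

lemma \<iota>_global:
  assumes "x \<in> polyhedron K"
  shows "\<iota> x = (\<Sum>s\<in>\<Union>K. bary K x s *\<^sub>R v s)"
proof -
  obtain S where S: "S \<in> K" "x \<in> convex hull S" using assms by (rule polyhedronE)
  have "(\<Sum>s\<in>\<Union>K. bary K x s *\<^sub>R v s) = (\<Sum>s\<in>S. bary K x s *\<^sub>R v s)"
    by (rule sum.mono_neutral_right) (use fin_vertices simplex(4)[OF S(1)] bary_outside[OF S] in auto)
  then show "\<iota> x = (\<Sum>s\<in>\<Union>K. bary K x s *\<^sub>R v s)" using \<iota>_bary[OF S] by simp
qed

lemma vertex:
  assumes "w \<in> \<Union>K"
  shows vertex_simplex: "{w} \<in> K" and bary_vertex: "bary K w = (\<lambda>s. if s = w then 1 else 0)"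
    and \<iota>_vertex: "\<iota> w = v w" and vertex_polyhedron: "w \<in> polyhedron K"
    and vertex_star: "w \<in> star_set K w"
proof -
  obtain S where "S \<in> K" "w \<in> S" using assms by blast
  then show w: "{w} \<in> K" using face[of S "{w}"] by blast
  show b: "bary K w = (\<lambda>s. if s = w then 1 else 0)"
    by (rule bary_eqI[OF w]) (simp add: is_bary_def)
  show "\<iota> w = v w" using \<iota>_bary[OF w, of w] b by simp
  show "w \<in> polyhedron K" unfolding polyhedron_def using w by force
  show "w \<in> star_set K w" unfolding star_set_def using w by force
qed

lemma star_subset: "star_set K w \<subseteq> polyhedron K"
  unfolding star_set_def polyhedron_def by auto

lemma bary_pos_in_simplex:
  assumes "S \<in> K" "x \<in> convex hull S" "bary K x w \<noteq> 0"
  shows "w \<in> S"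
  using bary_outside[OF assms(1,2)] assms(3) by blast

lemma bary_pos_star:
  assumes "x \<in> polyhedron K" "0 < bary K x w"
  shows "x \<in> star_set K w"
proof -
  obtain S where S: "S \<in> K" "x \<in> convex hull S" using assms(1) by (rule polyhedronE)
  have "w \<in> S" using bary_pos_in_simplex[OF S] assms(2) by simp
  then show ?thesis using S unfolding star_set_def by blast
qed

lemma starE:
  assumes "x \<in> star_set K w"
  obtains S where "S \<in> K" "w \<in> S" "x \<in> convex hull S"
  using assms unfolding star_set_def by blast

lemma compact_hull: "S \<in> K \<Longrightarrow> compact (convex hull S)"
  using simplex(2) finite_imp_compact_convex_hull by blast

lemma compact_polyhedron: "compact (polyhedron K)"
  unfolding polyhedron_def using finite_complex compact_hull by (intro compact_UN) auto

lemma compact_star: "compact (star_set K w)"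
  unfolding star_set_def using finite_complex compact_hull by (intro compact_UN) auto

lemma \<iota>_in_hull: "S \<in> K \<Longrightarrow> x \<in> convex hull S \<Longrightarrow> \<iota> x \<in> convex hull (v ` S)"
proof -
  assume S: "S \<in> K" "x \<in> convex hull S"
  have "(\<Sum>s\<in>S. bary K x s *\<^sub>R v s) \<in> convex hull (v ` S)"
    by (intro convex_sum simplex(2)[OF S(1)] convex_convex_hull sum_bary[OF S] bary_nonneg[OF S]
        hull_inc imageI)
  then show ?thesis using \<iota>_bary[OF S] by simp
qed

text \<open>Lets the affine hull of an image simplex be computed from its vertices in the final
  angle estimate.\<close>

lemma \<iota>_image_hull: "S \<in> K \<Longrightarrow> \<iota> ` (convex hull S) = convex hull (v ` S)"
proof
  assume S: "S \<in> K"
  show "\<iota> ` (convex hull S) \<subseteq> convex hull (v ` S)" using \<iota>_in_hull[OF S] by blast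
  have "v ` S \<subseteq> \<iota> ` (convex hull S)"
  proof (rule image_subsetI)
    fix s assume s: "s \<in> S"
    then have "v s = \<iota> s" using \<iota>_vertex[of s] simplex(4)[OF S] by (metis subsetD)
    moreover have "s \<in> convex hull S" using s by (rule hull_inc)
    ultimately show "v s \<in> \<iota> ` (convex hull S)" by (rule image_eqI)
  qed
  moreover have "convex (\<iota> ` (convex hull S))"
  proof (rule convexI)
    fix a b and p q :: real
    assume "a \<in> \<iota> ` (convex hull S)" "b \<in> \<iota> ` (convex hull S)" and pq: "0 \<le> p" "0 \<le> q" "p + q = 1"
    then obtain x y where x: "x \<in> convex hull S" "a = \<iota> x" and y: "y \<in> convex hull S" "b = \<iota> y" by blast
    define z where "z = p *\<^sub>R x + q *\<^sub>R y"
    have z: "z \<in> convex hull S" unfolding z_def using x(1) y(1) pq by (rule convexD[OF convex_convex_hull])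
    have "is_bary S z (\<lambda>s. p * bary K x s + q * bary K y s)"
      unfolding is_bary_def
    proof (intro conjI ballI allI impI)
      show "p * bary K x s + q * bary K y s = 0" if "s \<notin> S" for s
        using bary_outside[OF S x(1) that] bary_outside[OF S y(1) that] by simp
      show "0 \<le> p * bary K x s + q * bary K y s" for s
        using bary_nonneg[OF S x(1)] bary_nonneg[OF S y(1)] pq by simp
      show "(\<Sum>s\<in>S. p * bary K x s + q * bary K y s) = 1"
        using sum_bary[OF S x(1)] sum_bary[OF S y(1)] pq by (simp add: sum.distrib flip: sum_distrib_left)
      have "(\<Sum>s\<in>S. (p * bary K x s + q * bary K y s) *\<^sub>R s)
          = p *\<^sub>R (\<Sum>s\<in>S. bary K x s *\<^sub>R s) + q *\<^sub>R (\<Sum>s\<in>S. bary K y s *\<^sub>R s)"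
        by (simp add: sum.distrib scaleR_left_distrib scaleR_sum_right)
      then show "(\<Sum>s\<in>S. (p * bary K x s + q * bary K y s) *\<^sub>R s) = z"
        unfolding bary_repr[OF S x(1)] bary_repr[OF S y(1)] z_def .
    qed
    then have "bary K z = (\<lambda>s. p * bary K x s + q * bary K y s)" by (rule bary_eqI[OF S])
    then have "\<iota> z = p *\<^sub>R a + q *\<^sub>R b"
      unfolding \<iota>_bary[OF S z] x(2) y(2) \<iota>_bary[OF S x(1)] \<iota>_bary[OF S y(1)]
      by (simp add: sum.distrib scaleR_left_distrib scaleR_sum_right)
    then show "p *\<^sub>R a + q *\<^sub>R b \<in> \<iota> ` (convex hull S)" using z by (metis imageI)
  qed
  ultimately show "convex hull (v ` S) \<subseteq> \<iota> ` (convex hull S)" by (rule hull_minimal)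
qed

text \<open>On one simplex the coordinate at \<open>w\<close> is Lipschitz with the reciprocal
  altitude as constant; finitely many closed simplices are glued.\<close>

lemma continuous_on_bary: "continuous_on (polyhedron K) (\<lambda>x. bary K x w)"
  unfolding polyhedron_def
proof (rule continuous_on_closed_Union[OF finite_complex])
  fix S assume S: "S \<in> K"
  show "closed (convex hull S)" using compact_hull[OF S] by (rule compact_imp_closed)
  show "continuous_on (convex hull S) (\<lambda>x. bary K x w)"
  \<comment> \<open>The simplex \<open>{w}\<close> is kept apart: its altitude is the
    \<open>infdist\<close> to an empty hull, that is 0. There, and when \<open>w\<close> is not a
    vertex of \<open>S\<close>, the coordinate is constant.\<close>
  proof (cases "w \<in> S \<and> S \<noteq> {w}")
    case True
    then have a: "0 < altitude S w" using altitude_pos[of S w] simplex(3)[OF S] by blast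
    show ?thesis
      unfolding continuous_on_iff
    proof (intro ballI allI impI)
      fix x and e :: real assume x: "x \<in> convex hull S" and e: "0 < e"
      have "dist (bary K y w) (bary K x w) < e"
        if y: "y \<in> convex hull S" "dist y x < e * altitude S w" for y
      proof -
        have "\<bar>bary K y w - bary K x w\<bar> * altitude S w
            \<le> norm (\<Sum>s\<in>S. (bary K y s - bary K x s) *\<^sub>R s)"
          using True simplex(2)[OF S] sum_bary[OF S x] sum_bary[OF S y(1)]
          by (intro altitude_coeff_le) (auto simp: sum_subtractf)
        also have "\<dots> = dist y x"
          using bary_repr[OF S x] bary_repr[OF S y(1)]
          by (simp add: scaleR_left_diff_distrib sum_subtractf dist_norm)
        also have "\<dots> < e * altitude S w" by fact
        finally show ?thesis using a by (simp add: dist_real_def)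
      qed
      then show "\<exists>d>0. \<forall>y\<in>convex hull S. dist y x < d \<longrightarrow> dist (bary K y w) (bary K x w) < e"
        using a e by (intro exI[of _ "e * altitude S w"]) auto
    qed
  next
    case False
    have "continuous_on (convex hull S) (\<lambda>x. if w \<in> S then 1 else 0 :: real)" by (rule continuous_on_const)
    then show ?thesis
    proof (rule continuous_on_eq)
      fix x assume x: "x \<in> convex hull S"
      show "(if w \<in> S then 1 else 0) = bary K x w"
        using False bary_outside[OF S x, of w] sum_bary[OF S x] by (cases "w \<in> S") auto
    qed
  qed
qed

lemma continuous_on_\<iota>: "continuous_on (polyhedron K) \<iota>"
proof (rule continuous_on_eq)
  show "continuous_on (polyhedron K) (\<lambda>x. \<Sum>s\<in>\<Union>K. bary K x s *\<^sub>R v s)"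
    by (intro continuous_intros continuous_on_bary)
qed (simp add: \<iota>_global)

text \<open>Brings chords of an image simplex into the zero-sum form to which the altitude and angle
  bounds apply, while remembering the coordinates upstairs.\<close>

lemma \<iota>_diff:
  assumes S: "S \<in> K" "inj_on v S" and x: "x \<in> convex hull S" and y: "y \<in> convex hull S"
  obtains c where "sum c (v ` S) = 0" "\<iota> y - \<iota> x = (\<Sum>a\<in>v ` S. c a *\<^sub>R a)"
    "\<And>s. s \<in> S \<Longrightarrow> c (v s) = bary K y s - bary K x s"
proof
  define c where "c = (\<lambda>a. bary K y (the_inv_into S v a) - bary K x (the_inv_into S v a))"
  show c: "c (v s) = bary K y s - bary K x s" if "s \<in> S" for s
    unfolding c_def using the_inv_into_f_f[OF S(2) that] by simp
  show "sum c (v ` S) = 0"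
    using sum_bary[OF S(1) x] sum_bary[OF S(1) y] c by (simp add: sum.reindex[OF S(2)] sum_subtractf)
  show "\<iota> y - \<iota> x = (\<Sum>a\<in>v ` S. c a *\<^sub>R a)"
    using \<iota>_bary[OF S(1) x] \<iota>_bary[OF S(1) y] c
    by (simp add: sum.reindex[OF S(2)] sum_subtractf scaleR_left_diff_distrib)
qed

text \<open>The factor \<open>c\<close> may exceed 1 as long as the coordinate at \<open>w\<close>
  stays nonnegative, so the same lemma contracts towards the apex and expands away from it.\<close>

lemma radial:
  assumes S: "S \<in> K" "w \<in> S" and y: "y \<in> convex hull S" and c: "0 \<le> c" "0 \<le> 1 - c * (1 - bary K y w)"
  defines "z \<equiv> w + c *\<^sub>R (y - w)"
  shows "z \<in> convex hull S" "bary K z w = 1 - c * (1 - bary K y w)" "\<iota> z = v w + c *\<^sub>R (\<iota> y - v w)"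
proof -
  define \<beta> where "\<beta> = (\<lambda>s. c * bary K y s + (if s = w then 1 - c else 0))"
  note f = simplex(2)[OF S(1)]
  have sumw: "(\<Sum>s\<in>S. \<beta> s *\<^sub>R g s) = c *\<^sub>R (\<Sum>s\<in>S. bary K y s *\<^sub>R g s) + (1 - c) *\<^sub>R g w"
    for g :: "'b \<Rightarrow> 'c::euclidean_space"
    using f S(2) by (simp add: \<beta>_def scaleR_left_distrib sum.distrib scaleR_sum_right
        if_distrib[of "\<lambda>c. c *\<^sub>R _"] cong: if_cong)
  have "is_bary S z \<beta>"
    unfolding is_bary_def
  proof (intro conjI ballI allI impI)
    show "\<beta> s = 0" if "s \<notin> S" for s using that S(2) bary_outside[OF S(1) y] by (auto simp: \<beta>_def)
    show "0 \<le> \<beta> s" if "s \<in> S" for s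
      using bary_nonneg[OF S(1) y, of s] c by (auto simp: \<beta>_def algebra_simps)
    show "sum \<beta> S = 1"
      using f S(2) sum_bary[OF S(1) y] by (simp add: \<beta>_def sum.distrib sum_distrib_left[symmetric])
    show "(\<Sum>s\<in>S. \<beta> s *\<^sub>R s) = z"
      using sumw[of "\<lambda>s. s"] bary_repr[OF S(1) y] by (simp add: z_def algebra_simps)
  qed
  then have z: "z \<in> convex hull S" "bary K z = \<beta>"
    using is_bary_in_hull[OF f] bary_eqI[OF S(1)] by auto
  then show "z \<in> convex hull S" by simp
  show "bary K z w = 1 - c * (1 - bary K y w)" by (simp add: z(2) \<beta>_def algebra_simps)
  show "\<iota> z = v w + c *\<^sub>R (\<iota> y - v w)"
    unfolding \<iota>_bary[OF S(1) z(1)] z(2) sumw using \<iota>_bary[OF S(1) y] by (simp add: algebra_simps)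
qed

end

subsection \<open>Projection of a full star to a linear space\<close>

text \<open>A nonempty open piece of \<open>T\<close> has the full affine dimension, so it is not
  contained in one smaller affine set. Removing that set leaves an open nonempty piece for the
  induction.\<close>

lemma open_not_covered_by_lower_affine:
  fixes T :: "'a::euclidean_space set"
  assumes "finite F" "\<And>A. A \<in> F \<Longrightarrow> affine A \<and> aff_dim A < aff_dim T" "affine T"
    "open Q" "Q \<inter> T \<noteq> {}"
  shows "\<not> Q \<inter> T \<subseteq> \<Union>F"
  using assms
proof (induction arbitrary: Q rule: finite_induct)
  case (insert A F)
  have "openin (top_of_set T) (Q \<inter> T)" using openin_open_Int[OF insert.prems(3), of T] by (simp only: Int_commute)
  then have "aff_dim (Q \<inter> T) = aff_dim T" using aff_dim_openin insert.prems by blast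
  moreover have "aff_dim A < aff_dim T" using insert.prems(1) by blast
  ultimately have "\<not> Q \<inter> T \<subseteq> A" by (metis aff_dim_subset not_less)
  then have "(Q - A) \<inter> T \<noteq> {}" by blast
  moreover have "open (Q - A)" using insert.prems(1,3) by (simp add: affine_closed open_Diff)
  ultimately have "\<not> (Q - A) \<inter> T \<subseteq> \<Union>F" using insert.IH[of "Q - A"] insert.prems(1,2) by blast
  then show ?case by blast
qed auto

lemma half_scale: "0 \<le> N \<Longrightarrow> r / (2 * (N + 1)) * (N + 1) = r / 2" for r N :: real
  by (simp add: field_simps)

text \<open>Induction along the unit interval: the maximum of \<open>Z\<close> exists and cannot be
  below 1. It continues estimates from simplex to simplex along a segment without listing the
  simplices met.\<close>

lemma closed_progress_reaches_one:
  fixes Z :: "real set"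
  assumes "closed Z" "Z \<subseteq> {0..1}" "0 \<in> Z" "\<And>t. t \<in> Z \<Longrightarrow> t < 1 \<Longrightarrow> \<exists>t'\<in>Z. t < t'"
  shows "1 \<in> Z"
proof -
  have "compact Z" using assms(1,2) compact_Icc by (metis closed_Int_compact inf.absorb1)
  then obtain t where t: "t \<in> Z" "\<And>t'. t' \<in> Z \<Longrightarrow> t' \<le> t"
    using compact_attains_sup[of Z] assms(3) by blast
  have "\<not> t < 1" using assms(4)[OF t(1)] t(2) by force
  moreover have "t \<le> 1" using t(1) assms(2) by auto
  ultimately show ?thesis using t(1) by simp
qed

text \<open>The star of \<open>w\<close> seen through orthogonal projection to \<open>T\<close>,
  with \<open>v w\<close> moved to the origin so that the projected star is a cone with apex 0. The
  assumption \<open>graph\<close> bounds slopes by \<kappa> within single simplices only.\<close>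

locale star_chart = complex_map K v \<iota>
  for K :: "'b::euclidean_space set set" and v :: "'b \<Rightarrow> 'a::euclidean_space" and \<iota> :: "'b \<Rightarrow> 'a" +
  fixes w :: 'b and T :: "'a set" and \<kappa> :: real
  assumes w: "w \<in> \<Union>K" and T: "subspace T" and \<kappa>: "0 \<le> \<kappa>"
    and inj: "inj_on (\<lambda>x. closest_point T (\<iota> x - v w)) (star_set K w)"
    and nbhd: "\<exists>r>0. ball 0 r \<inter> T \<subseteq> (\<lambda>x. closest_point T (\<iota> x - v w)) ` star_set K w"
    and graph: "\<And>S x y. S \<in> K \<Longrightarrow> w \<in> S \<Longrightarrow> x \<in> convex hull S \<Longrightarrow> y \<in> convex hull S \<Longrightarrow>
      norm (\<iota> y - \<iota> x - closest_point T (\<iota> y - \<iota> x)) \<le> \<kappa> * norm (closest_point T (\<iota> y - \<iota> x))"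
begin

definition h :: "'b \<Rightarrow> 'a" where "h x = closest_point T (\<iota> x - v w)"

abbreviation "St \<equiv> star_set K w"

definition g :: "'a \<Rightarrow> 'b" where "g = the_inv_into St h"

lemma h_diff: "h y - h x = closest_point T (\<iota> y - \<iota> x)"
  using linear_diff[OF linear_closest_point_subspace[OF T], of "\<iota> y - v w" "\<iota> x - v w"]
  by (simp add: h_def)

lemma inj_h: "inj_on h St" using inj unfolding h_def[abs_def] .

lemma h_in_T: "h x \<in> T" unfolding h_def using closest_point_subspace_in[OF T] .

lemma continuous_on_h: "continuous_on (polyhedron K) h"
  unfolding h_def[abs_def]
  by (intro continuous_on_compose2[OF linear_continuous_on[OF linear_conv_bounded_linear[THEN iffD1,
      OF linear_closest_point_subspace[OF T]], of UNIV]] continuous_intros continuous_on_\<iota>) auto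

lemma continuous_on_h_star: "continuous_on St h"
  using continuous_on_h star_subset by (rule continuous_on_subset)

lemma g_h: "x \<in> St \<Longrightarrow> g (h x) = x"
  unfolding g_def using inj_h by (rule the_inv_into_f_f)

lemma h_g: "b \<in> h ` St \<Longrightarrow> h (g b) = b" and g_in: "b \<in> h ` St \<Longrightarrow> g b \<in> St"
  using g_h by auto

lemma continuous_on_g: "continuous_on (h ` St) g"
  unfolding g_def using continuous_on_h_star compact_star inj_h by (rule continuous_on_inv_into)

lemma compact_image_h: "compact (h ` St)"
  using continuous_on_h_star compact_star by (rule compact_continuous_image)

lemma graph_h:
  "S \<in> K \<Longrightarrow> w \<in> S \<Longrightarrow> x \<in> convex hull S \<Longrightarrow> y \<in> convex hull S \<Longrightarrow>
    norm (\<iota> y - \<iota> x - (h y - h x)) \<le> \<kappa> * norm (h y - h x)"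
  unfolding h_diff by (rule graph)

lemma h_radial:
  assumes "S \<in> K" "w \<in> S" "y \<in> convex hull S" "0 \<le> c" "0 \<le> 1 - c * (1 - bary K y w)"
  shows "h (w + c *\<^sub>R (y - w)) = c *\<^sub>R h y"
  using radial(3)[OF assms] linear_scale[OF linear_closest_point_subspace[OF T], of c "\<iota> y - v w"]
  by (simp add: h_def)

text \<open>The star simplices that miss \<open>x\<close> have compact union. By injectivity its
  image misses \<open>h x\<close>, hence stays at positive distance from it.\<close>

lemma common_simplex_nearby:
  assumes "x \<in> St"
  obtains d where "0 < d"
    "\<And>S y. S \<in> K \<Longrightarrow> w \<in> S \<Longrightarrow> y \<in> convex hull S \<Longrightarrow> dist (h y) (h x) < d \<Longrightarrow> x \<in> convex hull S"
proof -
  define C where "C = (\<Union>S\<in>{S\<in>K. w \<in> S \<and> x \<notin> convex hull S}. convex hull S)"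
  have C: "compact C" "C \<subseteq> St" "x \<notin> C"
    unfolding C_def using finite_complex compact_hull by (auto simp: star_set_def intro!: compact_UN)
  have "closed (h ` C)"
    using compact_continuous_image[OF continuous_on_subset[OF continuous_on_h_star C(2)] C(1)]
    by (rule compact_imp_closed)
  moreover have "h x \<notin> h ` C"
    using C inj_h assms by (metis inj_on_image_mem_iff)
  ultimately obtain d where d: "0 < d" "\<And>z. z \<in> h ` C \<Longrightarrow> d \<le> dist (h x) z"
    using separate_point_closed by metis
  show ?thesis
  proof (rule that[OF d(1)], rule ccontr)
    fix S y assume S: "S \<in> K" "w \<in> S" "y \<in> convex hull S" "dist (h y) (h x) < d" "x \<notin> convex hull S"
    then have "y \<in> C" unfolding C_def by blast
    then show False using d(2)[of "h y"] S(4) by (auto simp: dist_commute)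
  qed
qed

text \<open>The star is a cone, so a neighbourhood of the apex can be blown up to one of any point
  of the open star.\<close>
lemma open_star_interior:
  assumes x: "x \<in> St" "0 < bary K x w" and Q: "open Q" "x \<in> Q"
  obtains r where "0 < r" "ball (h x) r \<inter> T \<subseteq> h ` {y \<in> St. 0 < bary K y w \<and> y \<in> Q}"
proof -
  obtain r0 where r0: "0 < r0" "ball 0 r0 \<inter> T \<subseteq> h ` St" using nbhd unfolding h_def[abs_def] by blast
  \<comment> \<open>Contraction by \<open>c\<close> brings \<open>h x\<close> within
    \<open>r0 / 2\<close> of the apex, well inside the ball known to be covered.\<close>
  define c where "c = min 1 (r0 / (2 * (norm (h x) + 1)))"
  have c: "0 < c" "c \<le> 1" using r0 by (auto simp: c_def add_nonneg_pos)
  have "c * norm (h x) \<le> r0 / (2 * (norm (h x) + 1)) * (norm (h x) + 1)"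
    using c r0 by (intro mult_mono) (auto simp: c_def)
  also have "\<dots> = r0 / 2" by (rule half_scale) simp
  finally have cx: "c * norm (h x) \<le> r0 / 2" .
  obtain S0 where S0: "S0 \<in> K" "w \<in> S0" "x \<in> convex hull S0" using x(1) by (rule starE)
  have b1: "bary K y w \<le> 1" if "S \<in> K" "w \<in> S" "y \<in> convex hull S" for S y
  proof -
    have "bary K y w \<le> sum (bary K y) S"
      by (rule member_le_sum) (use that simplex(2) bary_nonneg[OF that(1,3)] in auto)
    then show ?thesis using sum_bary[OF that(1,3)] by simp
  qed
  define xc where "xc = w + c *\<^sub>R (x - w)"
  have cb: "c * (1 - bary K x w) \<le> c" using c x(2) by (simp add: mult_left_le)
  then have pc: "0 \<le> 1 - c * (1 - bary K x w)" using c by linarith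
  have xc: "xc \<in> convex hull S0" "bary K xc w = 1 - c * (1 - bary K x w)" "h xc = c *\<^sub>R h x"
    unfolding xc_def using radial(1,2)[OF S0 _ pc] h_radial[OF S0 _ pc] c by auto
  then have xcSt: "xc \<in> St" using S0 unfolding star_set_def by blast
  \<comment> \<open>Expansion by \<open>1 / c\<close> stays in the simplex when the coordinate at
    \<open>w\<close> is at least \<open>1 - c\<close>. The inequality is strict at \<open>xc\<close>
    and so persists for nearby points.\<close>
  have lt: "1 - c < bary K xc w" using xc(2) c x(2) by (simp add: algebra_simps)
  have "continuous_on (h ` St) (\<lambda>b. bary K (g b) w)"
    by (rule continuous_on_compose2[OF continuous_on_bary continuous_on_g]) (use g_in star_subset in blast)
  then obtain e1 where e1: "0 < e1"
    "\<And>b. b \<in> h ` St \<Longrightarrow> dist b (h xc) < e1 \<Longrightarrow> dist (bary K (g b) w) (bary K (g (h xc)) w) < bary K xc w - (1 - c)"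
    using lt xcSt unfolding continuous_on_iff by (metis diff_gt_0_iff_gt imageI)
  have blow: "b \<in> h ` St" if b: "b \<in> T" "dist b (h x) < min (r0 / 2) e1 / c" for b
  proof -
    have "dist (c *\<^sub>R b) (c *\<^sub>R h x) = c * dist b (h x)" using c by (simp add: dist_norm flip: scaleR_diff_right)
    also have "\<dots> < min (r0 / 2) e1" using b(2) c by (simp add: pos_less_divide_eq mult.commute)
    finally have d: "dist (c *\<^sub>R b) (c *\<^sub>R h x) < min (r0 / 2) e1" .
    have "norm (c *\<^sub>R b) \<le> norm (c *\<^sub>R h x) + dist (c *\<^sub>R b) (c *\<^sub>R h x)"
      by (simp only: dist_norm norm_triangle_sub)
    then have "norm (c *\<^sub>R b) < r0" using d cx c by simp
    then have cb: "c *\<^sub>R b \<in> h ` St" using r0 b(1) subspace_scale[OF T] by auto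
    define y where "y = g (c *\<^sub>R b)"
    have y: "y \<in> St" "h y = c *\<^sub>R b" using cb g_in h_g by (auto simp: y_def)
    have "dist (bary K y w) (bary K xc w) < bary K xc w - (1 - c)"
      using e1(2)[OF cb] d xc(3) g_h[OF xcSt] by (simp add: y_def)
    then have byy: "1 - c < bary K y w" by (simp add: dist_real_def abs_less_iff)
    obtain S where S: "S \<in> K" "w \<in> S" "y \<in> convex hull S" using y(1) by (rule starE)
    have "1 / c * (1 - bary K y w) \<le> 1" using byy c by (simp add: field_simps)
    then have p: "0 \<le> 1 - 1 / c * (1 - bary K y w)" by simp
    have "w + (1 / c) *\<^sub>R (y - w) \<in> St" using radial(1)[OF S _ p] S c unfolding star_set_def by auto
    moreover have "h (w + (1 / c) *\<^sub>R (y - w)) = b" using h_radial[OF S _ p] c y(2) by simp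
    ultimately show ?thesis by (metis imageI)
  qed
  define P where "P = {y \<in> St. 0 < bary K y w \<and> y \<in> Q}"
  obtain e2 where e2: "0 < e2" "ball x e2 \<subseteq> Q" using Q open_contains_ball by blast
  have hx: "h x \<in> h ` St" "g (h x) = x" using x(1) g_h by auto
  obtain e3 where e3: "0 < e3" "\<And>b. b \<in> h ` St \<Longrightarrow> dist b (h x) < e3 \<Longrightarrow> dist (g b) x < e2"
    using continuous_on_g e2(1) hx unfolding continuous_on_iff by metis
  obtain e4 where e4: "0 < e4" "\<And>b. b \<in> h ` St \<Longrightarrow> dist b (h x) < e4 \<Longrightarrow> dist (bary K (g b) w) (bary K x w) < bary K x w"
    using \<open>continuous_on (h ` St) (\<lambda>b. bary K (g b) w)\<close> x(2) hx unfolding continuous_on_iff by metis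
  define r where "r = min (min (r0 / 2) e1 / c) (min e3 e4)"
  have "0 < r" using r0 e1 c e3 e4 by (simp add: r_def)
  moreover have "ball (h x) r \<inter> T \<subseteq> h ` P"
  proof
    fix b assume b: "b \<in> ball (h x) r \<inter> T"
    then have db: "dist b (h x) < r" by (simp add: dist_commute)
    then have bSt: "b \<in> h ` St" using blow[of b] b by (simp add: r_def)
    have "dist (g b) x < e2" using e3(2)[OF bSt] db by (simp add: r_def)
    then have "g b \<in> Q" using e2(2) by (auto simp: dist_commute)
    moreover have "0 < bary K (g b) w" using e4(2)[OF bSt] db by (simp add: r_def dist_real_def abs_less_iff)
    ultimately have "g b \<in> P" using g_in[OF bSt] by (simp add: P_def)
    then show "b \<in> h ` P" using h_g[OF bSt] by (metis imageI)
  qed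
  ultimately show ?thesis using that unfolding P_def by blast
qed

text \<open>The segment from \<open>h x\<close> to \<open>h y\<close> stays in the ball, so it lifts
  to the star. Each short piece of the lift can be estimated in one simplex, and since all pieces
  have parallel projections the errors add up linearly.\<close>

lemma graph_on_convex:
  assumes D: "ball b0 r \<inter> T \<subseteq> h ` St" and x: "x \<in> St" "h x \<in> ball b0 r" and y: "y \<in> St" "h y \<in> ball b0 r"
  shows "norm (\<iota> y - \<iota> x - (h y - h x)) \<le> \<kappa> * norm (h y - h x)"
proof -
  define a where "a t = h x + t *\<^sub>R (h y - h x)" for t :: real
  have a: "a t \<in> h ` St" if "t \<in> {0..1}" for t
  proof -
    have at: "a t = (1 - t) *\<^sub>R h x + t *\<^sub>R h y" by (simp add: a_def algebra_simps)
    have "a t \<in> ball b0 r" unfolding at using x(2) y(2) that by (intro convexD convex_ball) auto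
    moreover have "a t \<in> T" unfolding a_def by (intro subspace_add subspace_scale subspace_diff T h_in_T)
    ultimately show ?thesis using D by blast
  qed
  have conta: "continuous_on {0..1} a" unfolding a_def[abs_def] by (intro continuous_intros)
  have contg: "continuous_on {0..1} (\<lambda>t. \<iota> (g (a t)))"
    by (rule continuous_on_compose2[OF continuous_on_\<iota> continuous_on_compose2[OF continuous_on_g conta]])
      (use a g_in star_subset in blast)+
  define Z where "Z = {t \<in> {0..1}. norm (\<iota> (g (a t)) - \<iota> x - t *\<^sub>R (h y - h x)) \<le> \<kappa> * (t * norm (h y - h x))}"
  have "closed Z" unfolding Z_def
  proof (rule continuous_on_closed_Collect_le)
    show "continuous_on {0..1} (\<lambda>t. norm (\<iota> (g (a t)) - \<iota> x - t *\<^sub>R (h y - h x)))"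
      by (intro continuous_on_norm continuous_on_diff contg continuous_on_const continuous_on_scaleR
          continuous_on_id)
    show "continuous_on {0..1} (\<lambda>t. \<kappa> * (t * norm (h y - h x)))" by (intro continuous_intros)
  qed simp
  moreover have "Z \<subseteq> {0..1}" unfolding Z_def by blast
  moreover have "0 \<in> Z" using g_h[OF x(1)] by (simp add: Z_def a_def)
  moreover have "\<exists>t'\<in>Z. t < t'" if t: "t \<in> Z" "t < 1" for t
  proof -
    have t01: "0 \<le> t" using t(1) by (simp add: Z_def)
    define x1 where "x1 = g (a t)"
    have at: "a t \<in> h ` St" using a t01 t(2) by simp
    have x1: "x1 \<in> St" "h x1 = a t" using g_in[OF at] h_g[OF at] by (auto simp: x1_def)
    obtain d where d: "0 < d"
      "\<And>S y. S \<in> K \<Longrightarrow> w \<in> S \<Longrightarrow> y \<in> convex hull S \<Longrightarrow> dist (h y) (h x1) < d \<Longrightarrow> x1 \<in> convex hull S"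
      using x1(1) by (rule common_simplex_nearby) (rule that)
    define N where "N = norm (h y - h x)"
    have N: "0 \<le> N" by (simp add: N_def)
    \<comment> \<open>The step is so short that its endpoint differs from \<open>a t\<close> by less
      than \<open>d\<close>; any star simplex over \<open>a t'\<close> then also contains the point
      over \<open>a t\<close>.\<close>
    define t' where "t' = min 1 (t + d / (2 * (N + 1)))"
    have t': "t < t'" "t' \<le> 1" using t(2) d(1) N by (auto simp: t'_def)
    have "(t' - t) * N \<le> d / (2 * (N + 1)) * (N + 1)" using N t' d by (intro mult_mono) (auto simp: t'_def)
    also have "\<dots> = d / 2" using N by (simp add: field_simps)
    finally have small: "(t' - t) * N < d" using d(1) by simp
    have at': "a t' \<in> h ` St" using a t01 t' by simp
    define y1 where "y1 = g (a t')"
    have y1: "y1 \<in> St" "h y1 = a t'" using g_in[OF at'] h_g[OF at'] by (auto simp: y1_def)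
    have diff: "a t' - a t = (t' - t) *\<^sub>R (h y - h x)" by (simp add: a_def algebra_simps)
    obtain S where S: "S \<in> K" "w \<in> S" "y1 \<in> convex hull S" using y1(1) by (rule starE)
    have "dist (h y1) (h x1) < d"
      unfolding dist_norm x1(2) y1(2) diff using small t' by (simp add: N_def)
    then have "x1 \<in> convex hull S" using d(2) S by blast
    then have "norm (\<iota> y1 - \<iota> x1 - (h y1 - h x1)) \<le> \<kappa> * norm (h y1 - h x1)"
      using graph_h S by blast
    then have "norm (\<iota> y1 - \<iota> x1 - (t' - t) *\<^sub>R (h y - h x)) \<le> \<kappa> * ((t' - t) * N)"
      unfolding x1(2) y1(2) diff using t' by (simp add: N_def)
    moreover have "norm (\<iota> x1 - \<iota> x - t *\<^sub>R (h y - h x)) \<le> \<kappa> * (t * N)"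
      using t(1) by (simp add: Z_def x1_def N_def)
    moreover have "\<iota> y1 - \<iota> x - t' *\<^sub>R (h y - h x)
        = (\<iota> x1 - \<iota> x - t *\<^sub>R (h y - h x)) + (\<iota> y1 - \<iota> x1 - (t' - t) *\<^sub>R (h y - h x))"
      by (simp add: algebra_simps)
    ultimately have "norm (\<iota> y1 - \<iota> x - t' *\<^sub>R (h y - h x)) \<le> \<kappa> * (t * N) + \<kappa> * ((t' - t) * N)"
      using norm_triangle_mono by metis
    also have "\<dots> = \<kappa> * (t' * N)" by (simp add: algebra_simps)
    finally have "t' \<in> Z" using t' t01 by (simp add: Z_def y1_def N_def)
    then show ?thesis using t'(1) by blast
  qed
  ultimately have "1 \<in> Z" by (rule closed_progress_reaches_one)
  then show ?thesis using g_h[OF y(1)] by (simp add: Z_def a_def)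
qed

text \<open>At a point of the open star a short step in any direction of \<open>T\<close> stays in
  the image, and a point over its end shares a simplex with \<open>x\<close>. A tangent vector at
  the vertex thus becomes a chord from \<open>x\<close> within a simplex, whose angle at the foot of
  \<open>x\<close> is controlled.\<close>

lemma direction_in_simplex:
  assumes x: "x \<in> St" "0 < bary K x w" and b: "b \<in> T"
  obtains S y s where "S \<in> K" "w \<in> S" "x \<in> convex hull S" "y \<in> convex hull S" "0 < s" "h y - h x = s *\<^sub>R b"
proof -
  obtain d where d: "0 < d"
      "\<And>S y. S \<in> K \<Longrightarrow> w \<in> S \<Longrightarrow> y \<in> convex hull S \<Longrightarrow> dist (h y) (h x) < d \<Longrightarrow> x \<in> convex hull S"
    using x(1) by (rule common_simplex_nearby) (rule that)
  obtain r where r: "0 < r" "ball (h x) r \<inter> T \<subseteq> h ` {y \<in> St. 0 < bary K y w \<and> y \<in> UNIV}"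
    using open_star_interior[OF x open_UNIV UNIV_I] by blast
  define s where "s = min r d / (2 * (norm b + 1))"
  have s: "0 < s" using r d by (simp add: s_def add_nonneg_pos)
  have "s * norm b \<le> s * (norm b + 1)" using s by simp
  also have "\<dots> = min r d / 2" unfolding s_def by (rule half_scale) simp
  finally have small: "s * norm b < min r d" using r d by linarith
  have "h x + s *\<^sub>R b \<in> ball (h x) r \<inter> T"
    using small s b h_in_T T by (simp add: dist_norm subspace_add subspace_scale)
  then obtain y where y: "y \<in> St" "h y = h x + s *\<^sub>R b" using r(2) by (auto simp: image_iff subset_iff)
  obtain S where S: "S \<in> K" "w \<in> S" "y \<in> convex hull S" using y(1) by (rule starE)
  have "x \<in> convex hull S" using d(2)[OF S] small s y(2) by (simp add: dist_norm)
  then show ?thesis using that[OF S(1,2) _ S(3) s] y(2) by simp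
qed

section \<open>Dimension of the star simplices and persistence of barycentric coordinates\<close>

lemma h_bary:
  assumes "S \<in> K" "x \<in> convex hull S"
  shows "h x = (\<Sum>s\<in>S. bary K x s *\<^sub>R h s)"
proof -
  note lin = linear_closest_point_subspace[OF T]
  have "\<iota> x - v w = (\<Sum>s\<in>S. bary K x s *\<^sub>R (v s - v w))"
    using \<iota>_bary[OF assms] sum_bary[OF assms]
    by (simp add: scaleR_diff_right sum_subtractf flip: scaleR_sum_left)
  also have "\<dots> = (\<Sum>s\<in>S. bary K x s *\<^sub>R (\<iota> s - v w))"
    by (intro sum.cong refl) (simp add: \<iota>_vertex[OF subsetD[OF simplex(4)[OF assms(1)]]])
  finally show ?thesis
    unfolding h_def by (simp only: linear_sum[OF lin] linear_scale[OF lin])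
qed

text \<open>An affine dependence among the projected vertices would let the barycentre of
  \<open>S\<close> move without moving its projection, against injectivity. Hence the projected
  vertices are independent in \<open>T\<close>.\<close>

lemma card_star_simplex_le:
  assumes S: "S \<in> K" "w \<in> S"
  shows "card S \<le> dim T + 1"
proof -
  note f = simplex(2)[OF S(1)]
  have St: "x \<in> St" if "x \<in> convex hull S" for x using that S unfolding star_set_def by blast
  have injS: "inj_on h S" using inj_h by (rule inj_on_subset) (use St[OF hull_inc] in blast)
  define k where "k = real (card S)"
  have k: "k > 0" using f simplex(1)[OF S(1)] by (simp add: k_def card_gt_0_iff)
  have "\<not> affine_dependent (h ` S)"
  proof
    assume "affine_dependent (h ` S)"
    then obtain U where U: "sum U (h ` S) = 0" "\<exists>b\<in>h ` S. U b \<noteq> 0" "(\<Sum>b\<in>h ` S. U b *\<^sub>R b) = 0"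
      using affine_dependent_explicit_finite[of "h ` S"] f by blast
    define c where "c s = U (h s)" for s
    have c: "sum c S = 0" "(\<Sum>s\<in>S. c s *\<^sub>R h s) = 0"
      using U(1,3) by (auto simp: c_def[abs_def] sum.reindex[OF injS])
    obtain s0 where s0: "s0 \<in> S" "c s0 \<noteq> 0" using U(2) by (auto simp: c_def)
    \<comment> \<open>The scale guarantees \<open>\<bar>e * c s\<bar> \<le> 1 / k\<close>, so the
      perturbed barycentric weights remain nonnegative.\<close>
    define e where "e = 1 / (k * (1 + (\<Sum>s\<in>S. \<bar>c s\<bar>)))"
    have sp: "0 \<le> (\<Sum>s\<in>S. \<bar>c s\<bar>)" by (simp add: sum_nonneg)
    have e: "0 < e" using k sp by (simp add: e_def add_pos_nonneg)
    have ec: "\<bar>e * c s\<bar> \<le> 1 / k" if "s \<in> S" for s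
    proof -
      have "\<bar>c s\<bar> \<le> (\<Sum>s\<in>S. \<bar>c s\<bar>)" by (rule member_le_sum) (use that f in auto)
      then have "e * \<bar>c s\<bar> \<le> e * (1 + (\<Sum>s\<in>S. \<bar>c s\<bar>))" using e by (intro mult_left_mono) auto
      also have "\<dots> = 1 / k"
      proof -
        have "1 + (\<Sum>s\<in>S. \<bar>c s\<bar>) \<noteq> 0" using sp by linarith
        then show ?thesis using k by (simp add: e_def)
      qed
      finally show ?thesis using e by (simp add: abs_mult)
    qed
    define \<beta> where "\<beta> q s = (if s \<in> S then 1 / k + q * c s else 0)" for q s
    have ib: "is_bary S (\<Sum>s\<in>S. \<beta> q s *\<^sub>R s) (\<beta> q)" if q: "q = 0 \<or> q = e" for q
      unfolding is_bary_def
    proof (intro conjI ballI allI impI refl)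
      show "\<beta> q s = 0" if "s \<notin> S" for s using that by (simp add: \<beta>_def)
      show "0 \<le> \<beta> q s" if "s \<in> S" for s using ec[OF that] that k q by (auto simp: \<beta>_def abs_le_iff)
      have "sum (\<beta> q) S = (\<Sum>s\<in>S. 1 / k + q * c s)" by (rule sum.cong) (auto simp: \<beta>_def)
      also have "\<dots> = 1" using c(1) k by (simp add: sum.distrib k_def flip: sum_distrib_left)
      finally show "sum (\<beta> q) S = 1" .
    qed
    have heq: "h (\<Sum>s\<in>S. \<beta> q s *\<^sub>R s) = (\<Sum>s\<in>S. (1 / k) *\<^sub>R h s)" if q: "q = 0 \<or> q = e" for q
    proof -
      have "h (\<Sum>s\<in>S. \<beta> q s *\<^sub>R s) = (\<Sum>s\<in>S. \<beta> q s *\<^sub>R h s)"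
        using h_bary[OF S(1) is_bary_in_hull[OF f ib[OF q]]] bary_eqI[OF S(1) ib[OF q]] by simp
      also have "\<dots> = (\<Sum>s\<in>S. (1 / k) *\<^sub>R h s + q *\<^sub>R (c s *\<^sub>R h s))"
        by (rule sum.cong) (auto simp: \<beta>_def scaleR_left_distrib)
      also have "\<dots> = (\<Sum>s\<in>S. (1 / k) *\<^sub>R h s)" using c(2) by (simp add: sum.distrib scaleR_sum_right[symmetric] del: scaleR_scaleR)
      finally show ?thesis .
    qed
    have "(\<Sum>s\<in>S. \<beta> 0 s *\<^sub>R s) = (\<Sum>s\<in>S. \<beta> e s *\<^sub>R s)"
    proof (rule inj_onD[OF inj_h])
      show "h (\<Sum>s\<in>S. \<beta> 0 s *\<^sub>R s) = h (\<Sum>s\<in>S. \<beta> e s *\<^sub>R s)"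
        unfolding heq[OF disjI1[OF refl]] heq[OF disjI2[OF refl]] ..
    qed (rule St[OF is_bary_in_hull[OF f ib]], simp)+
    then have "\<beta> 0 = \<beta> e" using bary_eqI[OF S(1) ib] by metis
    then have "\<beta> 0 s0 = \<beta> e s0" by simp
    then show False using s0 e by (simp add: \<beta>_def)
  qed
  then have "int (card (h ` S)) = aff_dim (h ` S) + 1" by (rule aff_dim_affine_independent)
  also have "aff_dim (h ` S) \<le> aff_dim T" by (rule aff_dim_subset) (use h_in_T in blast)
  finally show ?thesis using aff_dim_subspace[OF T] card_image[OF injS] by simp
qed

text \<open>Otherwise a neighbourhood of \<open>h x\<close> would be covered by the affine hulls of
  finitely many projected simplices of smaller dimension. Top dimension matters because thickness
  then yields altitudes with a factor \<open>dim T\<close>, which offsets the loss in a largest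
  coordinate of only \<open>1 / (dim T + 1)\<close>.\<close>

lemma open_star_pure:
  assumes x: "x \<in> St" "0 < bary K x w"
  obtains S where "S \<in> K" "w \<in> S" "x \<in> convex hull S" "card S = dim T + 1"
proof -
  define C where "C = (\<Union>S\<in>{S\<in>K. w \<in> S \<and> card S = dim T + 1}. convex hull S)"
  have "x \<in> C"
  proof (rule ccontr)
    assume nC: "x \<notin> C"
    have "compact C" unfolding C_def using finite_complex compact_hull by (intro compact_UN) auto
    then have "open (- C)" using compact_imp_closed by blast
    then obtain r where r: "0 < r" "ball (h x) r \<inter> T \<subseteq> h ` {y \<in> St. 0 < bary K y w \<and> y \<in> - C}"
      using open_star_interior[OF x, of "- C"] nC by blast
    define F where "F = (\<lambda>S. affine hull (h ` S)) ` {S\<in>K. w \<in> S \<and> card S \<noteq> dim T + 1}"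
    have "\<not> ball (h x) r \<inter> T \<subseteq> \<Union>F"
    proof (rule open_not_covered_by_lower_affine)
      show "finite F" unfolding F_def using finite_complex by simp
      show "affine T" using T by (rule subspace_imp_affine)
      show "ball (h x) r \<inter> T \<noteq> {}" using r(1) h_in_T[of x] by (metis IntI centre_in_ball empty_iff)
      fix A assume "A \<in> F"
      then obtain S where S: "S \<in> K" "w \<in> S" "card S \<noteq> dim T + 1" "A = affine hull (h ` S)"
        unfolding F_def by blast
      note f = simplex(2)[OF S(1)]
      have "aff_dim (h ` S) \<le> int (card (h ` S)) - 1" using aff_dim_le_card[of "h ` S"] f by simp
      also have "card (h ` S) \<le> card S" using f by (rule card_image_le)
      also have "card S < dim T + 1" using card_star_simplex_le[OF S(1,2)] S(3) by simp
      finally have "aff_dim (h ` S) < aff_dim T" by (simp add: aff_dim_subspace[OF T])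
      then show "affine A \<and> aff_dim A < aff_dim T" using S(4) by simp
    qed simp
    moreover have "ball (h x) r \<inter> T \<subseteq> \<Union>F"
    proof
      fix b assume "b \<in> ball (h x) r \<inter> T"
      then obtain y where y: "y \<in> St" "y \<notin> C" "b = h y" using r(2) by blast
      obtain S where S: "S \<in> K" "w \<in> S" "y \<in> convex hull S" using y(1) by (rule starE)
      note f = simplex(2)[OF S(1)]
      have "h y \<in> convex hull (h ` S)"
        unfolding h_bary[OF S(1,3)]
        by (intro convex_sum f convex_convex_hull sum_bary[OF S(1,3)] bary_nonneg[OF S(1,3)] hull_inc imageI)
      then have "h y \<in> affine hull (h ` S)" using convex_hull_subset_affine_hull by blast
      moreover have "card S \<noteq> dim T + 1" using y(2) S unfolding C_def by blast
      ultimately show "b \<in> \<Union>F" unfolding F_def using S y(3) by blast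
    qed
    ultimately show False by blast
  qed
  then show ?thesis using that unfolding C_def by blast
qed

text \<open>Along the segment from \<open>h x\<close> to \<open>b\<close> the coordinate at
  \<open>w\<close> falls at rate at most \<Lambda>, so it cannot reach 0. While it is positive, the
  lift is in the open star and can be continued through a top-dimensional simplex.\<close>

lemma bary_persists:
  assumes x: "x \<in> St" and b: "b \<in> T" and \<Lambda>: "0 \<le> \<Lambda>" "\<Lambda> * norm (b - h x) < bary K x w"
    and lip: "\<And>S y z. S \<in> K \<Longrightarrow> w \<in> S \<Longrightarrow> card S = dim T + 1 \<Longrightarrow> y \<in> convex hull S \<Longrightarrow> z \<in> convex hull S \<Longrightarrow>
       \<bar>bary K y w - bary K z w\<bar> \<le> \<Lambda> * norm (h y - h z)"
  obtains y where "y \<in> St" "h y = b" "0 < bary K y w"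
proof -
  define N where "N = norm (b - h x)"
  have N: "0 \<le> N" by (simp add: N_def)
  define a where "a t = h x + t *\<^sub>R (b - h x)" for t :: real
  have aT: "a t \<in> T" for t unfolding a_def by (intro subspace_add subspace_scale subspace_diff T h_in_T b)
  have conta: "continuous_on {0..1} a" unfolding a_def[abs_def] by (intro continuous_intros)
  \<comment> \<open>That the whole segment is covered is part of the claim, so the lift is
    considered only over \<open>I\<close>.\<close>
  define I where "I = {0..1} \<inter> a -` (h ` St)"
  have "closed I" unfolding I_def
    by (rule continuous_closed_preimage[OF conta _ compact_imp_closed[OF compact_image_h]]) simp
  have contb: "continuous_on I (\<lambda>t. bary K (g (a t)) w)"
  proof (rule continuous_on_compose2[OF continuous_on_bary])
    show "continuous_on I (\<lambda>t. g (a t))"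
      by (rule continuous_on_compose2[OF continuous_on_g continuous_on_subset[OF conta]]) (auto simp: I_def)
    show "(\<lambda>t. g (a t)) ` I \<subseteq> polyhedron K" using g_in star_subset by (auto simp: I_def)
  qed
  define Z where "Z = {t \<in> I. bary K x w - \<Lambda> * (t * N) \<le> bary K (g (a t)) w}"
  have "closed Z" unfolding Z_def
    by (intro continuous_on_closed_Collect_le continuous_intros contb \<open>closed I\<close>)
  moreover have "Z \<subseteq> {0..1}" unfolding Z_def I_def by blast
  moreover have "0 \<in> Z" using g_h[OF x] x by (simp add: Z_def I_def a_def)
  moreover have pos: "0 < bary K (g (a t)) w" if "t \<in> Z" for t
  proof -
    have "\<Lambda> * (t * N) \<le> \<Lambda> * N" using that \<Lambda>(1) N by (intro mult_left_mono mult_left_le_one_le) (auto simp: Z_def I_def)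
    then show ?thesis using that \<Lambda>(2) by (simp add: Z_def N_def)
  qed
  moreover have "\<exists>t'\<in>Z. t < t'" if t: "t \<in> Z" "t < 1" for t
  proof -
    have t01: "0 \<le> t" and at: "a t \<in> h ` St" using t(1) by (auto simp: Z_def I_def)
    define x1 where "x1 = g (a t)"
    have x1: "x1 \<in> St" "h x1 = a t" using g_in[OF at] h_g[OF at] by (auto simp: x1_def)
    have x1pos: "0 < bary K x1 w" using pos[OF t(1)] by (simp add: x1_def)
    obtain d where d: "0 < d"
      "\<And>S y. S \<in> K \<Longrightarrow> w \<in> S \<Longrightarrow> y \<in> convex hull S \<Longrightarrow> dist (h y) (h x1) < d \<Longrightarrow> x1 \<in> convex hull S"
      using x1(1) by (rule common_simplex_nearby) (rule that)
    obtain r where r: "0 < r" "ball (h x1) r \<inter> T \<subseteq> h ` {y \<in> St. 0 < bary K y w \<and> y \<in> UNIV}"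
      using open_star_interior[OF x1(1) x1pos open_UNIV UNIV_I] by blast
    define t' where "t' = min 1 (t + min r d / (2 * (N + 1)))"
    have t': "t < t'" "t' \<le> 1" using t(2) d(1) r(1) N by (auto simp: t'_def)
    have "(t' - t) * N \<le> min r d / (2 * (N + 1)) * (N + 1)" using N t' d r by (intro mult_mono) (auto simp: t'_def)
    also have "\<dots> = min r d / 2" using N by (simp add: field_simps)
    finally have small: "(t' - t) * N < min r d" using d(1) r(1) by linarith
    have diff: "a t' - a t = (t' - t) *\<^sub>R (b - h x)" by (simp add: a_def algebra_simps)
    have dist': "dist (a t') (a t) = (t' - t) * N" unfolding dist_norm diff using t' by (simp add: N_def)
    then have "a t' \<in> ball (h x1) r \<inter> T" using small aT x1(2) by (simp add: dist_commute)
    then obtain y1 where y1: "y1 \<in> St" "h y1 = a t'" "0 < bary K y1 w" using r(2) by (auto simp: image_iff subset_iff)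
    obtain S where S: "S \<in> K" "w \<in> S" "y1 \<in> convex hull S" "card S = dim T + 1"
      using y1(1,3) by (rule open_star_pure)
    have "x1 \<in> convex hull S" using d(2)[OF S(1-3)] dist' small x1(2) y1(2) by simp
    then have "\<bar>bary K y1 w - bary K x1 w\<bar> \<le> \<Lambda> * norm (h y1 - h x1)" using lip S by blast
    also have "norm (h y1 - h x1) = (t' - t) * N" using dist' x1(2) y1(2) by (simp add: dist_norm)
    finally have "bary K x1 w - \<Lambda> * ((t' - t) * N) \<le> bary K y1 w" by linarith
    moreover have "bary K x w - \<Lambda> * (t * N) \<le> bary K x1 w" using t(1) by (simp add: Z_def x1_def)
    moreover have "\<Lambda> * (t' * N) = \<Lambda> * (t * N) + \<Lambda> * ((t' - t) * N)" by (simp add: algebra_simps)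
    ultimately have "bary K x w - \<Lambda> * (t' * N) \<le> bary K y1 w" by linarith
    moreover have "g (a t') = y1" using g_h[OF y1(1)] y1(2) by simp
    moreover have "a t' \<in> h ` St" using y1 by (metis imageI)
    ultimately have "t' \<in> Z" using t' t01 by (simp add: Z_def I_def)
    then show ?thesis using t'(1) by blast
  qed
  ultimately have "1 \<in> Z" using closed_progress_reaches_one by blast
  moreover have "a 1 = b" by (simp add: a_def)
  ultimately have "b \<in> h ` St" "0 < bary K (g b) w" using pos[of 1] by (auto simp: Z_def I_def)
  then show ?thesis using that[of "g b"] g_in h_g by blast
qed

end

subsection \<open>Local homeomorphisms with a unique preimage in every component\<close>

text \<open>The set of points with exactly one preimage is both open and closed.\<close>
lemma local_homeomorphism_bij:
  fixes f :: "'b::euclidean_space \<Rightarrow> 'a::euclidean_space"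
  assumes X: "compact X" and cont: "continuous_on X f" and im: "f ` X \<subseteq> Y"
    and loc: "\<And>x Q. x \<in> X \<Longrightarrow> open Q \<Longrightarrow> x \<in> Q \<Longrightarrow>
      \<exists>W. W \<subseteq> X \<inter> Q \<and> openin (top_of_set X) W \<and> x \<in> W \<and> inj_on f W \<and> openin (top_of_set Y) (f ` W)"
    and comp: "\<And>C. C \<in> components Y \<Longrightarrow> \<exists>x\<in>X. f x \<in> C \<and> (\<forall>y\<in>X. f y = f x \<longrightarrow> y = x)"
  shows "bij_betw f X Y"
proof -
  define U where "U = {p \<in> Y. \<exists>x\<in>X. f x = p \<and> (\<forall>y\<in>X. f y = p \<longrightarrow> y = x)}"
  have "openin (top_of_set Y) U"
  proof (subst openin_subopen, intro ballI)
    fix p assume "p \<in> U"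
    then obtain x where x: "x \<in> X" "f x = p" "\<And>y. y \<in> X \<Longrightarrow> f y = p \<Longrightarrow> y = x"
      unfolding U_def by blast
    obtain W where W: "W \<subseteq> X" "openin (top_of_set X) W" "x \<in> W" "inj_on f W" "openin (top_of_set Y) (f ` W)"
      using loc[OF x(1) open_UNIV UNIV_I] by blast
    have "closedin (top_of_set X) (X - W)" using W(2) by (simp add: openin_closedin_eq)
    then have "compact (X - W)" using X closedin_compact by blast
    then have cl: "closed (f ` (X - W))"
      using compact_continuous_image continuous_on_subset[OF cont] compact_imp_closed by (metis Diff_subset)
    \<comment> \<open>Points of this open set have all their preimages in \<open>W\<close>, where
      \<open>f\<close> is injective.\<close>
    have "f ` W - f ` (X - W) = f ` W \<inter> - f ` (X - W)" by blast
    then have "openin (top_of_set Y) (f ` W - f ` (X - W))"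
      using openin_Int_open[OF W(5)] cl by (simp add: open_Compl)
    moreover have "p \<in> f ` W - f ` (X - W)" using W(3) x by blast
    moreover have "f ` W - f ` (X - W) \<subseteq> U"
    proof
      fix q assume q: "q \<in> f ` W - f ` (X - W)"
      then obtain x' where x': "x' \<in> W" "f x' = q" by blast
      have "y = x'" if y: "y \<in> X" "f y = q" for y
      proof -
        have "q \<in> f ` (X - W)" if "y \<notin> W" using y that by (metis DiffI imageI)
        then have "y \<in> W" using q by (metis DiffE)
        then show ?thesis using inj_onD[OF W(4), of y x'] x' y(2) by simp
      qed
      then show "q \<in> U" unfolding U_def using x' W(1) im by blast
    qed
    ultimately show "\<exists>T. openin (top_of_set Y) T \<and> p \<in> T \<and> T \<subseteq> U" by blast
  qed
  then obtain O1 where O1: "open O1" "U = Y \<inter> O1" unfolding openin_open by blast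
  have "openin (top_of_set Y) (Y - U)"
  proof (subst openin_subopen, intro ballI)
    fix p assume p: "p \<in> Y - U"
    show "\<exists>T. openin (top_of_set Y) T \<and> p \<in> T \<and> T \<subseteq> Y - U"
    \<comment> \<open>A point of \<open>Y - U\<close> has no preimage, an open condition by
      compactness, or two preimages; disjoint neighbourhoods of these have open images, and over
      their intersection there are still two.\<close>
    proof (cases "p \<in> f ` X")
      case False
      have "closed (f ` X)" using compact_continuous_image[OF cont X] by (rule compact_imp_closed)
      then have "openin (top_of_set Y) (Y \<inter> - f ` X)" by (intro openin_open_Int open_Compl)
      moreover have "Y \<inter> - f ` X \<subseteq> Y - U" unfolding U_def by blast
      ultimately show ?thesis using p False by blast
    next
      case True
      then obtain x1 where x1: "x1 \<in> X" "f x1 = p" by blast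
      then obtain x2 where x2: "x2 \<in> X" "f x2 = p" "x1 \<noteq> x2" using p unfolding U_def by blast
      obtain Q1 Q2 where Q: "open Q1" "open Q2" "x1 \<in> Q1" "x2 \<in> Q2" "Q1 \<inter> Q2 = {}"
        using hausdorff[OF x2(3)] by blast
      obtain W1 where W1: "W1 \<subseteq> X \<inter> Q1" "x1 \<in> W1" "openin (top_of_set Y) (f ` W1)"
        using loc[OF x1(1) Q(1,3)] by blast
      obtain W2 where W2: "W2 \<subseteq> X \<inter> Q2" "x2 \<in> W2" "openin (top_of_set Y) (f ` W2)"
        using loc[OF x2(1) Q(2,4)] by blast
      have "openin (top_of_set Y) (f ` W1 \<inter> f ` W2)" using W1(3) W2(3) by (rule openin_Int)
      moreover have "p \<in> f ` W1 \<inter> f ` W2" using imageI[OF W1(2), of f] imageI[OF W2(2), of f] x1(2) x2(2) by simp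
      moreover have "f ` W1 \<inter> f ` W2 \<subseteq> Y - U"
      proof
        fix q assume "q \<in> f ` W1 \<inter> f ` W2"
        then obtain y1 y2 where y: "y1 \<in> W1" "y2 \<in> W2" "f y1 = q" "f y2 = q"
          by (metis IntE imageE)
        then have "y1 \<in> X" "y2 \<in> X" "y1 \<noteq> y2" using W1(1) W2(1) Q(5) by auto
        then show "q \<in> Y - U" using y im unfolding U_def by blast
      qed
      ultimately show ?thesis by blast
    qed
  qed
  then obtain O2 where O2: "open O2" "Y - U = Y \<inter> O2" unfolding openin_open by blast
  have "C \<subseteq> U" if C: "C \<in> components Y" for C
  proof -
    have CY: "C \<subseteq> Y" "connected C" using C in_components_subset in_components_connected by auto
    have "O1 \<inter> O2 \<inter> C = {}" "C \<subseteq> O1 \<union> O2" using O1 O2 CY(1) by auto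
    then have "O1 \<inter> C = {} \<or> O2 \<inter> C = {}" using connectedD[OF CY(2) O1(1) O2(1)] by blast
    moreover have "O1 \<inter> C \<noteq> {}"
    proof -
      obtain x where "x \<in> X" "f x \<in> C" "\<forall>y\<in>X. f y = f x \<longrightarrow> y = x" using comp[OF C] by blast
      then have "f x \<in> U" unfolding U_def using im by blast
      then show ?thesis using \<open>f x \<in> C\<close> O1(2) by blast
    qed
    ultimately show ?thesis using O1 O2 CY(1) by blast
  qed
  then have "Y \<subseteq> U" using Union_components[of Y] by blast
  then have U: "\<And>p. p \<in> Y \<Longrightarrow> \<exists>x\<in>X. f x = p \<and> (\<forall>y\<in>X. f y = p \<longrightarrow> y = x)" unfolding U_def by blast
  show ?thesis
    unfolding bij_betw_def
  proof
    show "inj_on f X"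
    proof (rule inj_onI)
      fix x y assume "x \<in> X" "y \<in> X" "f x = f y"
      then show "x = y" using U[of "f x"] im by (metis image_subset_iff)
    qed
    show "f ` X = Y" using U im by blast
  qed
qed

subsection \<open>The closest-point projection of the complex\<close>

text \<open>The situation for \<open>1 \<le> m\<close>, with the real \<open>infdist\<close> in
  place of the extended \<open>lfs\<close>. The final theorem derives this form and treats
  \<open>m = 0\<close> apart.\<close>

locale manifold_complex = complex_map K v \<iota>
  for K :: "'b::euclidean_space set set" and v :: "'b \<Rightarrow> 'a::euclidean_space" and \<iota> :: "'b \<Rightarrow> 'a" +
  fixes M :: "'a set" and m :: nat and t0 \<mu>0 \<epsilon>0 :: real
  assumes M: "compact M" "C2_submanifold M m" and m: "1 \<le> m"
    and vM: "v ` \<Union>K \<subseteq> M" and injv: "inj_on v (\<Union>K)"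
    and star_inj: "\<And>w. w \<in> \<Union>K \<Longrightarrow> inj_on \<iota> (star_set K w)"
    and proj_inj: "\<And>w. w \<in> \<Union>K \<Longrightarrow> inj_on (closest_point (tangent_flat M (v w))) (\<iota> ` star_set K w)"
    and proj_int: "\<And>w. w \<in> \<Union>K \<Longrightarrow> v w \<in> (top_of_set (tangent_flat M (v w))) interior_of
                      (closest_point (tangent_flat M (v w)) ` \<iota> ` star_set K w)"
    and cst: "0 < t0" "t0 \<le> 1" "0 < \<mu>0" "\<mu>0 \<le> 1" "0 < \<epsilon>0" "\<epsilon>0 \<le> sqrt \<mu>0 * t0\<^sup>2 / 18"
    and Rpos: "\<And>w. w \<in> \<Union>K \<Longrightarrow> 0 < infdist (v w) (medial_axis M)"
    and thick: "\<And>S. S \<in> K \<Longrightarrow> 2 \<le> card S \<Longrightarrow> t0 \<le> thickness (v ` S)"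
    and edge: "\<And>S s. S \<in> K \<Longrightarrow> 2 \<le> card S \<Longrightarrow> s \<in> S \<Longrightarrow>
          \<mu>0 * \<epsilon>0 * infdist (v s) (medial_axis M) \<le> longest_edge (v ` S) \<and>
          longest_edge (v ` S) \<le> \<epsilon>0 * infdist (v s) (medial_axis M)"
    and vertex_sanity: "\<And>w w'. w \<in> \<Union>K \<Longrightarrow> w' \<in> \<Union>K \<Longrightarrow>
        dist (v w) (v w') < infdist (v w) (medial_axis M) / 15 \<Longrightarrow>
        closest_point (tangent_flat M (v w)) (v w')
                 \<in> closest_point (tangent_flat M (v w)) ` \<iota> ` star_set K w \<Longrightarrow> w' \<in> star_vertices K w"
begin

abbreviation "R w \<equiv> infdist (v w) (medial_axis M)"
abbreviation "TM \<equiv> tangent_space M"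
abbreviation "\<pi> \<equiv> closest_point M"

lemma constants: "\<epsilon>0 \<le> 1 / 18" "\<epsilon>0 / t0 \<le> 1 / 18" "324 * \<epsilon>0\<^sup>2 \<le> \<mu>0 * t0 ^ 4"
proof -
  have s: "0 < sqrt \<mu>0" "sqrt \<mu>0 \<le> 1" using cst by auto
  have "sqrt \<mu>0 * t0\<^sup>2 \<le> 1 * t0" using s cst by (intro mult_mono) (auto simp: power2_eq_square mult_left_le)
  then have e: "\<epsilon>0 \<le> t0 / 18" using cst(6) by simp
  then show "\<epsilon>0 \<le> 1 / 18" using cst(2) by simp
  show "\<epsilon>0 / t0 \<le> 1 / 18" using e cst(1) by (simp add: pos_divide_le_eq)
  have "(18 * \<epsilon>0)\<^sup>2 \<le> (sqrt \<mu>0 * t0\<^sup>2)\<^sup>2" using cst by (intro power_mono) auto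
  then show "324 * \<epsilon>0\<^sup>2 \<le> \<mu>0 * t0 ^ 4" using cst(3) by (simp add: power_mult_distrib flip: power_mult)
qed

lemma image_simplex:
  assumes "S \<in> K"
  shows "inj_on v S" "card (v ` S) = card S" "finite (v ` S)" "v ` S \<subseteq> M"
proof -
  show i: "inj_on v S" using injv simplex(4)[OF assms] by (rule inj_on_subset)
  show "card (v ` S) = card S" using i by (rule card_image)
  show "finite (v ` S)" "v ` S \<subseteq> M" using simplex[OF assms] vM by auto
qed

lemma TM_subspace: "p \<in> M \<Longrightarrow> subspace (TM p)" "p \<in> M \<Longrightarrow> dim (TM p) = m"
  using tangent_space_subspace[OF M(2)] by auto

lemma vertex_in_M: "w \<in> \<Union>K \<Longrightarrow> v w \<in> M" using vM by blast

lemma \<pi>: "x \<in> polyhedron K \<Longrightarrow> \<pi> (\<iota> x) \<in> M"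
    "x \<in> polyhedron K \<Longrightarrow> z \<in> M \<Longrightarrow> dist (\<iota> x) (\<pi> (\<iota> x)) \<le> dist (\<iota> x) z"
proof -
  assume "x \<in> polyhedron K"
  then obtain S where S: "S \<in> K" by (rule polyhedronE)
  then have "M \<noteq> {}" using image_simplex(4)[OF S] simplex(1)[OF S] by blast
  note c = closest_point_infdist[OF compact_imp_closed[OF M(1)] this]
  show "\<pi> (\<iota> x) \<in> M" by (rule c)
  show "z \<in> M \<Longrightarrow> dist (\<iota> x) (\<pi> (\<iota> x)) \<le> dist (\<iota> x) z" using c(2,3) by metis
qed

lemma edge_le: "S \<in> K \<Longrightarrow> 2 \<le> card S \<Longrightarrow> w \<in> S \<Longrightarrow> longest_edge (v ` S) \<le> R w / 18"
proof -
  assume S: "S \<in> K" "2 \<le> card S" "w \<in> S"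
  have "\<epsilon>0 * R w \<le> 1 / 18 * R w" using constants(1) infdist_nonneg by (rule mult_right_mono)
  then show ?thesis using edge[OF S] by simp
qed

lemma foot:
  assumes S: "S \<in> K" "2 \<le> card S" "w \<in> S" and x: "x \<in> convex hull S"
  shows foot_infdist: "0 < infdist (\<iota> x) (medial_axis M)"
    and foot_dist: "s \<in> S \<Longrightarrow> dist (v s) (\<pi> (\<iota> x)) \<le> 9/8 * longest_edge (v ` S)"
    and foot_lfs: "15/16 * R w \<le> infdist (\<pi> (\<iota> x)) (medial_axis M)"
    and foot_height: "dist (\<iota> x) (\<pi> (\<iota> x))
      \<le> 81/128 * (longest_edge (v ` S))\<^sup>2 / infdist (\<pi> (\<iota> x)) (medial_axis M)"
proof -
  have w: "w \<in> \<Union>K" using S by blast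
  note n = simplex_near_submanifold[OF M image_simplex(3,4)[OF S(1)] \<iota>_in_hull[OF S(1) x] imageI[OF S(3)]
      Rpos[OF w] edge_le[OF S]]
  show "0 < infdist (\<iota> x) (medial_axis M)" by (rule n(1))
  show "s \<in> S \<Longrightarrow> dist (v s) (\<pi> (\<iota> x)) \<le> 9/8 * longest_edge (v ` S)" by (rule n(2)) blast
  show "15/16 * R w \<le> infdist (\<pi> (\<iota> x)) (medial_axis M)" by (rule n(3))
  show "dist (\<iota> x) (\<pi> (\<iota> x))
      \<le> 81/128 * (longest_edge (v ` S))\<^sup>2 / infdist (\<pi> (\<iota> x)) (medial_axis M)" by (rule n(4))
qed

text \<open>The constant is \<open>(9/8)^2 * 16/15 = 27/20\<close>: the first factor from the
  distance of the vertices to the foot, the second from passing between \<open>infdist\<close> at a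
  vertex and at the foot.\<close>

lemma foot_angle:
  assumes S: "S \<in> K" "2 \<le> card S" and x: "x \<in> convex hull S"
    and c: "sum c (v ` S) = 0" "u = (\<Sum>a\<in>v ` S. c a *\<^sub>R a)"
  shows "norm (u - closest_point (TM (\<pi> (\<iota> x))) u) \<le> 27/20 * (\<epsilon>0 / t0) * norm u"
proof -
  obtain w where wS: "w \<in> S" using simplex(1)[OF S(1)] by blast
  then have w: "w \<in> \<Union>K" using S by blast
  let ?L = "longest_edge (v ` S)" and ?z = "\<pi> (\<iota> x)"
  let ?Rz = "infdist ?z (medial_axis M)"
  have xp: "x \<in> polyhedron K" unfolding polyhedron_def using S x by blast
  have card: "2 \<le> card (v ` S)" using S image_simplex(2) by simp
  note L = longest_edge_pos_of_thickness[OF image_simplex(3)[OF S(1)] card cst(1) thick[OF S]]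
  have Rz: "15/16 * R w \<le> ?Rz" using foot_lfs[OF S wS x] .
  then have Rzp: "0 < ?Rz" using Rpos[OF w] by linarith
  have Lz: "?L \<le> \<epsilon>0 * (16/15 * ?Rz)"
    using edge[OF S wS] mult_left_mono[of "R w" "16/15 * ?Rz" \<epsilon>0] Rz cst(5) by linarith
  have "norm (u - closest_point (TM ?z) u) \<le> (9/8 * ?L)\<^sup>2 / (t0 * ?L * ?Rz) * norm u"
    by (rule simplex_tangent_space_angle[OF M image_simplex(3,4)[OF S(1)] card cst(1) thick[OF S] \<pi>(1)[OF xp] Rzp _ c])
      (use foot_dist[OF S wS x] in blast)
  also have "\<dots> \<le> 27/20 * (\<epsilon>0 / t0) * norm u"
  proof (rule mult_right_mono)
    have "(9/8 * ?L)\<^sup>2 / (t0 * ?L * ?Rz) = 81/64 * (?L / (t0 * ?Rz))"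
      using L by (simp add: power2_eq_square)
    also have "\<dots> \<le> 81/64 * (\<epsilon>0 * (16/15 * ?Rz) / (t0 * ?Rz))"
      using Lz cst(1) Rzp by (intro mult_left_mono divide_right_mono) auto
    also have "\<dots> = 27/20 * (\<epsilon>0 / t0)" using Rzp by simp
    finally show "(9/8 * ?L)\<^sup>2 / (t0 * ?L * ?Rz) \<le> 27/20 * (\<epsilon>0 / t0)" .
  qed simp
  finally show ?thesis .
qed

text \<open>Based at a vertex, all vertices are within one edge length, so the normal part is at
  most \<open>\<epsilon>0 / t0\<close> times the chord. As this is at most \<open>1/18\<close>, the
  chord is at most \<open>18/17\<close> of its projection, which gives the slope form needed by
  \<open>star_chart\<close>.\<close>

lemma vertex_angle:
  assumes S: "S \<in> K" "w \<in> S" and x: "x \<in> convex hull S" and y: "y \<in> convex hull S"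
  shows "norm (\<iota> y - \<iota> x - closest_point (TM (v w)) (\<iota> y - \<iota> x))
      \<le> 18/17 * (\<epsilon>0 / t0) * norm (closest_point (TM (v w)) (\<iota> y - \<iota> x))"
proof (cases "2 \<le> card S")
  case True
  have w: "w \<in> \<Union>K" using S by blast
  let ?L = "longest_edge (v ` S)"
  let ?u = "\<iota> y - \<iota> x" and ?P = "closest_point (TM (v w))"
  obtain c where c: "sum c (v ` S) = 0" "?u = (\<Sum>a\<in>v ` S. c a *\<^sub>R a)"
    by (rule \<iota>_diff[OF S(1) image_simplex(1)[OF S(1)] x y]) (rule that)
  have card: "2 \<le> card (v ` S)" using True image_simplex(2)[OF S(1)] by simp
  note L = longest_edge_pos_of_thickness[OF image_simplex(3)[OF S(1)] card cst(1) thick[OF S(1) True]]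
  have "norm (?u - ?P ?u) \<le> ?L\<^sup>2 / (t0 * ?L * R w) * norm ?u"
    by (rule simplex_tangent_space_angle[OF M image_simplex(3,4)[OF S(1)] card cst(1) thick[OF S(1) True]
          vertex_in_M[OF w] Rpos[OF w] _ c])
      (rule longest_edge_ge[OF image_simplex(3)[OF S(1)] _ imageI[OF S(2)]])
  also have "\<dots> \<le> \<epsilon>0 / t0 * norm ?u"
  proof (rule mult_right_mono)
    have "?L\<^sup>2 / (t0 * ?L * R w) = ?L / (t0 * R w)" using L by (simp add: power2_eq_square)
    also have "\<dots> \<le> \<epsilon>0 * R w / (t0 * R w)"
      using edge[OF S(1) True S(2)] cst(1) Rpos[OF w] by (intro divide_right_mono) auto
    also have "\<dots> = \<epsilon>0 / t0" using Rpos[OF w] by simp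
    finally show "?L\<^sup>2 / (t0 * ?L * R w) \<le> \<epsilon>0 / t0" .
  qed simp
  finally have a: "norm (?u - ?P ?u) \<le> \<epsilon>0 / t0 * norm ?u" .
  have "norm ?u \<le> norm (?P ?u) + norm (?u - ?P ?u)" by (rule norm_triangle_sub)
  moreover have "\<epsilon>0 / t0 * norm ?u \<le> 1 / 18 * norm ?u" using constants(2) by (rule mult_right_mono) simp
  ultimately have "norm ?u \<le> 18/17 * norm (?P ?u)" using a by linarith
  then have "\<epsilon>0 / t0 * norm ?u \<le> \<epsilon>0 / t0 * (18/17 * norm (?P ?u))"
    using cst by (intro mult_left_mono) auto
  then show ?thesis using a by (simp add: algebra_simps)
next
  case False
  have w: "w \<in> \<Union>K" using S by blast
  have "card S = 1" using False simplex(1,2)[OF S(1)] by (metis One_nat_def Suc_leI card_gt_0_iff le_antisym not_less_eq_eq numeral_2_eq_2)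
  then have "S = {w}" using S(2) by (metis card_1_singletonE singletonD)
  then have "x = w" "y = w" using x y by auto
  moreover have "closest_point (TM (v w)) 0 = 0"
    using subspace_0[OF TM_subspace(1)[OF vertex_in_M[OF w]]] by (rule closest_point_self)
  ultimately show ?thesis by simp
qed

lemma star_chart:
  assumes w: "w \<in> \<Union>K"
  shows "star_chart K v \<iota> w (TM (v w)) (18/17 * (\<epsilon>0 / t0))"
proof -
  let ?T = "TM (v w)" and ?F = "tangent_flat M (v w)"
  let ?h = "\<lambda>x. closest_point ?T (\<iota> x - v w)"
  have T: "subspace ?T" using TM_subspace vertex_in_M[OF w] by blast
  have F: "closest_point ?F y = v w + closest_point ?T (y - v w)" for y
    unfolding tangent_flat_def using T by (rule closest_point_flat)
  show ?thesis
  proof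
    show "w \<in> \<Union>K" by fact
    show "subspace ?T" by fact
    show "0 \<le> 18/17 * (\<epsilon>0 / t0)" using cst by simp
    show "inj_on ?h (star_set K w)"
    proof (rule inj_onI)
      fix x y assume xy: "x \<in> star_set K w" "y \<in> star_set K w" "?h x = ?h y"
      then have "closest_point ?F (\<iota> x) = closest_point ?F (\<iota> y)" by (simp add: F)
      then have "\<iota> x = \<iota> y" using inj_onD[OF proj_inj[OF w]] xy by blast
      then show "x = y" using inj_onD[OF star_inj[OF w]] xy by blast
    qed
    obtain Q where Q: "openin (top_of_set ?F) Q" "v w \<in> Q" "Q \<subseteq> closest_point ?F ` \<iota> ` star_set K w"
      using proj_int[OF w] unfolding interior_of_def by blast
    then obtain r where r: "0 < r" "ball (v w) r \<inter> ?F \<subseteq> Q"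
      unfolding openin_contains_ball by blast
    have "ball 0 r \<inter> ?T \<subseteq> ?h ` star_set K w"
    proof
      fix b assume b: "b \<in> ball 0 r \<inter> ?T"
      then have "v w + b \<in> ball (v w) r \<inter> ?F" by (auto simp: tangent_flat_def dist_norm)
      then obtain x where "x \<in> star_set K w" "v w + b = closest_point ?F (\<iota> x)" using r(2) Q(3) by blast
      then show "b \<in> ?h ` star_set K w" by (auto simp: F)
    qed
    then show "\<exists>r>0. ball 0 r \<inter> ?T \<subseteq> ?h ` star_set K w" using r(1) by blast
  qed (rule vertex_angle)
qed

lemma off_medial_axis:
  assumes x: "x \<in> polyhedron K"
  shows "0 < infdist (\<iota> x) (medial_axis M)"
proof -
  obtain S where S: "S \<in> K" "x \<in> convex hull S" using x by (rule polyhedronE)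
  obtain w where w: "w \<in> S" using simplex(1)[OF S(1)] by blast
  show ?thesis
  proof (cases "2 \<le> card S")
    case True
    then show ?thesis using foot_infdist[OF S(1) _ w S(2)] by blast
  next
    case False
    then have "card S = 1" using simplex(1,2)[OF S(1)] by (metis One_nat_def Suc_leI card_gt_0_iff le_antisym not_less_eq_eq numeral_2_eq_2)
    then have "S = {w}" using w by (metis card_1_singletonE singletonD)
    then have "x = w" "w \<in> \<Union>K" using S by auto
    then show ?thesis using Rpos[of w] \<iota>_vertex[of w] by simp
  qed
qed

lemma continuous_on_H: "continuous_on (polyhedron K) (\<lambda>x. \<pi> (\<iota> x))"
proof (rule continuous_on_compose2[OF continuous_on_closest_point_off_medial_axis[OF M(1)] continuous_on_\<iota>])
  show "\<iota> ` polyhedron K \<subseteq> - medial_axis M" using off_medial_axis by force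
qed

lemma foot_normal:
  assumes "x \<in> polyhedron K" "u \<in> TM (\<pi> (\<iota> x))"
  shows "(\<iota> x - \<pi> (\<iota> x)) \<bullet> u = 0"
  by (rule closest_point_normal[OF \<pi>[OF assms(1)] assms(2)])

end

lemma inner_close_ge:
  fixes b d e :: "'a::real_inner"
  assumes "norm (d - b) \<le> k * norm b" "norm (e - b) \<le> k * norm b" "0 \<le> k"
  shows "(1 - 2 * k - k\<^sup>2) * (norm b)\<^sup>2 \<le> d \<bullet> e"
proof -
  have "d \<bullet> e = b \<bullet> b + (d - b) \<bullet> b + b \<bullet> (e - b) + (d - b) \<bullet> (e - b)"
    by (simp add: inner_diff_left inner_diff_right)
  moreover have "- (k * norm b * norm b) \<le> (d - b) \<bullet> b"
    using Cauchy_Schwarz_ineq2[of "d - b" b] mult_right_mono[OF assms(1) norm_ge_zero[of b]] by linarith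
  moreover have "- (norm b * (k * norm b)) \<le> b \<bullet> (e - b)"
    using Cauchy_Schwarz_ineq2[of b "e - b"] mult_left_mono[OF assms(2) norm_ge_zero[of b]] by linarith
  moreover have "- ((k * norm b) * (k * norm b)) \<le> (d - b) \<bullet> (e - b)"
  proof -
    have "norm (d - b) * norm (e - b) \<le> (k * norm b) * (k * norm b)"
      using assms by (intro mult_mono) auto
    then show ?thesis using Cauchy_Schwarz_ineq2[of "d - b" "e - b"] by linarith
  qed
  moreover have "b \<bullet> b = norm b * norm b" by (simp only: dot_square_norm power2_eq_square)
  ultimately show ?thesis by (simp add: algebra_simps power2_eq_square)
qed

section \<open>Local injectivity and openness of the foot map\<close>

context manifold_complex
begin

lemma \<kappa>_bounds: "0 \<le> 18/17 * (\<epsilon>0 / t0)" "18/17 * (\<epsilon>0 / t0) \<le> 1 / 17"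
  using constants(2) cst by auto

lemma card_ge_2: "S \<in> K \<Longrightarrow> x \<in> convex hull S \<Longrightarrow> y \<in> convex hull S \<Longrightarrow> x \<noteq> y \<Longrightarrow> 2 \<le> card S"
proof (rule ccontr)
  assume S: "S \<in> K" "x \<in> convex hull S" "y \<in> convex hull S" "x \<noteq> y" "\<not> 2 \<le> card S"
  have "card S \<noteq> 0" using simplex(1,2)[OF S(1)] by simp
  then have "card S = 1" using S(5) by linarith
  then obtain s where "S = {s}" by (rule card_1_singletonE)
  then show False using S by simp
qed

text \<open>If two points of the star had the same foot, the difference would be normal there, although it
  is close to a tangent direction of a simplex through the first point.\<close>
lemma foot_inj_on_convex:
  assumes w: "w \<in> \<Union>K" and D: "ball b0 r \<inter> TM (v w) \<subseteq> star_chart.h v \<iota> w (TM (v w)) ` star_set K w"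
    and x: "x \<in> star_set K w" "0 < bary K x w" "star_chart.h v \<iota> w (TM (v w)) x \<in> ball b0 r"
    and y: "y \<in> star_set K w" "star_chart.h v \<iota> w (TM (v w)) y \<in> ball b0 r"
    and eq: "\<pi> (\<iota> x) = \<pi> (\<iota> y)"
  shows "x = y"
proof (rule ccontr)
  assume "x \<noteq> y"
  interpret C: star_chart K v \<iota> w "TM (v w)" "18/17 * (\<epsilon>0 / t0)" using w by (rule star_chart)
  let ?z = "\<pi> (\<iota> x)"
  define b where "b = C.h y - C.h x"
  have "b \<noteq> 0" using C.inj_h \<open>x \<noteq> y\<close> x(1) y(1) unfolding b_def by (metis eq_iff_diff_eq_0 inj_onD)
  have bT: "b \<in> TM (v w)" unfolding b_def by (intro subspace_diff C.T C.h_in_T)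
  obtain S u s where S: "S \<in> K" "w \<in> S" "x \<in> convex hull S" "u \<in> convex hull S" and s: "0 < s"
    and hu: "C.h u - C.h x = s *\<^sub>R b"
    using C.direction_in_simplex[OF x(1,2) bT] by metis
  have "u \<noteq> x" using hu s \<open>b \<noteq> 0\<close> by auto
  then have card: "2 \<le> card S" using card_ge_2 S by blast
  have xp: "x \<in> polyhedron K" and yp: "y \<in> polyhedron K" using x(1) y(1) star_subset by auto
  note zM = \<pi>(1)[OF xp]
  define d where "d = \<iota> y - \<iota> x"
  \<comment> \<open>The chord \<open>d\<close> from \<open>x\<close> to \<open>y\<close> and the
    rescaled simplex chord \<open>e\<close> both project to \<open>b\<close>, so both are close to
    \<open>b\<close>; only \<open>e\<close> is known to be nearly tangent at the foot.\<close>
  define e where "e = (1 / s) *\<^sub>R (\<iota> u - \<iota> x)"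
  have d: "norm (d - b) \<le> 1 / 17 * norm b"
    using C.graph_on_convex[OF D x(1,3) y] mult_right_mono[OF \<kappa>_bounds(2) norm_ge_zero[of b]]
    unfolding d_def b_def by linarith
  have "norm (\<iota> u - \<iota> x - s *\<^sub>R b) \<le> 18/17 * (\<epsilon>0 / t0) * norm (s *\<^sub>R b)"
    using C.graph_h[OF S(1,2,3,4)] unfolding hu .
  also have "\<dots> \<le> 1 / 17 * norm (s *\<^sub>R b)" using \<kappa>_bounds(2) by (rule mult_right_mono) simp
  finally have "norm (s *\<^sub>R (e - b)) \<le> 1 / 17 * norm (s *\<^sub>R b)"
    using s by (simp add: e_def scaleR_diff_right)
  then have e: "norm (e - b) \<le> 1 / 17 * norm b" using s by simp
  obtain c where c: "sum c (v ` S) = 0" "\<iota> u - \<iota> x = (\<Sum>a\<in>v ` S. c a *\<^sub>R a)"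
    by (rule \<iota>_diff[OF S(1) image_simplex(1)[OF S(1)] S(3,4)]) (rule that)
  have lin: "linear (closest_point (TM ?z))" using TM_subspace(1)[OF zM] by (rule linear_closest_point_subspace)
  let ?e = "closest_point (TM ?z) e"
  have "e - ?e = (1 / s) *\<^sub>R (\<iota> u - \<iota> x - closest_point (TM ?z) (\<iota> u - \<iota> x))"
    unfolding e_def linear_scale[OF lin] by (simp only: scaleR_diff_right)
  then have "norm (e - ?e) = 1 / s * norm (\<iota> u - \<iota> x - closest_point (TM ?z) (\<iota> u - \<iota> x))"
    using s by simp
  also have "\<dots> \<le> 1 / s * (27/20 * (\<epsilon>0 / t0) * norm (\<iota> u - \<iota> x))"
    by (rule mult_left_mono[OF foot_angle[OF S(1) card S(3) c]]) (use s in simp)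
  also have "\<dots> = 27/20 * (\<epsilon>0 / t0) * norm e" using s by (simp add: e_def)
  also have "\<dots> \<le> 3/40 * norm e" using constants(2) by (intro mult_right_mono) auto
  finally have eP: "norm (e - ?e) \<le> 3/40 * norm e" .
  have ne: "norm e \<le> 18/17 * norm b" using e norm_triangle_sub[of e b] by linarith
  have nd: "norm d \<le> 18/17 * norm b" using d norm_triangle_sub[of d b] by linarith
  have eT: "?e \<in> TM ?z" using TM_subspace(1)[OF zM] by (rule closest_point_subspace_in)
  \<comment> \<open>As the feet coincide, \<open>d\<close> is a difference of two vectors normal
    there, hence orthogonal to the tangential part of \<open>e\<close>.\<close>
  have "d \<bullet> ?e = (\<iota> y - \<pi> (\<iota> y)) \<bullet> ?e - (\<iota> x - ?z) \<bullet> ?e"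
    unfolding eq[symmetric] by (simp add: d_def inner_diff_left)
  also have "\<dots> = 0" using foot_normal[OF xp eT] foot_normal[OF yp, of ?e] eT eq by simp
  finally have "d \<bullet> e = d \<bullet> (e - ?e)" by (simp add: inner_diff_right)
  also have "\<dots> \<le> norm d * norm (e - ?e)" by (rule norm_cauchy_schwarz)
  also have "\<dots> \<le> (18/17 * norm b) * (3/40 * (18/17 * norm b))"
    using nd eP ne by (intro mult_mono) auto
  finally have up: "d \<bullet> e \<le> (18/17 * 3/40 * 18/17) * (norm b)\<^sup>2" by (simp add: power2_eq_square)
  \<comment> \<open>The two bounds on \<open>d \<bullet> e\<close> read \<open>254/289\<close> from
    below and \<open>24.3/289\<close> from above, in units of \<open>(norm b)^2\<close>.\<close>
  have "(1 - 2 * (1/17) - (1/17)\<^sup>2) * (norm b)\<^sup>2 \<le> d \<bullet> e"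
    by (rule inner_close_ge[OF d e]) simp
  then have "(1 - 2 * (1/17) - (1/17)\<^sup>2) * (norm b)\<^sup>2 \<le> (18/17 * 3/40 * 18/17) * (norm b)\<^sup>2"
    using up by linarith
  then have "(norm b)\<^sup>2 \<le> 0" by (simp add: power2_eq_square)
  then show False using \<open>b \<noteq> 0\<close> by simp
qed

lemma bary_pos_exists:
  assumes "x \<in> polyhedron K"
  obtains w where "w \<in> \<Union>K" "0 < bary K x w" "\<And>s. bary K x s \<le> bary K x w"
proof -
  obtain S where S: "S \<in> K" "x \<in> convex hull S" using assms by (rule polyhedronE)
  note f = simplex(1,2)[OF S(1)]
  have "Max (bary K x ` S) \<in> bary K x ` S" using f by (intro Max_in) auto
  then obtain w where w: "w \<in> S" "bary K x w = Max (bary K x ` S)" by auto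
  have le: "bary K x s \<le> bary K x w" for s
  proof (cases "s \<in> S")
    case True
    then show ?thesis using w(2) f(2) by (metis Max_ge finite_imageI imageI)
  next
    case False
    then show ?thesis using bary_outside[OF S False] bary_nonneg[OF S] by simp
  qed
  have "0 < bary K x w"
  proof (rule ccontr)
    assume "\<not> 0 < bary K x w"
    then have "bary K x s = 0" for s using le[of s] bary_nonneg[OF S, of s] by linarith
    then show False using sum_bary[OF S] by simp
  qed
  then show ?thesis using that[of w] w(1) S(1) le by blast
qed

text \<open>Parametrised by an open piece of the tangent space at \<open>v w\<close> and read in a
  chart of \<open>M\<close>, the foot map is an injective continuous map between flats of dimension
  \<open>m\<close>, so invariance of domain applies.\<close>

lemma foot_local_homeomorphism:
  assumes x: "x \<in> polyhedron K" and Q: "open Q" "x \<in> Q"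
  shows "\<exists>W. W \<subseteq> polyhedron K \<inter> Q \<and> openin (top_of_set (polyhedron K)) W \<and> x \<in> W \<and>
    inj_on (\<lambda>x. \<pi> (\<iota> x)) W \<and> openin (top_of_set M) ((\<lambda>x. \<pi> (\<iota> x)) ` W)"
proof -
  let ?H = "\<lambda>x. \<pi> (\<iota> x)" and ?X = "polyhedron K"
  obtain w where w: "w \<in> \<Union>K" "0 < bary K x w" using bary_pos_exists[OF x] by metis
  interpret C: star_chart K v \<iota> w "TM (v w)" "18/17 * (\<epsilon>0 / t0)" using w(1) by (rule star_chart)
  obtain E :: "'a set" and U V \<phi> \<psi> where E: "subspace E" "dim E = m" and UV: "open U" "open V" "?H x \<in> V"
    and hom: "homeomorphism (U \<inter> E) (M \<inter> V) \<phi> \<psi>"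
    using M(2)[unfolded C2_submanifold_def, rule_format, OF \<pi>(1)[OF x]] by metis
  have "openin (top_of_set ?X) (?X \<inter> ?H -` V)"
    by (rule continuous_openin_preimage_gen[OF continuous_on_H UV(2)])
  then obtain O' where O': "open O'" "?X \<inter> ?H -` V = ?X \<inter> O'" unfolding openin_open by blast
  have "x \<in> O'" using O' x UV(3) by blast
  have xSt: "x \<in> star_set K w" using bary_pos_star[OF x w(2)] .
  have "open (Q \<inter> O')" "x \<in> Q \<inter> O'" using Q O'(1) \<open>x \<in> O'\<close> by auto
  then obtain r where r: "0 < r"
    "ball (C.h x) r \<inter> TM (v w) \<subseteq> C.h ` {y \<in> star_set K w. 0 < bary K y w \<and> y \<in> Q \<inter> O'}"
    by (rule C.open_star_interior[OF xSt w(2)]) (rule that)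
  define B where "B = ball (C.h x) r \<inter> TM (v w)"
  \<comment> \<open>The closed star need not be open in the polyhedron. A positive coordinate at
    \<open>w\<close> is an open condition that forces membership in the star.\<close>
  define W where "W = (?X \<inter> (\<lambda>y. bary K y w) -` {0<..}) \<inter> (?X \<inter> C.h -` ball (C.h x) r)"
  have W: "y \<in> star_set K w" "0 < bary K y w" "C.h y \<in> ball (C.h x) r" "y \<in> Q \<inter> O'" if "y \<in> W" for y
  proof -
    show y: "y \<in> star_set K w" "0 < bary K y w" "C.h y \<in> ball (C.h x) r"
      using that bary_pos_star unfolding W_def by auto
    then obtain y' where "y' \<in> star_set K w" "y' \<in> Q \<inter> O'" "C.h y = C.h y'"
      using r(2) C.h_in_T by blast
    then show "y \<in> Q \<inter> O'" using C.inj_h y(1) by (metis inj_onD)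
  qed
  have openW: "openin (top_of_set ?X) W"
    unfolding W_def
    by (intro openin_Int continuous_openin_preimage_gen continuous_on_bary C.continuous_on_h) auto
  have xW: "x \<in> W" unfolding W_def using x w(2) r(1) by simp
  have D: "B \<subseteq> C.h ` star_set K w" using r(2) unfolding B_def by blast
  have injW: "inj_on ?H W"
    using foot_inj_on_convex[OF w(1) D[unfolded B_def]] W by (intro inj_onI) blast
  have hW: "C.h ` W = B"
  proof
    show "C.h ` W \<subseteq> B" using W(3) C.h_in_T unfolding B_def by blast
    show "B \<subseteq> C.h ` W"
    proof
      fix b assume b: "b \<in> B"
      then obtain y where y: "y \<in> star_set K w" "0 < bary K y w" "b = C.h y" using r(2) unfolding B_def by blast
      then have "y \<in> W" using b star_subset unfolding W_def B_def by auto
      then show "b \<in> C.h ` W" using y(3) by blast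
    qed
  qed
  have gW: "C.g ` B = W" unfolding hW[symmetric] using C.g_h W(1) by (force simp: image_iff)
  define k where "k b = \<psi> (?H (C.g b))" for b
  have HV: "?H y \<in> M \<inter> V" if "y \<in> W" for y
    using W(4)[OF that] O'(2) \<pi>(1) that unfolding W_def by blast
  have contg: "continuous_on B C.g" using C.continuous_on_g D by (rule continuous_on_subset)
  have contHg: "continuous_on B (\<lambda>b. ?H (C.g b))"
    by (rule continuous_on_compose2[OF continuous_on_H contg]) (use gW in \<open>auto simp: W_def\<close>)
  have contk: "continuous_on B k"
    unfolding k_def[abs_def]
    by (rule continuous_on_compose2[OF _ contHg, of "M \<inter> V"])
      (use hom HV gW in \<open>auto simp: homeomorphism_def\<close>)
  have psi: "\<psi> ` (M \<inter> V) = U \<inter> E" "\<And>z. z \<in> M \<inter> V \<Longrightarrow> \<phi> (\<psi> z) = z"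
    using hom by (auto simp: homeomorphism_def)
  have kim: "k b \<in> U \<inter> E" if "b \<in> B" for b
    unfolding k_def using HV[of "C.g b"] gW that psi(1) by blast
  have injk: "inj_on k B"
  proof (rule inj_onI)
    fix a b assume ab: "a \<in> B" "b \<in> B" "k a = k b"
    then have g: "C.g a \<in> W" "C.g b \<in> W" using gW by auto
    then have "?H (C.g a) = ?H (C.g b)" using psi(2) HV ab(3) unfolding k_def by metis
    then have "C.g a = C.g b" using inj_onD[OF injW] g by blast
    then show "a = b" using C.h_g ab(1,2) D by (metis subsetD)
  qed
  have "openin (top_of_set E) (k ` B)"
  proof (rule invariance_of_domain_affine_sets[OF _ _ _ _ contk _ injk])
    show "openin (top_of_set (TM (v w))) B" unfolding B_def by (simp add: openin_open_Int Int_commute)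
    show "affine (TM (v w))" "affine E" using C.T E(1) subspace_imp_affine by auto
    show "aff_dim E \<le> aff_dim (TM (v w))"
      using aff_dim_subspace[OF E(1)] aff_dim_subspace[OF C.T] E(2) TM_subspace(2)[OF vertex_in_M[OF w(1)]] by simp
    show "k \<in> B \<rightarrow> E" using kim by blast
  qed
  then have "openin (top_of_set (U \<inter> E)) (k ` B)"
    by (rule openin_subset_trans) (use kim in auto)
  then have "openin (top_of_set (M \<inter> V)) (\<phi> ` k ` B)" by (rule homeomorphism_imp_open_map[OF hom])
  moreover have "\<phi> ` k ` B = ?H ` W"
  proof -
    have "\<phi> ` k ` B = (\<lambda>b. ?H (C.g b)) ` B"
      unfolding image_image k_def using psi(2) HV gW by (intro image_cong refl) blast
    also have "\<dots> = ?H ` W" using gW by (metis image_image)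
    finally show ?thesis .
  qed
  ultimately have "openin (top_of_set (M \<inter> V)) (?H ` W)" by simp
  then have "openin (top_of_set M) (?H ` W)" using openin_open_Int[OF UV(2)] by (rule openin_trans)
  moreover have "W \<subseteq> ?X \<inter> Q" using W(4) unfolding W_def by blast
  ultimately show ?thesis using openW xW injW by (intro exI[of _ W] conjI)
qed

section \<open>The only point with foot at a given vertex\<close>

lemma foot_height_bound:
  assumes S: "S \<in> K" "2 \<le> card S" "w \<in> S" and x: "x \<in> convex hull S"
  shows "dist (\<iota> x) (\<pi> (\<iota> x)) \<le> 27/40 * \<epsilon>0\<^sup>2 * R w"
proof -
  let ?L = "longest_edge (v ` S)" and ?Rz = "infdist (\<pi> (\<iota> x)) (medial_axis M)"
  have w: "w \<in> \<Union>K" using S by blast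
  note Rw = Rpos[OF w]
  have Rz: "15/16 * R w \<le> ?Rz" by (rule foot_lfs[OF S x])
  have card: "2 \<le> card (v ` S)" using S image_simplex(2)[OF S(1)] by simp
  have L0: "0 < ?L" by (rule longest_edge_pos_of_thickness[OF image_simplex(3)[OF S(1)] card cst(1) thick[OF S(1,2)]])
  have L: "?L \<le> \<epsilon>0 * R w" using edge[OF S] by simp
  have "dist (\<iota> x) (\<pi> (\<iota> x)) \<le> 81/128 * ?L\<^sup>2 / ?Rz" by (rule foot_height[OF S x])
  also have "\<dots> \<le> 81/128 * (\<epsilon>0 * R w)\<^sup>2 / (15/16 * R w)"
    using Rw Rz L L0 by (intro frac_le mult_left_mono power_mono) auto
  also have "\<dots> = 27/40 * \<epsilon>0\<^sup>2 * R w" using Rw by (simp add: power2_eq_square)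
  finally show ?thesis .
qed

text \<open>Since \<open>(norm q)^2\<close> is the inner product of \<open>q\<close> with the normal
  vector at the foot, it suffices that \<open>q\<close> is nearly tangent there. A simplex chord
  \<open>e\<close> close to \<open>q\<close> has this property by \<open>foot_angle\<close>.\<close>

lemma normal_projection_small:
  assumes w: "w \<in> \<Union>K" and x: "x \<in> star_set K w" "0 < bary K x w"
  defines "q \<equiv> closest_point (TM (v w)) (\<iota> x - \<pi> (\<iota> x))"
  shows "norm q \<le> 5/2 * (\<epsilon>0 / t0) * dist (\<iota> x) (\<pi> (\<iota> x))"
proof (cases "q = 0")
  case True
  then show ?thesis using cst by simp
next
  case False
  interpret C: star_chart K v \<iota> w "TM (v w)" "18/17 * (\<epsilon>0 / t0)" using w by (rule star_chart)
  let ?z = "\<pi> (\<iota> x)"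
  let ?k = "\<epsilon>0 / t0"
  define n where "n = \<iota> x - ?z"
  have k0: "0 \<le> ?k" using cst by simp
  have qT: "q \<in> TM (v w)" unfolding q_def using C.T by (rule closest_point_subspace_in)
  obtain S u s where S: "S \<in> K" "w \<in> S" "x \<in> convex hull S" "u \<in> convex hull S" and s: "0 < s"
    and hu: "C.h u - C.h x = s *\<^sub>R q"
    using C.direction_in_simplex[OF x qT] by metis
  have "u \<noteq> x" using hu s False by auto
  then have card: "2 \<le> card S" using card_ge_2 S by blast
  have xp: "x \<in> polyhedron K" using x(1) star_subset by auto
  note zM = \<pi>(1)[OF xp]
  define e where "e = (1 / s) *\<^sub>R (\<iota> u - \<iota> x)"
  have "norm (\<iota> u - \<iota> x - s *\<^sub>R q) \<le> 18/17 * ?k * norm (s *\<^sub>R q)"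
    using C.graph_h[OF S(1,2,3,4)] unfolding hu .
  moreover have "\<iota> u - \<iota> x - s *\<^sub>R q = s *\<^sub>R (e - q)"
    using s by (simp add: e_def scaleR_diff_right)
  ultimately have "s * norm (e - q) \<le> s * (18/17 * ?k * norm q)" using s by (simp add: mult_ac)
  then have e: "norm (e - q) \<le> 18/17 * ?k * norm q" using s by (rule mult_left_le_imp_le)
  obtain c where c: "sum c (v ` S) = 0" "\<iota> u - \<iota> x = (\<Sum>a\<in>v ` S. c a *\<^sub>R a)"
    by (rule \<iota>_diff[OF S(1) image_simplex(1)[OF S(1)] S(3,4)]) (rule that)
  have lin: "linear (closest_point (TM ?z))" using TM_subspace(1)[OF zM] by (rule linear_closest_point_subspace)
  let ?e = "closest_point (TM ?z) e"
  have "e - ?e = (1 / s) *\<^sub>R (\<iota> u - \<iota> x - closest_point (TM ?z) (\<iota> u - \<iota> x))"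
    unfolding e_def linear_scale[OF lin] by (simp only: scaleR_diff_right)
  then have "norm (e - ?e) = 1 / s * norm (\<iota> u - \<iota> x - closest_point (TM ?z) (\<iota> u - \<iota> x))"
    using s by simp
  also have "\<dots> \<le> 1 / s * (27/20 * ?k * norm (\<iota> u - \<iota> x))"
    by (rule mult_left_mono[OF foot_angle[OF S(1) card S(3) c]]) (use s in simp)
  also have "\<dots> = 27/20 * ?k * norm e" using s by (simp add: e_def)
  finally have eP: "norm (e - ?e) \<le> 27/20 * ?k * norm e" .
  have "18/17 * ?k * norm q \<le> 1/17 * norm q" using \<kappa>_bounds(2) by (rule mult_right_mono) simp
  then have ne: "norm e \<le> 18/17 * norm q" using e norm_triangle_sub[of e q] by linarith
  have eT: "?e \<in> TM ?z" using TM_subspace(1)[OF zM] by (rule closest_point_subspace_in)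
  have "n \<bullet> ?e = 0" unfolding n_def by (rule foot_normal[OF xp eT])
  then have "n \<bullet> e = n \<bullet> (e - ?e)" by (simp add: inner_diff_right)
  also have "\<dots> \<le> norm n * norm (e - ?e)" by (rule norm_cauchy_schwarz)
  also have "\<dots> \<le> norm n * (27/20 * ?k * (18/17 * norm q))"
    using eP mult_left_mono[OF ne, of "27/20 * ?k"] k0 by (intro mult_left_mono) auto
  finally have ne': "n \<bullet> e \<le> norm n * (27/20 * ?k * (18/17 * norm q))" .
  have "n \<bullet> (q - e) \<le> norm n * norm (q - e)" by (rule norm_cauchy_schwarz)
  also have "\<dots> \<le> norm n * (18/17 * ?k * norm q)"
    using e by (intro mult_left_mono) (auto simp: norm_minus_commute)
  finally have nq: "n \<bullet> (q - e) \<le> norm n * (18/17 * ?k * norm q)" .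
  have "(norm q)\<^sup>2 = n \<bullet> q" unfolding q_def n_def using norm_closest_point_subspace(2)[OF C.T] by simp
  also have "\<dots> = n \<bullet> e + n \<bullet> (q - e)" by (simp add: inner_diff_right)
  also have "\<dots> \<le> norm n * (27/20 * ?k * (18/17 * norm q)) + norm n * (18/17 * ?k * norm q)"
    using ne' nq by (rule add_mono)
  \<comment> \<open>\<open>18/17 * (27/20 + 1) = 423/170\<close>, just below
    \<open>5/2 = 425/170\<close>.\<close>
  also have "\<dots> = (423/170) * (?k * norm n * norm q)" by (simp add: algebra_simps)
  also have "\<dots> \<le> 5/2 * (?k * norm n * norm q)" using k0 by (intro mult_right_mono mult_nonneg_nonneg) auto
  finally have "norm q * norm q \<le> (5/2 * ?k * norm n) * norm q" by (simp add: power2_eq_square)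
  moreover have "0 < norm q" using False by simp
  ultimately have "norm q \<le> 5/2 * ?k * norm n" by (rule mult_right_le_imp_le)
  then show ?thesis by (simp only: n_def dist_norm)
qed

lemma foot_vertex_unique:
  assumes w': "w' \<in> \<Union>K" and x: "x \<in> polyhedron K" and eq: "\<pi> (\<iota> x) = v w'"
  shows "x = w'"
proof -
  obtain w where w: "w \<in> \<Union>K" "0 < bary K x w" and max: "\<And>s. bary K x s \<le> bary K x w"
    using bary_pos_exists[OF x] by metis
  interpret C: star_chart K v \<iota> w "TM (v w)" "18/17 * (\<epsilon>0 / t0)" using w(1) by (rule star_chart)
  have dimT: "dim (TM (v w)) = m" using TM_subspace(2) vertex_in_M w(1) by blast
  have xSt: "x \<in> star_set K w" by (rule bary_pos_star[OF x w(2)])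
  obtain S where S: "S \<in> K" "w \<in> S" "x \<in> convex hull S" "card S = m + 1"
    using C.open_star_pure[OF xSt w(2)] dimT by metis
  have card: "2 \<le> card S" using S(4) m by simp
  note Rw = Rpos[OF w(1)]
  let ?L = "longest_edge (v ` S)"
  have "1 = sum (bary K x) S" using sum_bary[OF S(1,3)] by simp
  also have "\<dots> \<le> real (card S) * bary K x w" using max by (intro sum_bounded_above) auto
  finally have bx: "1 \<le> (real m + 1) * bary K x w" using S(4) by (simp add: add.commute)
  define q where "q = closest_point (TM (v w)) (\<iota> x - \<pi> (\<iota> x))"
  have qT: "q \<in> TM (v w)" unfolding q_def using C.T by (rule closest_point_subspace_in)
  have "norm q \<le> 5/2 * (\<epsilon>0 / t0) * dist (\<iota> x) (\<pi> (\<iota> x))"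
    unfolding q_def by (rule normal_projection_small[OF w(1) xSt w(2)])
  also have "\<dots> \<le> 5/2 * (\<epsilon>0 / t0) * (27/40 * \<epsilon>0\<^sup>2 * R w)"
    using foot_height_bound[OF S(1) card S(2,3)] cst by (intro mult_left_mono) auto
  also have "\<dots> = 27/16 * (\<epsilon>0 * R w / t0) * \<epsilon>0\<^sup>2" by simp
  also have "\<dots> \<le> 27/16 * (\<epsilon>0 * R w / t0) * (\<mu>0 * t0 ^ 4 / 324)"
    using constants(3) cst Rw by (intro mult_left_mono) auto
  also have "\<dots> = 27/16/324 * (\<mu>0 * \<epsilon>0 * R w * t0) * t0\<^sup>2"
    using cst(1) by (simp add: power2_eq_square power4_eq_xxxx)
  also have "\<dots> \<le> 27/16/324 * (\<mu>0 * \<epsilon>0 * R w * t0) * 1"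
    using cst Rw by (intro mult_left_mono) (auto simp: power_le_one)
  finally have q: "norm q \<le> 27/16/324 * (\<mu>0 * \<epsilon>0 * R w * t0)" by simp
  \<comment> \<open>A lower bound for the altitudes of the star simplices with \<open>m + 1\<close>
    vertices, from thickness and the lower edge bound. The factor \<open>18/17\<close> in \<Lambda>
    passes from the simplex to its projection.\<close>
  define a0 where "a0 = t0 * (real m * (\<mu>0 * \<epsilon>0 * R w))"
  have a0: "0 < a0" using cst Rw m by (simp add: a0_def)
  define \<Lambda> where "\<Lambda> = 18/17 / a0"
  have \<Lambda>: "0 \<le> \<Lambda>" using a0 by (simp add: \<Lambda>_def)
  have lip: "\<bar>bary K y w - bary K z w\<bar> \<le> \<Lambda> * norm (C.h y - C.h z)"
    if S': "S' \<in> K" "w \<in> S'" "card S' = dim (TM (v w)) + 1" and y: "y \<in> convex hull S'" and z: "z \<in> convex hull S'"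
    for S' y z
  proof -
    have cS: "card S' = m + 1" using S'(3) dimT by simp
    then have cS': "2 \<le> card S'" "2 \<le> card (v ` S')" using m image_simplex(2)[OF S'(1)] by auto
    obtain c where c: "sum c (v ` S') = 0" "\<iota> y - \<iota> z = (\<Sum>a\<in>v ` S'. c a *\<^sub>R a)"
      "\<And>s. s \<in> S' \<Longrightarrow> c (v s) = bary K y s - bary K z s"
      by (rule \<iota>_diff[OF S'(1) image_simplex(1)[OF S'(1)] z y]) (rule that)
    have "a0 \<le> t0 * (real (card (v ` S') - 1) * longest_edge (v ` S'))"
    proof -
      have cm: "card (v ` S') - 1 = m" using image_simplex(2)[OF S'(1)] cS by simp
      show ?thesis
        unfolding a0_def cm using edge[OF S'(1) cS'(1) S'(2)] cst(1) by (intro mult_left_mono) auto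
    qed
    also have "\<dots> \<le> altitude (v ` S') (v w)"
      by (rule altitude_ge_of_thickness[OF image_simplex(3)[OF S'(1)] cS'(2) cst(1) thick[OF S'(1) cS'(1)] imageI[OF S'(2)]])
    finally have "\<bar>c (v w)\<bar> * a0 \<le> \<bar>c (v w)\<bar> * altitude (v ` S') (v w)" by (rule mult_left_mono) simp
    also have "\<dots> \<le> norm (\<iota> y - \<iota> z)"
      unfolding c(2) by (rule altitude_coeff_le[OF image_simplex(3)[OF S'(1)] imageI[OF S'(2)] c(1)])
    also have "\<dots> \<le> norm (C.h y - C.h z) + norm (\<iota> y - \<iota> z - (C.h y - C.h z))" by (rule norm_triangle_sub)
    also have "\<dots> \<le> norm (C.h y - C.h z) + 1/17 * norm (C.h y - C.h z)"
      using C.graph_h[OF S'(1,2) z y] mult_right_mono[OF \<kappa>_bounds(2) norm_ge_zero[of "C.h y - C.h z"]] by linarith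
    finally have "\<bar>bary K y w - bary K z w\<bar> * a0 \<le> 18/17 * norm (C.h y - C.h z)"
      using c(3)[OF S'(2)] by simp
    then show ?thesis using a0 by (simp add: \<Lambda>_def pos_le_divide_eq)
  qed
  define b where "b = C.h x - q"
  have bT: "b \<in> TM (v w)" unfolding b_def by (intro subspace_diff C.T C.h_in_T qT)
  have small: "\<Lambda> * norm (b - C.h x) < bary K x w"
  proof -
    have "\<Lambda> * norm (b - C.h x) = \<Lambda> * norm q" by (simp add: b_def)
    also have "\<dots> \<le> \<Lambda> * (27/16/324 * (a0 / real m))" using q \<Lambda> m by (intro mult_left_mono) (auto simp: a0_def mult_ac)
    also have "\<dots> = 18/17 * 27/16/324 / real m" using a0 by (simp add: \<Lambda>_def)
    \<comment> \<open>The numerator is \<open>3/544\<close>, and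
      \<open>m + 1 \<le> 2 * m\<close>.\<close>
    also have "\<dots> < 1 / (real m + 1)" using m by (simp add: field_simps)
    also have "\<dots> \<le> bary K x w" using bx by (simp add: field_simps)
    finally show ?thesis .
  qed
  have "\<exists>y. y \<in> star_set K w \<and> C.h y = b \<and> 0 < bary K y w"
  proof (rule C.bary_persists[OF xSt bT \<Lambda> small])
    fix S y z assume "S \<in> K" "w \<in> S" "card S = dim (TM (v w)) + 1" "y \<in> convex hull S" "z \<in> convex hull S"
    then show "\<bar>bary K y w - bary K z w\<bar> \<le> \<Lambda> * norm (C.h y - C.h z)" by (rule lip)
  qed blast
  then obtain y where y: "y \<in> star_set K w" "C.h y = b" "0 < bary K y w" by blast
  have lin: "linear (closest_point (TM (v w)))" using C.T by (rule linear_closest_point_subspace)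
  \<comment> \<open>Subtracting \<open>\<iota> x - \<pi> (\<iota> x)\<close> moves
    \<open>\<iota> x\<close> to its foot \<open>v w'\<close>, so \<open>b\<close> is the projection
    of that vertex.\<close>
  have hw': "C.h w' = b"
  proof -
    have "\<iota> w' = v w'" using \<iota>_vertex[OF w'] .
    then have "C.h w' = closest_point (TM (v w)) ((\<iota> x - v w) - (\<iota> x - \<pi> (\<iota> x)))" by (simp add: C.h_def eq)
    also have "\<dots> = b" by (simp only: linear_diff[OF lin] b_def C.h_def q_def)
    finally show ?thesis .
  qed
  have F: "closest_point (tangent_flat M (v w)) z = v w + closest_point (TM (v w)) (z - v w)" for z
    unfolding tangent_flat_def using C.T by (rule closest_point_flat)
  have "dist (v w) (v w') < R w / 15"
    using foot_dist[OF S(1) card S(2,3,2)] edge_le[OF S(1) card S(2)] Rw unfolding eq by linarith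
  moreover have "closest_point (tangent_flat M (v w)) (v w')
      \<in> closest_point (tangent_flat M (v w)) ` \<iota> ` star_set K w"
  proof -
    have "closest_point (tangent_flat M (v w)) (v w') = closest_point (tangent_flat M (v w)) (\<iota> y)"
      using hw' y(2) \<iota>_vertex[OF w'] by (simp add: F C.h_def)
    then show ?thesis using y(1) by blast
  qed
  ultimately have "w' \<in> star_vertices K w" by (rule vertex_sanity[OF w(1) w'])
  then obtain S' where "S' \<in> K" "w \<in> S'" "w' \<in> S'" unfolding star_vertices_def by blast
  then have "w' \<in> star_set K w" unfolding star_set_def using hull_inc[of w' S'] by blast
  then have "w' = y" using inj_onD[OF C.inj_h] hw' y by metis
  \<comment> \<open>The point over \<open>b\<close> is both \<open>y\<close>, with positive
    coordinate at \<open>w\<close>, and the vertex \<open>w'\<close>, whose only nonzero coordinate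
    is its own.\<close>
  then have "w = w'" using y(3) bary_vertex[OF w'] by (auto split: if_splits)
  \<comment> \<open>Now the normal vector at the foot is normal at \<open>v w\<close> itself, so its
    projection vanishes and \<open>x\<close> and \<open>w'\<close> have the same image under
    \<open>C.h\<close>.\<close>
  have "q = 0"
    unfolding q_def
  proof (rule closest_point_subspaceI[OF C.T subspace_0[OF C.T]])
    fix u assume "u \<in> TM (v w)"
    then have "u \<in> TM (\<pi> (\<iota> x))" using eq \<open>w = w'\<close> by simp
    then show "(\<iota> x - \<pi> (\<iota> x) - 0) \<bullet> u = 0" using foot_normal[OF x] by simp
  qed
  then have "C.h x = C.h w'" using hw' by (simp add: b_def)
  then show ?thesis using inj_onD[OF C.inj_h] xSt \<open>w' \<in> star_set K w\<close> by blast
qed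

lemma foot_bij:
  assumes "\<And>C. C \<in> components M \<Longrightarrow> C \<inter> v ` \<Union>K \<noteq> {}"
  shows "bij_betw (\<lambda>x. \<pi> (\<iota> x)) (polyhedron K) M"
proof (rule local_homeomorphism_bij[OF compact_polyhedron continuous_on_H])
  show "(\<lambda>x. \<pi> (\<iota> x)) ` polyhedron K \<subseteq> M" using \<pi>(1) by blast
  show "\<exists>W\<subseteq>polyhedron K \<inter> Q. openin (top_of_set (polyhedron K)) W \<and> x \<in> W \<and>
      inj_on (\<lambda>x. \<pi> (\<iota> x)) W \<and> openin (top_of_set M) ((\<lambda>x. \<pi> (\<iota> x)) ` W)"
    if "x \<in> polyhedron K" "open Q" "x \<in> Q" for x Q
    using foot_local_homeomorphism[OF that] by blast
  fix C assume C: "C \<in> components M"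
  then obtain w where w: "w \<in> \<Union>K" "v w \<in> C" using assms[OF C] by blast
  have "\<pi> (\<iota> w) = v w" using \<iota>_vertex[OF w(1)] vertex_in_M[OF w(1)] closest_point_self by metis
  then show "\<exists>x\<in>polyhedron K. \<pi> (\<iota> x) \<in> C \<and> (\<forall>y\<in>polyhedron K. \<pi> (\<iota> y) = \<pi> (\<iota> x) \<longrightarrow> y = x)"
    using w foot_vertex_unique[OF w(1)] vertex_polyhedron[OF w(1)] by (intro bexI[of _ w]) auto
qed

end

subsection \<open>The triangulation theorem\<close>

lemma embedding_on_inj: "embedding_on S f \<Longrightarrow> inj_on f S"
  unfolding embedding_on_def homeomorphism_def by (metis inj_onI)

lemma lfs_nonneg: "0 \<le> lfs M y"
  by (simp add: lfs_def infdist_nonneg)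

lemma point_of_submanifold_estimates:
  fixes M :: "'a::euclidean_space set"
  assumes M: "closed M" "p \<in> M" and c: "0 \<le> c" and k: "0 \<le> k"
  shows "infdist p M = dist (closest_point M p) p \<and>
    ereal (dist (closest_point M p) p) \<le> ereal c * lfs M (closest_point M p) \<and>
    sin (subspace_angle (direction (affine hull {p})) T) \<le> k"
proof -
  have p: "closest_point M p = p" using M(2) by (rule closest_point_self)
  have "direction (affine hull {p}) - {0} = {}" by (auto simp: direction_def)
  then have "subspace_angle (direction (affine hull {p})) T = 0" by (simp add: subspace_angle_def)
  moreover have "0 \<le> ereal c * lfs M p" using c lfs_nonneg[of M p] by (intro ereal_0_le_mult) auto
  ultimately show ?thesis using M p k by (simp flip: zero_ereal_def)
qed

text \<open>The parameter space is \<open>{0}\<close>, so the quadratic error bound with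
  \<open>e = 0\<close> leaves only \<open>z = y\<close>.\<close>

lemma C2_submanifold_0_isolated:
  fixes M :: "'a::euclidean_space set"
  assumes "C2_submanifold M 0" "y \<in> M"
  obtains r where "0 < r" "M \<inter> ball y r = {y}"
proof -
  obtain E :: "'a set" and D B r where E: "subspace E" "dim E = 0" and D: "linear D" and r: "0 < r"
    and z: "\<And>z. z \<in> M \<Longrightarrow> norm (z - y) < r \<Longrightarrow>
        \<exists>e\<in>E. norm e \<le> (B::real) * norm (z - y) \<and> norm (z - y - D e) \<le> B * (norm e)\<^sup>2"
    by (rule C2_submanifold_linearize[OF assms]) (rule that)
  have "z = y" if "z \<in> M \<inter> ball y r" for z
  proof -
    have "z \<in> M" "norm (z - y) < r" using that by (auto simp: dist_norm norm_minus_commute)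
    then obtain e where e: "e \<in> E" "norm (z - y - D e) \<le> B * (norm e)\<^sup>2" using z by blast
    have "e = 0" using e(1) E(2) dim_eq_0[of E] by auto
    then show ?thesis using e(2) linear_0[OF D] by simp
  qed
  then show ?thesis using that[OF r] assms(2) r by fastforce
qed

theorem mainTheorem15:
  fixes M :: "'a::euclidean_space set" and m :: nat and P :: "'a set"
    and K :: "'b::euclidean_space set set" and v :: "'b \<Rightarrow> 'a" and \<iota> :: "'b \<Rightarrow> 'a"
    and t0 \<mu>0 \<epsilon>0 :: real
  assumes M: "compact M" "C2_submanifold M m"
    and P: "finite P" "P \<subseteq> M" "\<forall>C\<in>components M. C \<inter> P \<noteq> {}"
    and K: "geom_complex K" "bij_betw v (\<Union>K) P" "pl_extension K v \<iota>"
    and star_emb: "\<forall>w\<in>\<Union>K. embedding_on (star_set K w) \<iota>"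
    and a: "\<forall>w\<in>\<Union>K.
              embedding_on (\<iota> ` star_set K w) (closest_point (tangent_flat M (v w))) \<and>
              v w \<in> (top_of_set (tangent_flat M (v w))) interior_of
                      (closest_point (tangent_flat M (v w)) ` \<iota> ` star_set K w)"
    and cst: "0 < t0" "t0 \<le> 1" "0 < \<mu>0" "\<mu>0 \<le> 1" "0 < \<epsilon>0"
                "\<epsilon>0 \<le> sqrt \<mu>0 * t0\<^sup>2 / 18"
    and b: "\<forall>S\<in>K. card S \<ge> 2 \<longrightarrow>
              thickness (v ` S) \<ge> t0 \<and>
              (\<forall>s\<in>S. ereal (\<mu>0 * \<epsilon>0) * lfs M (v s) \<le> ereal (longest_edge (v ` S)) \<and>
                      ereal (longest_edge (v ` S)) \<le> ereal \<epsilon>0 * lfs M (v s))"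
    and c: "\<forall>w\<in>\<Union>K. \<forall>w'\<in>\<Union>K. ereal (dist (v w) (v w')) < lfs M (v w) / 15 \<longrightarrow>
              (closest_point (tangent_flat M (v w)) (v w')
                 \<in> closest_point (tangent_flat M (v w)) ` \<iota> ` star_set K w
               \<longleftrightarrow> w' \<in> star_vertices K w)"
  shows "embedding_on (polyhedron K) \<iota> \<and>
         \<iota> ` polyhedron K \<subseteq> U_set M \<and>
         (\<exists>g. homeomorphism (\<iota> ` polyhedron K) M (closest_point M) g) \<and>
         (\<forall>S\<in>K. \<forall>x\<in>\<iota> ` (convex hull S).
            infdist x M = dist (closest_point M x) x \<and>
            ereal (dist (closest_point M x) x)
              \<le> ereal (7/3 * \<epsilon>0\<^sup>2) * lfs M (closest_point M x) \<and>
            sin (subspace_angle (direction (affine hull (\<iota> ` (convex hull S))))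
                                (tangent_space M (closest_point M x)))
              \<le> 13 * \<epsilon>0 / (4 * t0))"
proof -
  have clM: "closed M" using M(1) by (rule compact_imp_closed)
  have finV: "finite (\<Union>K)" using K(2) P(1) bij_betw_finite by blast
  interpret complex_map K v \<iota> by unfold_locales (use K finV in auto)
  have vP: "v ` \<Union>K = P" and injv: "inj_on v (\<Union>K)" using K(2) by (auto simp: bij_betw_def)
  have vM: "v ` \<Union>K \<subseteq> M" using vP P(2) by simp
  have star_inj: "inj_on \<iota> (star_set K w)" if "w \<in> \<Union>K" for w
    using star_emb that embedding_on_inj by blast
  have proj_inj: "inj_on (closest_point (tangent_flat M (v w))) (\<iota> ` star_set K w)" if "w \<in> \<Union>K" for w
    using a that embedding_on_inj by blast
  have k0: "0 \<le> 13 * \<epsilon>0 / (4 * t0)" using cst by simp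
  have singleton: "infdist x M = dist (closest_point M x) x \<and>
            ereal (dist (closest_point M x) x)
              \<le> ereal (7/3 * \<epsilon>0\<^sup>2) * lfs M (closest_point M x) \<and>
            sin (subspace_angle (direction (affine hull (\<iota> ` (convex hull S))))
                                (tangent_space M (closest_point M x)))
              \<le> 13 * \<epsilon>0 / (4 * t0)"
    if S: "S \<in> K" "S = {s}" and x: "x \<in> \<iota> ` (convex hull S)" for S s x
  proof -
    have s: "s \<in> \<Union>K" using S by blast
    have im: "\<iota> ` (convex hull S) = {v s}" using S(2) \<iota>_vertex[OF s] by simp
    then have xs: "x = v s" using x by simp
    have "v s \<in> M" using vM s by blast
    then show ?thesis unfolding im xs by (rule point_of_submanifold_estimates[OF clM _ _ k0]) simp
  qed
  have T: "subspace (tangent_space M (v w))" "dim (tangent_space M (v w)) = m" if "w \<in> \<Union>K" for w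
    using tangent_space_subspace[OF M(2), of "v w"] vM that by auto
  show ?thesis
  proof (cases "m = 0")
    case True
    \<comment> \<open>The tangent flat is a single point, so projection to it is constant;
      injectivity of the projection and of \<iota> shrink the star to its apex.\<close>
    have star: "star_set K w \<subseteq> {w}" if w: "w \<in> \<Union>K" for w
    proof
      fix x assume x: "x \<in> star_set K w"
      have "tangent_space M (v w) = {0}" using T[OF w] True dim_eq_0 subspace_0 by blast
      then have F: "tangent_flat M (v w) = {v w}" by (simp add: tangent_flat_def)
      have "closest_point {v w} y = v w" for y using closest_point_in_set[of "{v w}" y] by simp
      then have "closest_point (tangent_flat M (v w)) (\<iota> x) = closest_point (tangent_flat M (v w)) (\<iota> w)"
        by (simp only: F)
      then have "\<iota> x = \<iota> w"
        by (rule inj_onD[OF proj_inj[OF w] _ imageI[OF x] imageI[OF vertex_star[OF w]]])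
      then show "x \<in> {w}" using inj_onD[OF star_inj[OF w]] x vertex_star[OF w] by blast
    qed
    have single: "\<exists>s. S = {s}" if S: "S \<in> K" for S
    proof -
      obtain w where w: "w \<in> S" using simplex(1)[OF S] by blast
      have "S \<subseteq> star_set K w"
      proof
        fix x assume "x \<in> S"
        then have "x \<in> convex hull S" by (rule hull_inc)
        then show "x \<in> star_set K w" unfolding star_set_def using S w by blast
      qed
      then show ?thesis using star[of w] S w by blast
    qed
    have poly: "polyhedron K = \<Union>K"
    proof
      show "polyhedron K \<subseteq> \<Union>K" unfolding polyhedron_def using single by fastforce
      show "\<Union>K \<subseteq> polyhedron K" using vertex_polyhedron by blast
    qed
    have \<iota>v: "\<iota> x = v x" if "x \<in> \<Union>K" for x using \<iota>_vertex[OF that] .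
    have MP: "M = P"
    proof
      \<comment> \<open>Points of \<open>M\<close> are isolated, so components are singletons, and
        each of them meets \<open>P\<close>.\<close>
      show "M \<subseteq> P"
      proof
        fix y assume y: "y \<in> M"
        obtain r where r: "0 < r" "M \<inter> ball y r = {y}"
          using C2_submanifold_0_isolated[of M y] M(2) True y by blast
        obtain C where C: "C \<in> components M" "y \<in> C" using y Union_components[of M] by blast
        have "connected C" "C \<subseteq> M" using in_components_connected[OF C(1)] in_components_subset[OF C(1)] by auto
        moreover have "ball y r \<inter> - {y} \<inter> C = {}" using r(2) \<open>C \<subseteq> M\<close> by blast
        moreover have "C \<subseteq> ball y r \<union> - {y}" using r(1) by auto
        ultimately have "ball y r \<inter> C = {} \<or> - {y} \<inter> C = {}"
          using connectedD[of C "ball y r" "- {y}"] by auto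
        moreover have "y \<in> ball y r \<inter> C" using C(2) r(1) by simp
        ultimately have "C = {y}" by blast
        then show "y \<in> P" using P(3) C(1) by blast
      qed
    qed (rule P(2))
    have im: "\<iota> ` polyhedron K = M" unfolding poly using \<iota>v vP MP by auto
    have "inj_on \<iota> (polyhedron K)" unfolding poly using injv \<iota>v by (simp add: inj_on_def)
    then have "embedding_on (polyhedron K) \<iota>"
      unfolding embedding_on_def
      by (intro homeomorphism_compact[OF compact_polyhedron continuous_on_\<iota>]) auto
    moreover have "M \<subseteq> U_set M"
    proof
      fix p assume p: "p \<in> M"
      obtain r where r: "0 < r" "M \<inter> ball p r = {p}"
        using C2_submanifold_0_isolated[of M p] M(2) True p by blast
      \<comment> \<open>Within half the isolation radius every nearest point of \<open>M\<close> is
        within \<open>r\<close> of \<open>p\<close>, hence is \<open>p\<close>.\<close>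
      have "x \<notin> medial_axis M" if x: "x \<in> ball p (r / 2)" for x
      proof
        assume "x \<in> medial_axis M"
        then obtain y z where yz: "y \<in> M" "z \<in> M" "y \<noteq> z" "dist x y = infdist x M" "dist x z = infdist x M"
          unfolding medial_axis_def by blast
        have "infdist x M \<le> dist x p" using p by (rule infdist_le)
        then have "dist x y < r / 2" "dist x z < r / 2" using x yz by (auto simp: dist_commute)
        then have "y \<in> M \<inter> ball p r" "z \<in> M \<inter> ball p r"
          using x yz(1,2) dist_triangle[of p y x] dist_triangle[of p z x] by auto
        then show False using yz(3) unfolding r(2) by simp
      qed
      then have "ball p (r / 2) \<inter> medial_axis M = {}" by blast
      then have "p \<notin> closure (medial_axis M)"
        using r(1) unfolding closure_iff_nhds_not_empty
        by (metis centre_in_ball half_gt_zero inf_commute open_ball order_refl)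
      then show "p \<in> U_set M" by (simp add: U_set_def)
    qed
    moreover have "homeomorphism M M (closest_point M) id"
      by (rule homeomorphismI) (auto simp: closest_point_self intro!: continuous_on_eq[OF continuous_on_id] continuous_on_id)
    ultimately show ?thesis unfolding im using singleton single by blast
  next
    case False
    \<comment> \<open>A star reduced to its apex would project to one point, which has no interior
      in a flat of positive dimension. So every vertex lies on an edge, and hypothesis (b) yields
      that \<open>lfs\<close> is finite and positive there.\<close>
    have big: "\<exists>S\<in>K. w \<in> S \<and> 2 \<le> card S" if w: "w \<in> \<Union>K" for w
    proof (rule ccontr)
      assume n: "\<not> (\<exists>S\<in>K. w \<in> S \<and> 2 \<le> card S)"
      have "x = w" if "x \<in> star_set K w" for x
      proof -
        obtain S where S: "S \<in> K" "w \<in> S" "x \<in> convex hull S" using \<open>x \<in> star_set K w\<close> by (rule starE)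
        have "card S \<noteq> 0" using simplex(1,2)[OF S(1)] by simp
        then have "card S = 1" using n S by fastforce
        then obtain s where "S = {s}" by (rule card_1_singletonE)
        then show ?thesis using S by simp
      qed
      then have "closest_point (tangent_flat M (v w)) ` \<iota> ` star_set K w \<subseteq> {closest_point (tangent_flat M (v w)) (\<iota> w)}"
        by auto
      moreover have F: "v w \<in> tangent_flat M (v w)"
        using subspace_0[OF T(1)[OF w]] by (auto simp: tangent_flat_def)
      then have "closest_point (tangent_flat M (v w)) (\<iota> w) = v w"
        using \<iota>_vertex[OF w] closest_point_self by metis
      ultimately have "v w \<in> (top_of_set (tangent_flat M (v w))) interior_of {v w}"
        using a w interior_of_mono by fastforce
      then obtain Q where Q: "openin (top_of_set (tangent_flat M (v w))) Q" "v w \<in> Q" "Q \<subseteq> {v w}"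
        unfolding interior_of_def by blast
      obtain r where r: "0 < r" "ball (v w) r \<inter> tangent_flat M (v w) \<subseteq> Q"
        using Q(1,2) unfolding openin_contains_ball by blast
      have "\<not> tangent_space M (v w) \<subseteq> {0}" using T(2)[OF w] False dim_eq_0 by metis
      then obtain b where b: "b \<in> tangent_space M (v w)" "b \<noteq> 0" by blast
      define e where "e = (r / (2 * norm b)) *\<^sub>R b"
      have "norm e = r / 2" "e \<noteq> 0" using b(2) r(1) by (auto simp: e_def)
      moreover have "e \<in> tangent_space M (v w)" unfolding e_def using b(1) T(1)[OF w] subspace_scale by blast
      ultimately have "v w + e \<in> ball (v w) r \<inter> tangent_flat M (v w)" using r(1)
        by (auto simp: tangent_flat_def dist_norm)
      then have "v w + e \<in> {v w}" using r(2) Q(3) by blast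
      then show False using \<open>e \<noteq> 0\<close> by simp
    qed
    have ne: "medial_axis M \<noteq> {}" if S: "S \<in> K" "2 \<le> card S" for S
    proof
      \<comment> \<open>Then \<open>lfs\<close> is infinite and the lower edge bound would make a
        finite edge infinite.\<close>
      assume "medial_axis M = {}"
      then have l: "lfs M y = \<infinity>" for y by (simp add: lfs_def)
      obtain s where "s \<in> S" using simplex(1)[OF S(1)] by blast
      then have "ereal (\<mu>0 * \<epsilon>0) * lfs M (v s) \<le> ereal (longest_edge (v ` S))" using b S by blast
      then show False using cst by (simp add: l)
    qed
    have edge: "\<mu>0 * \<epsilon>0 * infdist (v s) (medial_axis M) \<le> longest_edge (v ` S)"
        "longest_edge (v ` S) \<le> \<epsilon>0 * infdist (v s) (medial_axis M)"
      if S: "S \<in> K" "2 \<le> card S" "s \<in> S" for S s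
    proof -
      have l: "lfs M (v s) = ereal (infdist (v s) (medial_axis M))" using ne[OF S(1,2)] by (simp add: lfs_def)
      have "ereal (\<mu>0 * \<epsilon>0) * lfs M (v s) \<le> ereal (longest_edge (v ` S))"
        "ereal (longest_edge (v ` S)) \<le> ereal \<epsilon>0 * lfs M (v s)" using b S by auto
      then show "\<mu>0 * \<epsilon>0 * infdist (v s) (medial_axis M) \<le> longest_edge (v ` S)"
        "longest_edge (v ` S) \<le> \<epsilon>0 * infdist (v s) (medial_axis M)" by (auto simp: l)
    qed
    have thick: "t0 \<le> thickness (v ` S)" if "S \<in> K" "2 \<le> card S" for S
      using b that by blast
    have Rpos: "0 < infdist (v w) (medial_axis M)" if w: "w \<in> \<Union>K" for w
    proof -
      obtain S where S: "S \<in> K" "w \<in> S" "2 \<le> card S" using big[OF w] by blast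
      have "inj_on v S" using injv simplex(4)[OF S(1)] by (rule inj_on_subset)
      then have card: "2 \<le> card (v ` S)" using S(3) by (simp add: card_image)
      have "0 < longest_edge (v ` S)"
        by (rule longest_edge_pos_of_thickness[OF _ card cst(1) thick[OF S(1,3)]]) (use simplex(2)[OF S(1)] in simp)
      then have "0 < \<epsilon>0 * infdist (v w) (medial_axis M)" using edge(2)[OF S(1,3,2)] by linarith
      then show ?thesis using cst(5) by (simp add: zero_less_mult_iff)
    qed
    interpret manifold_complex K v \<iota> M m t0 \<mu>0 \<epsilon>0
    proof unfold_locales
      show "w' \<in> star_vertices K w"
        if w: "w \<in> \<Union>K" "w' \<in> \<Union>K" and d: "dist (v w) (v w') < infdist (v w) (medial_axis M) / 15"
          and p: "closest_point (tangent_flat M (v w)) (v w')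
                 \<in> closest_point (tangent_flat M (v w)) ` \<iota> ` star_set K w" for w w'
      proof -
        obtain S where "S \<in> K" "2 \<le> card S" using big[OF w(1)] by blast
        then have l: "lfs M (v w) = ereal (infdist (v w) (medial_axis M))" using ne by (simp add: lfs_def)
        have "ereal (dist (v w) (v w')) < lfs M (v w) / 15"
          using d by (simp add: l numeral_eq_ereal)
        then show ?thesis using c w p by blast
      qed
    qed (use M False vM injv star_inj proj_inj a cst Rpos thick edge in auto)
    let ?X = "polyhedron K"
    have bij: "bij_betw (\<lambda>x. closest_point M (\<iota> x)) ?X M"
      by (rule foot_bij) (use P(3) vP in blast)
    then have injH: "inj_on (\<lambda>x. closest_point M (\<iota> x)) ?X" and imH: "(\<lambda>x. closest_point M (\<iota> x)) ` ?X = M"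
      by (auto simp: bij_betw_def)
    have "inj_on \<iota> ?X" using injH by (auto simp: inj_on_def)
    then have emb: "embedding_on ?X \<iota>"
      unfolding embedding_on_def
      by (intro homeomorphism_compact[OF compact_polyhedron continuous_on_\<iota>]) auto
    have off: "\<iota> ` ?X \<subseteq> - closure (medial_axis M)"
    proof (intro image_subsetI ComplI)
      fix x assume x: "x \<in> ?X" "\<iota> x \<in> closure (medial_axis M)"
      then have "infdist (\<iota> x) (medial_axis M) = 0"
        by (metis closure_empty empty_iff in_closure_iff_infdist_zero)
      then show False using off_medial_axis[OF x(1)] by simp
    qed
    then have U: "\<iota> ` ?X \<subseteq> U_set M" by (simp add: U_set_def)
    have hom: "\<exists>g. homeomorphism (\<iota> ` ?X) M (closest_point M) g"
    proof (rule homeomorphism_compact)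
      show "compact (\<iota> ` ?X)" using continuous_on_\<iota> compact_polyhedron by (rule compact_continuous_image)
      show "continuous_on (\<iota> ` ?X) (closest_point M)"
        by (rule continuous_on_subset[OF continuous_on_closest_point_off_medial_axis[OF M(1)]])
          (use off closure_subset in blast)
      show "closest_point M ` \<iota> ` ?X = M" using imH by (simp add: image_image)
      show "inj_on (closest_point M) (\<iota> ` ?X)" using injH by (auto simp: inj_on_def)
    qed
    have est: "infdist x M = dist (closest_point M x) x \<and>
            ereal (dist (closest_point M x) x)
              \<le> ereal (7/3 * \<epsilon>0\<^sup>2) * lfs M (closest_point M x) \<and>
            sin (subspace_angle (direction (affine hull (\<iota> ` (convex hull S))))
                                (tangent_space M (closest_point M x)))
              \<le> 13 * \<epsilon>0 / (4 * t0)"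
      if S: "S \<in> K" and x: "x \<in> \<iota> ` (convex hull S)" for S x
    proof (cases "2 \<le> card S")
      case False
      have "card S \<noteq> 0" using simplex(1,2)[OF S] by simp
      then have "card S = 1" using False by linarith
      then obtain s where "S = {s}" by (rule card_1_singletonE)
      then show ?thesis using singleton[OF S _ x] by blast
    next
      case True
      obtain y where y: "y \<in> convex hull S" "x = \<iota> y" using x by blast
      obtain w where wS: "w \<in> S" using simplex(1)[OF S] by blast
      then have "w \<in> \<Union>K" using S by blast
      have yX: "y \<in> ?X" unfolding polyhedron_def using S y(1) by blast
      let ?z = "closest_point M x"
      have zM: "?z \<in> M" using \<pi>(1)[OF yX] y(2) by simp
      then have "M \<noteq> {}" by blast
      then have inf: "infdist x M = dist ?z x" using closest_point_infdist(2)[OF clM] by (simp add: dist_commute)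
      have "dist x ?z \<le> 27/40 * \<epsilon>0\<^sup>2 * infdist (v w) (medial_axis M)"
        unfolding y(2) by (rule foot_height_bound[OF S True wS y(1)])
      also have "\<dots> \<le> 27/40 * \<epsilon>0\<^sup>2 * (16/15 * infdist ?z (medial_axis M))"
        using foot_lfs[OF S True wS y(1)] unfolding y(2) by (intro mult_left_mono) auto
      \<comment> \<open>\<open>27/40\<close> comes from the height bound and \<open>16/15\<close>
        from moving from the vertex to the foot; the product is below \<open>7/3\<close>.\<close>
      also have "\<dots> = 18/25 * (\<epsilon>0\<^sup>2 * infdist ?z (medial_axis M))" by simp
      also have "\<dots> \<le> 7/3 * (\<epsilon>0\<^sup>2 * infdist ?z (medial_axis M))"
        by (intro mult_right_mono mult_nonneg_nonneg infdist_nonneg) auto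
      finally have "dist ?z x \<le> 7/3 * \<epsilon>0\<^sup>2 * infdist ?z (medial_axis M)" by (simp add: dist_commute)
      then have d: "ereal (dist ?z x) \<le> ereal (7/3 * \<epsilon>0\<^sup>2) * lfs M ?z"
        using ne[OF S True] by (simp add: lfs_def)
      have hull: "affine hull (\<iota> ` (convex hull S)) = affine hull (v ` S)"
        unfolding \<iota>_image_hull[OF S] by (rule affine_hull_convex_hull)
      have "\<epsilon>0 / t0 \<le> 1 / 18" by (rule constants(2))
      then have k1: "13 * \<epsilon>0 / (4 * t0) < 1" by simp
      have "sin (subspace_angle (direction (affine hull (v ` S))) (tangent_space M ?z)) \<le> 13 * \<epsilon>0 / (4 * t0)"
      proof (rule sin_subspace_angle_le[OF TM_subspace(1)[OF zM] k0 k1])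
        fix u assume "u \<in> direction (affine hull (v ` S))"
        then obtain c where c: "sum c (v ` S) = 0" "u = (\<Sum>a\<in>v ` S. c a *\<^sub>R a)"
          using direction_affine_hull_finite[OF image_simplex(3)[OF S]] by metis
        have "norm (u - closest_point (tangent_space M ?z) u) \<le> 27/20 * (\<epsilon>0 / t0) * norm u"
          unfolding y(2) by (rule foot_angle[OF S True y(1) c])
        also have "\<dots> \<le> 13 * \<epsilon>0 / (4 * t0) * norm u"
          using cst by (intro mult_right_mono) (auto simp: field_simps)
        finally show "norm (u - closest_point (tangent_space M ?z) u) \<le> 13 * \<epsilon>0 / (4 * t0) * norm u" .
      qed
      then show ?thesis using inf d hull by simp
    qed
    show ?thesis using emb U hom est by blast
  qed
qed

end
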